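(* Let $S$ be a $C^1$-differentiable surface of $\ell^2$ with codimension $\Gamma_{\mathbb N\setminus I_0}$, and let $(S\cap U,I_1,f)$ and $(S\cap U_1,I_2,f')$ be two local coordinate triples of $S$ with $S\cap U\cap U_1\neq\varnothing$. For $E\in\mathscr B(S\cap U)$ put $$\mu(E,S\cap U,I_1,f)=\int_{P_{I_1}E}n_{I_1}\bigl(\mathbf x_{I_1}+f(\mathbf x_{I_1})\bigr)\,F_{\mathbb N\setminus I_1}\bigl(f(\mathbf x_{I_1})\bigr)\,\mathrm d\mu_{I_1}(\mathbf x_{I_1}),$$ and for $E\in\mathscr B(S\cap U_1)$ put $$\mu(E,S\cap U_1,I_2,f')=\int_{P_{I_2}E}n_{I_2}\bigl(\mathbf x_{I_2}+f'(\mathbf x_{I_2})\bigr)\,F_{\mathbb N\setminus I_2}\bigl(f'(\mathbf x_{I_2})\bigr)\,\mathrm d\mu_{I_2}(\mathbf x_{I_2}).$$ Then $\mu(E,S\cap U_1,I_2,f')=\mu(E,S\cap U,I_1,f)$ for every $E\in\mathscr B(S\cap U\cap U_1)$.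
   Context: Basic notation. $\ell^2=\ell^2(\mathbb N)$ is the real Hilbert space with inner product $\langle\cdot,\cdot\rangle$ and standard orthonormal basis $\{\mathbf e_k\}_{k\ge1}$; $\mathbb N=\{1,2,\dots\}$, $\mathbb N_0=\mathbb N\cup\{0\}$. $\{a_i\}_{i\ge1}$ is a fixed sequence of positive numbers with $\sum_i a_i<\infty$. For $I\subset\mathbb N$, $P_I$ is the orthogonal projection of $\ell^2$ onto the closed linear span of $\{\mathbf e_i:i\in I\}$ ($P_\emptyset=0$). $C^1_X(U;Y)$ is the set of continuously Fréchet differentiable maps from an open subset $U$ of a normed space $X$ into a normed space $Y$. $\mathscr B(\cdot)$ is the Borel $\sigma$-algebra. Surfaces. For nonempty $I_1,I_2\subset\mathbb N$ write $I_1\sim I_2$ if $I_2=(I_1\setminus K_1)\sqcup K_2$ for some $K_1\subset I_1$, $K_2\subset\mathbb N\setminus I_1$ with $\mathrm{card}\,K_1=\mathrm{card}\,K_2\in\mathbb N_0$. Fix a nonempty $I_0\subset\mathbb N$ and put $\Gamma_{I_0}=\{I\subset\mathbb N:I\sim I_0\}$. A nonempty $S\subset\ell^2$ is a surface with codimension $\Gamma_{\mathbb N\setminus I_0}$ if each $\mathbf x\in S$ has an open neighborhood $U$ in $\ell^2$, an $I\in\Gamma_{I_0}$, an open neighborhood $U_I$ of $P_I\mathbf x$ in $P_I\ell^2$ and $f\in C^1_{P_I\ell^2}(U_I;P_{\mathbb N\setminus I}\ell^2)$ such that $P_I|_{S\cap U}$ is a homeomorphism onto $U_I$ and $S\cap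 U=\{\mathbf y+f(\mathbf y):\mathbf y\in U_I\}$. Then $(S\cap U,I,f)$ is a local coordinate triple of $S$. A $C^1$-differentiable surface is such a surface with a family of local coordinate triples covering it. The quantity $n_I$. For a local coordinate triple $(S\cap U,I,f)$ and $\mathbf x\in S\cap U$, with $f_j=\langle f,\mathbf e_j\rangle$ and $\mathbf x_I=P_I\mathbf x$, $$n_I(\mathbf x)=\sqrt{1+\sum_{K_1\subset I,\,K_2\subset\mathbb N\setminus I,\,\mathrm{card}K_1=\mathrm{card}K_2\in\mathbb N}\bigl|\det(D_{x_i}f_j(\mathbf x_I))_{i\in K_1,j\in K_2}\bigr|^2}\in[1,\infty]$$ (elements of $K_1,K_2$ in increasing order). Gaussian data. $\mu_I$ is the Borel probability measure on $P_I\ell^2$ obtained by restricting the product measure $\prod_{i\in I}\frac{1}{\sqrt{2\pi a_i^2}}e^{-x_i^2/(2a_i^2)}\mathrm dx_i$. For $I\ne\emptyset$ let $C_I=\{\sum_{i\in I}x_i\mathbf e_i\in P_I\ell^2:\sum_{i\in I}|\ln\frac1{\sqrt{2\pi a_i^2}}-\frac{x_i^2}{2a_i^2}|<\infty\}$, and $F_I(\mathbf x_I)=\prod_{i\in I}\frac1{\sqrt{2\pi a_i^2}}e^{-x_i^2/(2a_i^2)}$ if $\mathbf x_I=\sum_{i\in I}x_i\mathbf e_i\in C_I$, $F_I(\mathbf x_I)=+\infty$ if $\mathbf x_I\in P_I\ell^2\setminus C_I$ (and $F_\emptyset\equiv1$). *)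

theory Defs
  imports "HOL-Probability.Probability" "Jordan_Normal_Form.Determinant"
begin

hide_const (open) Determinants.det

section \<open>The real Hilbert space of square-summable sequences\<close>

text \<open>
  The index set \<open>{1, 2, \<dots>}\<close> is represented by the type \<^typ>\<open>nat\<close>, i.e. the index \<open>k\<close> here is
  the index \<open>k + 1\<close> in the usual numbering; nothing below depends on more than the order.
\<close>

typedef ell2 = "{x :: nat \<Rightarrow> real. summable (\<lambda>i. (x i)\<^sup>2)}"
  morphisms coord Abs_ell2
  by (rule exI[of _ "\<lambda>_. 0"]) simp

lemma ell2_eqI: "(\<And>i. coord x i = coord y i) \<Longrightarrow> x = y"
  by (metis coord_inject ext)

lemma summable_coord_sq: "summable (\<lambda>i. (coord x i)\<^sup>2)"
  using coord[of x] by simp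

lemma coord_Abs: "summable (\<lambda>i. (f i)\<^sup>2) \<Longrightarrow> coord (Abs_ell2 f) i = f i"
  by (simp add: Abs_ell2_inverse)

lemma summable_mult_of_sq:
  fixes f g :: "nat \<Rightarrow> real"
  assumes "summable (\<lambda>i. (f i)\<^sup>2)" "summable (\<lambda>i. (g i)\<^sup>2)"
  shows "summable (\<lambda>i. f i * g i)"
proof (rule summable_comparison_test'[where N = 0])
  show "summable (\<lambda>i. (f i)\<^sup>2 + (g i)\<^sup>2)"
    using assms by (rule summable_add)
  fix n :: nat
  have "2 * \<bar>f n\<bar> * \<bar>g n\<bar> \<le> \<bar>f n\<bar>\<^sup>2 + \<bar>g n\<bar>\<^sup>2"
    by (rule sum_squares_bound)
  moreover have "0 \<le> \<bar>f n\<bar> * \<bar>g n\<bar>" by simp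
  ultimately show "norm (f n * g n) \<le> (f n)\<^sup>2 + (g n)\<^sup>2"
    unfolding real_norm_def abs_mult power2_abs by linarith
qed

lemma summable_sq_add:
  fixes f g :: "nat \<Rightarrow> real"
  assumes "summable (\<lambda>i. (f i)\<^sup>2)" "summable (\<lambda>i. (g i)\<^sup>2)"
  shows "summable (\<lambda>i. (f i + g i)\<^sup>2)"
proof -
  have "summable (\<lambda>i. (f i)\<^sup>2 + (g i)\<^sup>2 + 2 * (f i * g i))"
    by (intro summable_add summable_mult assms summable_mult_of_sq)
  moreover have "(\<lambda>i. (f i)\<^sup>2 + (g i)\<^sup>2 + 2 * (f i * g i)) = (\<lambda>i. (f i + g i)\<^sup>2)"
    by (auto simp: power2_eq_square algebra_simps)
  ultimately show ?thesis by simp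
qed

lemma summable_sq_scale:
  fixes f :: "nat \<Rightarrow> real"
  assumes "summable (\<lambda>i. (f i)\<^sup>2)"
  shows "summable (\<lambda>i. (c * f i)\<^sup>2)"
  using summable_mult[OF assms, of "c\<^sup>2"] by (simp add: power_mult_distrib)

instantiation ell2 :: real_inner
begin

definition "0 = Abs_ell2 (\<lambda>_. 0)"
definition "x + y = Abs_ell2 (\<lambda>i. coord x i + coord y i)"
definition "- x = Abs_ell2 (\<lambda>i. - coord x i)"
definition "x - y = Abs_ell2 (\<lambda>i. coord x i - coord y i)"
definition "c *\<^sub>R x = Abs_ell2 (\<lambda>i. c * coord x i)"
definition "inner x y = (\<Sum>i. coord x i * coord y i)"
definition "norm (x :: ell2) = sqrt (inner x x)"
definition "sgn (x :: ell2) = inverse (norm x) *\<^sub>R x"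
definition "dist x y = norm (x - y :: ell2)"
definition "(uniformity :: (ell2 \<times> ell2) filter) = (INF e\<in>{0 <..}. principal {(x, y). dist x y < e})"
definition "open (U :: ell2 set) = (\<forall>x\<in>U. \<forall>\<^sub>F (x', y) in uniformity. x' = x \<longrightarrow> y \<in> U)"

lemma coord_zero: "coord 0 i = 0"
  by (simp add: zero_ell2_def coord_Abs)

lemma coord_add: "coord (x + y) i = coord x i + coord y i"
  unfolding plus_ell2_def by (rule coord_Abs) (intro summable_sq_add summable_coord_sq)

lemma coord_uminus: "coord (- x) i = - coord x i"
  unfolding uminus_ell2_def by (rule coord_Abs) (simp add: summable_coord_sq)

lemma coord_diff: "coord (x - y) i = coord x i - coord y i"
  unfolding minus_ell2_def
  using summable_sq_add[OF summable_coord_sq[of x], of "\<lambda>i. - coord y i"]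
  by (intro coord_Abs) (simp add: summable_coord_sq)

lemma coord_scaleR: "coord (c *\<^sub>R x) i = c * coord x i"
  unfolding scaleR_ell2_def by (rule coord_Abs) (intro summable_sq_scale summable_coord_sq)

lemmas coord_simps = coord_zero coord_add coord_uminus coord_diff coord_scaleR

lemma summable_coord_mult: "summable (\<lambda>i. coord x i * coord y i)"
  by (intro summable_mult_of_sq summable_coord_sq)

instance
proof
  fix x y z :: ell2 and c d :: real
  show "x + y + z = x + (y + z)" "x + y = y + x" "0 + x = x" "- x + x = 0" "x - y = x + - y"
    "c *\<^sub>R (x + y) = c *\<^sub>R x + c *\<^sub>R y" "(c + d) *\<^sub>R x = c *\<^sub>R x + d *\<^sub>R x"
    "c *\<^sub>R d *\<^sub>R x = (c * d) *\<^sub>R x" "1 *\<^sub>R x = x"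
    by (auto intro!: ell2_eqI simp: coord_simps algebra_simps)
  show "inner x y = inner y x"
    by (simp add: inner_ell2_def mult.commute)
  show "inner (x + y) z = inner x z + inner y z"
    by (simp add: inner_ell2_def coord_simps distrib_right suminf_add summable_coord_mult)
  show "inner (c *\<^sub>R x) y = c * inner x y"
    by (simp add: inner_ell2_def coord_simps mult.assoc suminf_mult summable_coord_mult)
  show "0 \<le> inner x x"
    unfolding inner_ell2_def by (intro suminf_nonneg summable_coord_mult) simp
  show "inner x x = 0 \<longleftrightarrow> x = 0"
  proof
    assume "inner x x = 0"
    then have "\<forall>i. coord x i * coord x i = 0"
      unfolding inner_ell2_def by (subst (asm) suminf_eq_zero_iff) (auto intro: summable_coord_mult)
    then show "x = 0" by (intro ell2_eqI) (simp add: coord_simps)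
  qed (simp add: inner_ell2_def coord_simps)
qed (fact norm_ell2_def sgn_ell2_def dist_ell2_def uniformity_ell2_def open_ell2_def)+

end

lemma norm_ell2_sq: "(norm (x :: ell2))\<^sup>2 = (\<Sum>i. (coord x i)\<^sup>2)"
  unfolding power2_norm_eq_inner inner_ell2_def by (simp add: power2_eq_square)

lemma sum_coord_le_norm: "(\<Sum>i<n. (coord x i)\<^sup>2) \<le> (norm x)\<^sup>2"
  unfolding norm_ell2_sq by (rule sum_le_suminf) (auto intro: summable_coord_sq)

lemma abs_coord_le_norm: "\<bar>coord x i\<bar> \<le> norm x"
proof -
  have "(coord x i)\<^sup>2 \<le> (\<Sum>j<Suc i. (coord x j)\<^sup>2)"
    by (rule member_le_sum) auto
  also have "\<dots> \<le> (norm x)\<^sup>2" by (rule sum_coord_le_norm)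
  finally have "\<bar>coord x i\<bar>\<^sup>2 \<le> (norm x)\<^sup>2" by simp
  then show ?thesis by (rule power2_le_imp_le) simp
qed

instance ell2 :: complete_space
proof
  fix X :: "nat \<Rightarrow> ell2"
  assume X: "Cauchy X"
  have "Cauchy (\<lambda>n. coord (X n) i)" for i
    unfolding Cauchy_def
  proof (intro allI impI)
    fix e :: real assume "0 < e"
    then obtain N where N: "\<And>m n. m \<ge> N \<Longrightarrow> n \<ge> N \<Longrightarrow> dist (X m) (X n) < e"
      using X unfolding Cauchy_def by metis
    have "dist (coord (X m) i) (coord (X n) i) < e" if "m \<ge> N" "n \<ge> N" for m n
      using N[OF that] abs_coord_le_norm[of "X m - X n" i]
      by (simp add: dist_norm coord_simps)
    then show "\<exists>N. \<forall>m\<ge>N. \<forall>n\<ge>N. dist (coord (X m) i) (coord (X n) i) < e" by blast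
  qed
  then have "\<forall>i. \<exists>l. (\<lambda>n. coord (X n) i) \<longlonglongrightarrow> l"
    by (simp add: Cauchy_convergent_iff convergent_def)
  then obtain L where L: "\<And>i. (\<lambda>n. coord (X n) i) \<longlonglongrightarrow> L i" by metis
  have main: "\<exists>N. \<forall>n\<ge>N. \<forall>k. (\<Sum>i<k. (L i - coord (X n) i)\<^sup>2) \<le> e\<^sup>2" if "0 < e" for e
  proof -
    obtain N where N: "\<And>m n. m \<ge> N \<Longrightarrow> n \<ge> N \<Longrightarrow> dist (X m) (X n) < e"
      using X \<open>0 < e\<close> unfolding Cauchy_def by metis
    have "(\<Sum>i<k. (L i - coord (X n) i)\<^sup>2) \<le> e\<^sup>2" if "n \<ge> N" for n k
    proof (rule LIMSEQ_le_const2)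
      show "(\<lambda>m. \<Sum>i<k. (coord (X m) i - coord (X n) i)\<^sup>2) \<longlonglongrightarrow> (\<Sum>i<k. (L i - coord (X n) i)\<^sup>2)"
        by (intro tendsto_intros L)
      have "(\<Sum>i<k. (coord (X m) i - coord (X n) i)\<^sup>2) \<le> e\<^sup>2" if "m \<ge> N" for m
      proof -
        have "(\<Sum>i<k. (coord (X m) i - coord (X n) i)\<^sup>2) \<le> (norm (X m - X n))\<^sup>2"
          using sum_coord_le_norm[where x = "X m - X n" and n = k] by (simp add: coord_simps)
        also have "\<dots> \<le> e\<^sup>2"
          using N[OF \<open>m \<ge> N\<close> \<open>n \<ge> N\<close>] by (intro power_mono) (auto simp: dist_norm)
        finally show ?thesis .
      qed
      then show "\<exists>M. \<forall>m\<ge>M. (\<Sum>i<k. (coord (X m) i - coord (X n) i)\<^sup>2) \<le> e\<^sup>2" by blast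
    qed
    then show ?thesis by blast
  qed
  have summ: "summable (\<lambda>i. (L i - coord (X n) i)\<^sup>2)"
    if "\<forall>k. (\<Sum>i<k. (L i - coord (X n) i)\<^sup>2) \<le> B" for n B
    using that by (intro summableI_nonneg_bounded[where x = B]) auto
  have L_summable: "summable (\<lambda>i. (L i)\<^sup>2)"
  proof -
    obtain N where "\<forall>n\<ge>N. \<forall>k. (\<Sum>i<k. (L i - coord (X n) i)\<^sup>2) \<le> 1\<^sup>2"
      using main[of 1] by auto
    then have "summable (\<lambda>i. (L i - coord (X N) i)\<^sup>2)" by (intro summ) auto
    from summable_sq_add[OF this summable_coord_sq[of "X N"]] show ?thesis by simp
  qed
  have "X \<longlonglongrightarrow> Abs_ell2 L"
  proof (rule metric_LIMSEQ_I)
    fix r :: real assume "0 < r"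
    then obtain N where N: "\<forall>n\<ge>N. \<forall>k. (\<Sum>i<k. (L i - coord (X n) i)\<^sup>2) \<le> (r/2)\<^sup>2"
      using main[of "r/2"] by auto
    have "dist (X n) (Abs_ell2 L) < r" if "n \<ge> N" for n
    proof -
      have "(norm (Abs_ell2 L - X n))\<^sup>2 = (\<Sum>i. (L i - coord (X n) i)\<^sup>2)"
        by (simp add: norm_ell2_sq coord_simps coord_Abs L_summable)
      also have "\<dots> \<le> (r/2)\<^sup>2"
        using N that by (intro suminf_le_const summ) auto
      finally have "norm (Abs_ell2 L - X n) \<le> r/2"
        by (rule power2_le_imp_le) (use \<open>0 < r\<close> in simp)
      then show ?thesis using \<open>0 < r\<close> by (simp add: dist_norm norm_minus_commute)
    qed
    then show "\<exists>no. \<forall>n\<ge>no. dist (X n) (Abs_ell2 L) < r" by blast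
  qed
  then show "convergent X" by (rule convergentI)
qed

definition basis_vec :: "nat \<Rightarrow> ell2"
  where "basis_vec k = Abs_ell2 (\<lambda>i. if i = k then 1 else 0)"

lemma coord_basis_vec: "coord (basis_vec k) i = (if i = k then 1 else 0)"
proof -
  have "summable (\<lambda>i. (if i = k then 1 else 0 :: real)\<^sup>2)"
    by (rule summable_finite[of "{k}"]) auto
  then show ?thesis by (simp add: basis_vec_def coord_Abs)
qed

lemma inner_basis_vec: "inner x (basis_vec k) = coord x k"
proof -
  have "(\<lambda>i. coord x i * coord (basis_vec k) i) sums (\<Sum>i\<in>{k}. coord x i * coord (basis_vec k) i)"
    by (rule sums_finite) (auto simp: coord_basis_vec)
  then show ?thesis
    by (simp add: inner_ell2_def sums_iff coord_basis_vec)
qed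

definition orth_proj :: "ell2 set \<Rightarrow> ell2 \<Rightarrow> ell2"
  where "orth_proj W x = (THE y. y \<in> W \<and> (\<forall>w\<in>W. inner (x - y) w = 0))"

definition coord_proj :: "nat set \<Rightarrow> ell2 \<Rightarrow> ell2"
  where "coord_proj I = orth_proj (closure (span (basis_vec ` I)))"

abbreviation coord_space :: "nat set \<Rightarrow> ell2 set"
  where "coord_space I \<equiv> range (coord_proj I)"

lemma coord_sum_basis:
  "coord (\<Sum>i<n. c i *\<^sub>R basis_vec i) k = (if k < n then c k else 0)"
  by (induction n) (auto simp: coord_simps coord_basis_vec less_Suc_eq)

lemma closure_span_basis:
  "closure (span (basis_vec ` I)) = {x. \<forall>i. i \<notin> I \<longrightarrow> coord x i = 0}" (is "_ = ?W")
proof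
  have "closed ?W"
  proof -
    have "?W = (\<Inter>i\<in>-I. {x. inner x (basis_vec i) = 0})"
      by (auto simp: inner_basis_vec)
    moreover have "closed {x. inner x (basis_vec i) = 0}" for i
      by (intro closed_Collect_eq continuous_intros)
    ultimately show ?thesis by (auto intro!: closed_INT)
  qed
  moreover have "span (basis_vec ` I) \<subseteq> ?W"
    by (rule span_minimal) (auto simp: coord_basis_vec subspace_def coord_simps)
  ultimately show "closure (span (basis_vec ` I)) \<subseteq> ?W"
    by (rule closure_minimal[rotated])
next
  show "?W \<subseteq> closure (span (basis_vec ` I))"
  proof
    fix x assume x: "x \<in> ?W"
    define s where "s n = (\<Sum>i<n. coord x i *\<^sub>R basis_vec i)" for n
    have s_span: "s n \<in> span (basis_vec ` I)" for n
      unfolding s_def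
    proof (rule span_sum)
      fix i assume "i \<in> {..<n}"
      show "coord x i *\<^sub>R basis_vec i \<in> span (basis_vec ` I)"
      proof (cases "i \<in> I")
        case True
        then show ?thesis by (intro span_scale span_base) auto
      next
        case False
        then show ?thesis using x by (simp add: span_zero)
      qed
    qed
    have "(norm (s n - x))\<^sup>2 = (\<Sum>i. (coord x (i + n))\<^sup>2)" for n
    proof -
      have "(norm (s n - x))\<^sup>2 = (\<Sum>i. (coord (s n - x) (i + n))\<^sup>2) + (\<Sum>i<n. (coord (s n - x) i)\<^sup>2)"
        unfolding norm_ell2_sq by (rule suminf_split_initial_segment) (rule summable_coord_sq)
      also have "\<dots> = (\<Sum>i. (coord x (i + n))\<^sup>2)"
        by (simp add: coord_simps s_def coord_sum_basis)
      finally show ?thesis .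
    qed
    moreover have "(\<lambda>n. \<Sum>i. (coord x (i + n))\<^sup>2) \<longlonglongrightarrow> 0"
      using suminf_exist_split2[OF summable_coord_sq[of x]] by simp
    ultimately have "(\<lambda>n. (norm (s n - x))\<^sup>2) \<longlonglongrightarrow> 0" by simp
    then have "(\<lambda>n. sqrt ((norm (s n - x))\<^sup>2)) \<longlonglongrightarrow> sqrt 0"
      by (rule tendsto_real_sqrt)
    then have "s \<longlonglongrightarrow> x"
      by (simp add: LIM_zero_iff tendsto_norm_zero_iff)
    then show "x \<in> closure (span (basis_vec ` I))"
      using s_span closure_sequential by blast
  qed
qed

lemma coord_coord_proj: "coord (coord_proj I x) i = (if i \<in> I then coord x i else 0)"
proof -
  define W where "W = {x. \<forall>i. i \<notin> I \<longrightarrow> coord x i = 0}"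
  define y where "y = Abs_ell2 (\<lambda>i. if i \<in> I then coord x i else 0)"
  have "summable (\<lambda>i. (if i \<in> I then coord x i else 0)\<^sup>2)"
    by (rule summable_comparison_test'[OF summable_coord_sq[of x], where N = 0]) auto
  then have y: "coord y i = (if i \<in> I then coord x i else 0)" for i
    by (simp add: y_def coord_Abs)
  have orth: "\<forall>w\<in>W. inner (x - y) w = 0"
  proof
    fix w assume "w \<in> W"
    then have "coord (x - y) i * coord w i = 0" for i
      by (auto simp: W_def coord_simps y)
    then show "inner (x - y) w = 0" by (simp only: inner_ell2_def suminf_zero)
  qed
  have "orth_proj W x = y"
    unfolding orth_proj_def
  proof (rule the_equality)
    show "y \<in> W \<and> (\<forall>w\<in>W. inner (x - y) w = 0)"
      using orth by (simp add: W_def y)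
  next
    fix z assume z: "z \<in> W \<and> (\<forall>w\<in>W. inner (x - z) w = 0)"
    have "y - z \<in> W" using z by (auto simp: W_def coord_simps y)
    then have "inner (x - z) (y - z) - inner (x - y) (y - z) = 0"
      using z orth by simp
    then have "inner (y - z) (y - z) = 0"
      by (simp add: inner_diff_left)
    then show "z = y" by simp
  qed
  then show ?thesis
    by (simp add: coord_proj_def closure_span_basis y flip: W_def)
qed

lemma coord_space_eq: "coord_space I = {x. \<forall>i. i \<notin> I \<longrightarrow> coord x i = 0}"
proof -
  have "x \<in> coord_space I" if "\<forall>i. i \<notin> I \<longrightarrow> coord x i = 0" for x
    using that by (intro range_eqI[of _ _ x] ell2_eqI) (auto simp: coord_coord_proj)
  then show ?thesis by (auto simp: coord_coord_proj)
qed

section \<open>Surfaces\<close>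

definition index_equiv :: "nat set \<Rightarrow> nat set \<Rightarrow> bool"
  where "index_equiv I\<^sub>1 I\<^sub>2 \<longleftrightarrow> I\<^sub>1 \<noteq> {} \<and> I\<^sub>2 \<noteq> {} \<and>
    (\<exists>K\<^sub>1 K\<^sub>2. K\<^sub>1 \<subseteq> I\<^sub>1 \<and> K\<^sub>2 \<subseteq> - I\<^sub>1 \<and> finite K\<^sub>1 \<and> finite K\<^sub>2 \<and> card K\<^sub>1 = card K\<^sub>2 \<and>
      I\<^sub>2 = (I\<^sub>1 - K\<^sub>1) \<union> K\<^sub>2)"

definition index_class :: "nat set \<Rightarrow> nat set set"
  where "index_class I\<^sub>0 = {I. index_equiv I I\<^sub>0}"

text \<open>
  \<open>C1_map X U Y f\<close>: \<open>f\<close> is a continuously Frechet differentiable map from the relatively open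
  subset \<open>U\<close> of the closed subspace \<open>X\<close> into the subspace \<open>Y\<close>. A derivative on \<open>X\<close> is
  represented by its extension \<open>f'\<close> to the whole space that is zero on the orthogonal complement of \<open>X\<close>;
  this extension preserves operator norms, so continuity of \<open>f'\<close> is continuity of the
  derivative in the operator norm on \<open>X\<close>.
\<close>

definition C1_map :: "ell2 set \<Rightarrow> ell2 set \<Rightarrow> ell2 set \<Rightarrow> (ell2 \<Rightarrow> ell2) \<Rightarrow> bool"
  where "C1_map X U Y f \<longleftrightarrow> openin (top_of_set X) U \<and> f ` U \<subseteq> Y \<and>
    (\<exists>f' :: ell2 \<Rightarrow> ell2 \<Rightarrow>\<^sub>L ell2.
      (\<forall>y\<in>U. (f has_derivative blinfun_apply (f' y)) (at y within U) \<and>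
              (\<forall>v. blinfun_apply (f' y) v = blinfun_apply (f' y) (orth_proj X v))) \<and>
      continuous_on U f')"

text \<open>
  \<open>coordinate_triple I\<^sub>0 S V I f\<close>: \<open>(V, I, f)\<close> with \<open>V = S \<inter> U\<close> is a local coordinate triple of \<open>S\<close>.
  The values of \<open>f\<close> matter only on the domain \<open>U\<^sub>I = P\<^sub>I V\<close>.
\<close>

definition coordinate_triple ::
    "nat set \<Rightarrow> ell2 set \<Rightarrow> ell2 set \<Rightarrow> nat set \<Rightarrow> (ell2 \<Rightarrow> ell2) \<Rightarrow> bool"
  where "coordinate_triple I\<^sub>0 S V I f \<longleftrightarrow>
    V \<noteq> {} \<and> I \<in> index_class I\<^sub>0 \<and>
    (\<exists>U U\<^sub>I g. open U \<and> V = S \<inter> U \<and>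
      openin (top_of_set (coord_space I)) U\<^sub>I \<and>
      C1_map (coord_space I) U\<^sub>I (coord_space (- I)) f \<and>
      homeomorphism V U\<^sub>I (coord_proj I) g \<and>
      V = {y + f y | y. y \<in> U\<^sub>I})"

definition surface :: "nat set \<Rightarrow> ell2 set \<Rightarrow> bool"
  where "surface I\<^sub>0 S \<longleftrightarrow> S \<noteq> {} \<and> (\<forall>x\<in>S. \<exists>V I f. x \<in> V \<and> coordinate_triple I\<^sub>0 S V I f)"

definition C1_surface ::
    "nat set \<Rightarrow> ell2 set \<Rightarrow> (ell2 set \<times> nat set \<times> (ell2 \<Rightarrow> ell2)) set \<Rightarrow> bool"
  where "C1_surface I\<^sub>0 S \<A> \<longleftrightarrow> surface I\<^sub>0 S \<and>
    (\<forall>(V, I, f)\<in>\<A>. coordinate_triple I\<^sub>0 S V I f) \<and> S = (\<Union>(V, I, f)\<in>\<A>. V)"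

section \<open>The surface measure of a local coordinate triple\<close>

definition partial_deriv :: "nat \<Rightarrow> nat \<Rightarrow> (ell2 \<Rightarrow> ell2) \<Rightarrow> ell2 \<Rightarrow> real"
  where "partial_deriv i j f y = deriv (\<lambda>t. inner (f (y + t *\<^sub>R basis_vec i)) (basis_vec j)) 0"

definition minor :: "(ell2 \<Rightarrow> ell2) \<Rightarrow> ell2 \<Rightarrow> nat set \<Rightarrow> nat set \<Rightarrow> real"
  where "minor f y K\<^sub>1 K\<^sub>2 = det (mat (card K\<^sub>1) (card K\<^sub>2)
    (\<lambda>(r, s). partial_deriv (sorted_list_of_set K\<^sub>1 ! r) (sorted_list_of_set K\<^sub>2 ! s) f y))"

definition sqrt_ennreal :: "ennreal \<Rightarrow> ennreal"
  where "sqrt_ennreal s = (if s = \<infinity> then \<infinity> else ennreal (sqrt (enn2real s)))"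

definition normal_factor :: "nat set \<Rightarrow> (ell2 \<Rightarrow> ell2) \<Rightarrow> ell2 \<Rightarrow> ennreal"
  where "normal_factor I f x = sqrt_ennreal (1 +
    (\<Sum>\<^sub>\<infinity>(K\<^sub>1, K\<^sub>2)\<in>{(K\<^sub>1, K\<^sub>2). K\<^sub>1 \<subseteq> I \<and> K\<^sub>2 \<subseteq> - I \<and> finite K\<^sub>1 \<and> finite K\<^sub>2 \<and>
        card K\<^sub>1 = card K\<^sub>2 \<and> 1 \<le> card K\<^sub>1}.
      ennreal (\<bar>minor f (coord_proj I x) K\<^sub>1 K\<^sub>2\<bar>\<^sup>2)))"

text \<open>
  The product of the centred normal distributions with standard deviations \<open>a i\<close>, \<open>i \<in> I\<close>, restricted
  from \<open>\<real>\<^sup>I\<close> to the square-summable families (a set of full measure) and regarded as a measure on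
  the Borel subsets of \<open>coord_space I\<close>.
\<close>

definition gauss_measure :: "(nat \<Rightarrow> real) \<Rightarrow> nat set \<Rightarrow> ell2 measure"
  where "gauss_measure a I =
    distr
      (restrict_space (\<Pi>\<^sub>M i\<in>I. density lborel (\<lambda>x. ennreal (normal_density 0 (a i) x)))
        {x. (\<lambda>i. (x i)\<^sup>2) summable_on I})
      (restrict_space borel (coord_space I))
      (\<lambda>x. Abs_ell2 (\<lambda>i. if i \<in> I then x i else 0))"

definition density_domain :: "(nat \<Rightarrow> real) \<Rightarrow> nat set \<Rightarrow> ell2 set"
  where "density_domain a I = {x \<in> coord_space I.
    (\<lambda>i. \<bar>ln (1 / sqrt (2 * pi * (a i)\<^sup>2)) - (coord x i)\<^sup>2 / (2 * (a i)\<^sup>2)\<bar>) summable_on I}"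

definition density_prod :: "(nat \<Rightarrow> real) \<Rightarrow> nat set \<Rightarrow> ell2 \<Rightarrow> ennreal"
  where "density_prod a I x =
    (if I = {} then 1
     else if x \<in> density_domain a I
     then ennreal (\<Prod>i. if i \<in> I then normal_density 0 (a i) (coord x i) else 1)
     else \<infinity>)"

definition local_measure ::
    "(nat \<Rightarrow> real) \<Rightarrow> nat set \<Rightarrow> (ell2 \<Rightarrow> ell2) \<Rightarrow> ell2 set \<Rightarrow> ennreal"
  where "local_measure a I f E =
    (\<integral>\<^sup>+y\<in>coord_proj I ` E. normal_factor I f (y + f y) * density_prod a (- I) (f y) \<partial>gauss_measure a I)"

end

theory Submission
  imports Defs
begin

text \<open>
  Two charts of the surface whose index sets differ by finitely many indices are linked by a
  transition map that keeps all common coordinates and replaces finitely many others. The Gaussian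
  measure is a product measure, so the claim is a change of variables in finitely many coordinates
  followed by Fubini. The proof reduces it to the exchange of a single index \<open>p\<close> for a single index
  \<open>q\<close>, where substitution on the real line is enough.

  Exchange of one index (\<open>local_measure_exchange\<close>). Let the same set \<open>V\<close> be a graph over the index sets
  \<open>J \<union> {p}\<close> and \<open>J \<union> {q}\<close>. For fixed \<open>J\<close>-coordinates, the surface is a curve that both \<open>x\<^sub>p\<close> and
  \<open>x\<^sub>q\<close> parametrize, and \<open>dx\<^sub>q = c dx\<^sub>p\<close> with \<open>c = D\<^sub>p f\<^sub>q\<close>. Disintegrating the Gaussian measure along
  that one coordinate (\<open>nn_integral_gauss_measure_insert\<close>) and substituting
  (\<open>nn_integral_substitution_inj\<close>) leaves a pointwise identity of integrands
  (\<open>surface_density_exchange\<close>). Its Gaussian part says that the one-dimensional density moved out of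
  the product over the normal indices is the one that the base measure gains. Its geometric part says
  that all minors of the derivative are multiplied by the common factor \<open>\<bar>c\<bar>\<close>: the rows
  \<open>e\<^sub>i + f' e\<^sub>i\<close> of both charts span the same tangent space, and one elimination step with pivot \<open>c\<close>
  turns one matrix of rows into the other (\<open>graph_rows_exchange\<close>). The minors are then matched by a
  bijection of index pairs (\<open>minor_sum_exchange\<close>), so that the normal factors differ by \<open>\<bar>c\<bar>\<close>.

  Reduction to one index. If \<open>p\<close> belongs to the first index set only, some partial derivative
  \<open>D\<^sub>p f\<^sub>q\<close> with \<open>q\<close> in the second index set only is nonzero, for otherwise a nonzero tangent vector
  would be projected to zero by the second chart (\<open>graph_row_nonzero\<close>). By an implicit function
  theorem in one variable, the surface is then locally a graph over the index set with \<open>p\<close> replaced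
  by \<open>q\<close> (\<open>C1_graph_exchange\<close>), which is closer to the second one. Induction on the number of differing
  indices proves the claim locally; countably many of these neighbourhoods cover the surface, and
  countable additivity patches the local statements together (\<open>local_measure_independent\<close>).
\<close>

section \<open>Coordinates and projections in \<open>ell2\<close>\<close>

lemma bounded_linear_coord: "bounded_linear (\<lambda>x. coord x i)"
  by (rule bounded_linear_intro[where K = 1]) (use abs_coord_le_norm in \<open>auto simp: coord_simps\<close>)

lemmas continuous_on_coord [continuous_intros] = bounded_linear.continuous_on[OF bounded_linear_coord]
lemmas has_derivative_coord = bounded_linear.has_derivative[OF bounded_linear_coord]

lemma coord_measurable [measurable]: "(\<lambda>x. coord x i) \<in> borel_measurable borel"
  by (intro borel_measurable_continuous_onI continuous_on_coord continuous_on_id)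

lemma norm_coord_proj_le: "norm (coord_proj I x) \<le> norm x"
proof (rule power2_le_imp_le)
  show "(norm (coord_proj I x))\<^sup>2 \<le> (norm x)\<^sup>2"
    unfolding norm_ell2_sq
    by (rule suminf_le) (auto simp: coord_coord_proj summable_coord_sq
        intro!: summable_comparison_test'[OF summable_coord_sq[of x], where N = 0])
qed simp

lemma bounded_linear_coord_proj: "bounded_linear (coord_proj I)"
  by (rule bounded_linear_intro[where K = 1])
     (auto intro!: ell2_eqI simp: coord_coord_proj coord_simps norm_coord_proj_le)

lemmas continuous_on_coord_proj [continuous_intros] =
  bounded_linear.continuous_on[OF bounded_linear_coord_proj]
lemmas has_derivative_coord_proj = bounded_linear.has_derivative[OF bounded_linear_coord_proj]
lemmas coord_proj_linear_simps =
  linear_add[OF bounded_linear.linear[OF bounded_linear_coord_proj]]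
  linear_diff[OF bounded_linear.linear[OF bounded_linear_coord_proj]]
  linear_scale[OF bounded_linear.linear[OF bounded_linear_coord_proj]]
  linear_0[OF bounded_linear.linear[OF bounded_linear_coord_proj]]

lemma coord_proj_idem [simp]: "coord_proj I (coord_proj I x) = coord_proj I x"
  by (rule ell2_eqI) (simp add: coord_coord_proj)

lemma coord_proj_compl: "coord_proj I x + coord_proj (- I) x = x"
  by (rule ell2_eqI) (simp add: coord_coord_proj coord_simps)

lemma coord_proj_compl_zero [simp]: "coord_proj I (coord_proj (- I) x) = 0"
  by (rule ell2_eqI) (simp add: coord_coord_proj coord_simps)

lemma norm_basis_vec [simp]: "norm (basis_vec k) = 1"
  by (simp add: norm_eq_sqrt_inner inner_basis_vec coord_basis_vec)

lemma coord_proj_basis_vec: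
  "coord_proj I (basis_vec k) = (if k \<in> I then basis_vec k else 0)"
  by (rule ell2_eqI) (auto simp: coord_coord_proj coord_basis_vec coord_simps)

lemma tendsto_coord_truncation:
  "(\<lambda>n. \<Sum>i<n. coord x i *\<^sub>R basis_vec i) \<longlonglongrightarrow> x"
proof -
  define s where "s n = (\<Sum>i<n. coord x i *\<^sub>R basis_vec i)" for n
  have "(norm (s n - x))\<^sup>2 = (\<Sum>i. (coord x (i + n))\<^sup>2)" for n
  proof -
    have "(norm (s n - x))\<^sup>2 = (\<Sum>i. (coord (s n - x) (i + n))\<^sup>2) + (\<Sum>i<n. (coord (s n - x) i)\<^sup>2)"
      unfolding norm_ell2_sq by (rule suminf_split_initial_segment) (rule summable_coord_sq)
    also have "\<dots> = (\<Sum>i. (coord x (i + n))\<^sup>2)"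
      by (simp add: coord_simps s_def coord_sum_basis)
    finally show ?thesis .
  qed
  moreover have "(\<lambda>n. \<Sum>i. (coord x (i + n))\<^sup>2) \<longlonglongrightarrow> 0"
    using suminf_exist_split2[OF summable_coord_sq[of x]] by simp
  ultimately have "(\<lambda>n. (norm (s n - x))\<^sup>2) \<longlonglongrightarrow> 0" by simp
  then have "(\<lambda>n. sqrt ((norm (s n - x))\<^sup>2)) \<longlonglongrightarrow> sqrt 0"
    by (rule tendsto_real_sqrt)
  then show ?thesis
    by (simp add: LIM_zero_iff tendsto_norm_zero_iff s_def)
qed

text \<open>
  Finite rational combinations of basis vectors form a countable dense set. This makes \<open>ell2\<close> second
  countable, which is needed both for products of Borel \<sigma>-algebras and for countable subcovers.
\<close>

lemma ell2_rational_dense: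
  fixes x :: ell2
  assumes "0 < e"
  obtains q :: "rat list" where "dist (\<Sum>i<length q. of_rat (q ! i) *\<^sub>R basis_vec i) x < e"
proof -
  obtain n where n: "dist (\<Sum>i<n. coord x i *\<^sub>R basis_vec i) x < e / 2"
    using tendsto_coord_truncation[of x] assms unfolding lim_sequentially
    by (meson half_gt_zero le_refl)
  define d where "d = e / (2 * (real n + 1))"
  have "0 < d" using assms by (simp add: d_def)
  have "\<exists>q. \<bar>of_rat q - coord x i\<bar> < d" for i
  proof -
    obtain q where "coord x i - d < of_rat q" "of_rat q < coord x i"
      using of_rat_dense[of "coord x i - d" "coord x i"] \<open>0 < d\<close> by auto
    then show ?thesis by (intro exI[of _ q]) auto
  qed
  then obtain r where r: "\<And>i. \<bar>of_rat (r i) - coord x i\<bar> < d" by metis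
  define q where "q = map r [0..<n]"
  have "norm ((\<Sum>i<n. of_rat (r i) *\<^sub>R basis_vec i) - (\<Sum>i<n. coord x i *\<^sub>R basis_vec i))
      = norm (\<Sum>i<n. (of_rat (r i) - coord x i) *\<^sub>R basis_vec i)"
    by (simp add: sum_subtractf scaleR_diff_left)
  also have "\<dots> \<le> (\<Sum>i<n. d)"
    by (rule order_trans[OF norm_sum sum_mono]) (use r in \<open>simp add: less_imp_le\<close>)
  also have "\<dots> < e / 2"
    using assms by (simp add: d_def divide_simps)
  finally have "dist (\<Sum>i<n. of_rat (r i) *\<^sub>R basis_vec i) (\<Sum>i<n. coord x i *\<^sub>R basis_vec i) < e / 2"
    by (simp add: dist_norm)
  with n have "dist (\<Sum>i<n. of_rat (r i) *\<^sub>R basis_vec i) x < e"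
    by (metis dist_triangle_half_r dist_commute)
  then have "dist (\<Sum>i<length q. of_rat (q ! i) *\<^sub>R basis_vec i) x < e"
    by (simp add: q_def)
  then show ?thesis by (rule that)
qed

instance ell2 :: second_countable_topology
proof
  define c where "c q = (\<Sum>i<length q. of_rat (q ! i) *\<^sub>R basis_vec i)" for q :: "rat list"
  define B where "B = range (\<lambda>(q, n :: nat). ball (c q) (inverse (Suc n)))"
  have "topological_basis B"
  proof (rule topological_basisI)
    fix O' :: "ell2 set" and x assume "open O'" "x \<in> O'"
    then obtain e where e: "0 < e" "ball x e \<subseteq> O'" by (meson open_contains_ball)
    obtain n where n: "inverse (Suc n) < e / 2"
      using reals_Archimedean[of "e / 2"] e by auto
    obtain q where q: "dist (c q) x < inverse (Suc n)"
      unfolding c_def by (rule ell2_rational_dense[of "inverse (Suc n)" x]) auto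
    have "ball (c q) (inverse (Suc n)) \<subseteq> ball x e"
    proof
      fix y assume "y \<in> ball (c q) (inverse (Suc n))"
      then have "dist x y < inverse (Suc n) + inverse (Suc n)"
        using q dist_triangle[of x y "c q"] by (simp add: dist_commute)
      also have "\<dots> < e" using n by (simp add: field_simps)
      finally show "y \<in> ball x e" by simp
    qed
    then show "\<exists>B'\<in>B. x \<in> B' \<and> B' \<subseteq> O'"
      using q e by (intro bexI[of _ "ball (c q) (inverse (Suc n))"]) (auto simp: B_def)
  qed (auto simp: B_def)
  moreover have "countable B" by (simp add: B_def)
  ultimately show "\<exists>B :: ell2 set set. countable B \<and> open = generate_topology B"
    using topological_basis_imp_subbasis by blast
qed

text \<open>
  A map into \<open>ell2\<close> is the pointwise limit of its truncations, so its coordinates decide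
  measurability.
\<close>

lemma ell2_measurableI:
  assumes "\<And>i. (\<lambda>\<omega>. coord (f \<omega>) i) \<in> borel_measurable M"
  shows "f \<in> borel_measurable M"
proof (rule borel_measurable_LIMSEQ_metric)
  show "(\<lambda>\<omega>. \<Sum>i<n. coord (f \<omega>) i *\<^sub>R basis_vec i) \<in> borel_measurable M" for n
    by (intro borel_measurable_sum borel_measurable_scaleR assms) auto
  show "(\<lambda>n. \<Sum>i<n. coord (f \<omega>) i *\<^sub>R basis_vec i) \<longlonglongrightarrow> f \<omega>" for \<omega>
    by (rule tendsto_coord_truncation)
qed

section \<open>A one-dimensional inverse function theorem\<close>

lemma has_real_derivative_along_line:
  fixes \<phi> :: "'a :: real_normed_vector \<Rightarrow> real"
  assumes "(\<phi> has_derivative \<phi>') (at (x + t *\<^sub>R e))"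
  shows "((\<lambda>t. \<phi> (x + t *\<^sub>R e)) has_real_derivative \<phi>' e) (at t)"
proof -
  have lin: "linear \<phi>'" by (rule has_derivative_linear[OF assms])
  have "((\<lambda>t. x + t *\<^sub>R e) has_derivative (\<lambda>h. h *\<^sub>R e)) (at t)"
    by (auto intro!: derivative_eq_intros)
  then have "((\<lambda>t. \<phi> (x + t *\<^sub>R e)) has_derivative (\<lambda>h. \<phi>' (h *\<^sub>R e))) (at t)"
    by (rule has_derivative_compose) (rule assms)
  moreover have "(\<lambda>h. \<phi>' (h *\<^sub>R e)) = (*) (\<phi>' e)"
    by (auto simp: linear_cmul[OF lin] mult.commute)
  ultimately show ?thesis by (simp add: has_field_derivative_def)
qed

text \<open>
  The map \<open>G\<close> moves points only in the direction \<open>e\<close>, so that inverting it is a scalar problem on each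
  line parallel to \<open>e\<close>: there \<open>\<phi>\<close> is strictly monotone, which gives injectivity, and the intermediate
  value theorem gives openness and continuity of the inverse. The derivative of the inverse is
  explicit, because the equation \<open>v + (\<phi>' v - \<pi> v) e = u\<close> has the solution
  \<open>v = u + ((\<pi> u - \<phi>' u) / \<phi>' e) e\<close>.
\<close>

theorem shear_inverse_function:
  fixes \<phi> \<pi> :: "'a :: real_normed_vector \<Rightarrow> real" and \<phi>' :: "'a \<Rightarrow> 'a \<Rightarrow>\<^sub>L real"
  assumes D: "open D" "x\<^sub>0 \<in> D"
    and der: "\<And>x. x \<in> D \<Longrightarrow> (\<phi> has_derivative \<phi>' x) (at x)"
    and cont: "continuous_on D \<phi>'"
    and \<pi>: "bounded_linear \<pi>" "\<pi> e = 1"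
    and nz: "\<phi>' x\<^sub>0 e \<noteq> 0"
  defines "G \<equiv> \<lambda>x. x + (\<phi> x - \<pi> x) *\<^sub>R e"
  obtains N K K' where "open N" "x\<^sub>0 \<in> N" "N \<subseteq> D" "open (G ` N)"
    "\<And>x. x \<in> N \<Longrightarrow> K (G x) = x"
    "\<And>u. u \<in> G ` N \<Longrightarrow> (K has_derivative blinfun_apply (K' u)) (at u)"
    "continuous_on (G ` N) K'"
proof -
  \<comment> \<open>The factor \<open>c\<close> makes the directional derivative positive, whatever its sign.\<close>
  define c where "c = \<phi>' x\<^sub>0 e"
  have cont_e: "continuous_on D (\<lambda>x. c * \<phi>' x e)"
    by (intro continuous_intros cont)
  have "open {x \<in> D. 0 < c * \<phi>' x e}"
  proof -
    have "{x \<in> D. 0 < c * \<phi>' x e} = (\<lambda>x. c * \<phi>' x e) -` {0<..} \<inter> D" by auto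
    then show ?thesis
      using continuous_open_preimage[OF cont_e \<open>open D\<close>, of "{0<..}"] by (simp add: Int_commute)
  qed
  moreover have "x\<^sub>0 \<in> {x \<in> D. 0 < c * \<phi>' x e}"
    using D nz by (auto simp: c_def zero_less_mult_iff)
  ultimately obtain r where r: "0 < r" "ball x\<^sub>0 r \<subseteq> {x \<in> D. 0 < c * \<phi>' x e}"
    by (meson open_contains_ball)
  define N where "N = ball x\<^sub>0 r"
  have N: "open N" "x\<^sub>0 \<in> N" "N \<subseteq> D" "convex N" and pos: "\<And>x. x \<in> N \<Longrightarrow> 0 < c * \<phi>' x e"
    using r by (auto simp: N_def)
  have line: "x + t *\<^sub>R e \<in> N" if "x + a *\<^sub>R e \<in> N" "x + b *\<^sub>R e \<in> N" "a \<le> t" "t \<le> b" for x a b t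
  proof (cases "a = b")
    case False
    define s where "s = (t - a) / (b - a)"
    have s: "0 \<le> s" "s \<le> 1" "s * (b - a) = t - a"
      using that False by (auto simp: s_def divide_simps)
    have "(1 - s) *\<^sub>R (x + a *\<^sub>R e) + s *\<^sub>R (x + b *\<^sub>R e) \<in> N"
      using that s by (intro convexD[OF \<open>convex N\<close>]) auto
    also have "(1 - s) *\<^sub>R (x + a *\<^sub>R e) + s *\<^sub>R (x + b *\<^sub>R e) = x + (a + s * (b - a)) *\<^sub>R e"
      by (simp add: algebra_simps)
    finally show ?thesis by (simp add: s)
  qed (use that in auto)
  have lder: "((\<lambda>t. \<phi> (x + t *\<^sub>R e)) has_real_derivative \<phi>' (x + t *\<^sub>R e) e) (at t)"
    if "x + t *\<^sub>R e \<in> N" for x t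
    using der N that by (intro has_real_derivative_along_line) auto
  \<comment> \<open>\<open>\<phi>\<close> is strictly monotone on every segment of \<open>N\<close> parallel to \<open>e\<close>.\<close>
  have mono: "c * \<phi> (x + a *\<^sub>R e) < c * \<phi> (x + b *\<^sub>R e)"
    if "x + a *\<^sub>R e \<in> N" "x + b *\<^sub>R e \<in> N" "a < b" for x a b
  proof (rule DERIV_pos_imp_increasing[OF \<open>a < b\<close>])
    fix t assume "a \<le> t" "t \<le> b"
    then have t: "x + t *\<^sub>R e \<in> N" using line that by blast
    show "\<exists>y. ((\<lambda>t. c * \<phi> (x + t *\<^sub>R e)) has_real_derivative y) (at t) \<and> 0 < y"
      by (rule exI conjI DERIV_cmult[OF lder[OF t]] pos[OF t])+
  qed
  have \<pi>_line: "\<pi> (x + t *\<^sub>R e) = \<pi> x + t" for x t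
    using \<pi> by (simp add: linear_add linear_cmul bounded_linear.linear)
  then have \<pi>_G: "\<pi> (G x) = \<phi> x" for x
    by (simp add: G_def)
  have inj: "x = x'" if "x \<in> N" "x' \<in> N" "G x = G x'" for x x'
  proof -
    define k where "k = (\<phi> x - \<pi> x) - (\<phi> x' - \<pi> x')"
    have x': "x' = x + k *\<^sub>R e" using that(3) by (simp add: G_def k_def algebra_simps)
    have eq: "\<phi> x = \<phi> x'" using that(3) \<pi>_G by metis
    have "\<not> 0 < k" using mono[of x 0 k] that eq x' by auto
    moreover have "\<not> k < 0" using mono[of x k 0] that eq x' by auto
    ultimately show ?thesis using x' by simp
  qed
  define K where "K = inv_into N G"
  have KG: "K (G x) = x" if "x \<in> N" for x
    unfolding K_def using inj that by (intro inv_into_f_f inj_onI) auto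
  have \<phi>_cont: "continuous_on N \<phi>"
    by (intro continuous_at_imp_continuous_on ballI has_derivative_continuous[OF der]) (use N in auto)
  \<comment> \<open>The intermediate value theorem gives, at once, that \<open>G\<close> is open and that \<open>K\<close> is continuous.\<close>
  have loc: "\<forall>\<^sub>F u in nhds (G x). \<exists>y\<in>N. G y = u \<and> dist y x < \<epsilon>" if "x \<in> N" "0 < \<epsilon>" for x \<epsilon>
  proof -
    note x_in = that
    define k where "k = \<phi> x - \<pi> x"
    have e0: "e \<noteq> 0" using \<pi> by (auto simp: linear_0 bounded_linear.linear)
    obtain r where r: "0 < r" "ball x r \<subseteq> N" using N(1) x_in by (auto simp: open_contains_ball)
    define d where "d = min (r / (2 * norm e)) (\<epsilon> / (2 * norm e))"
    have d0: "0 < d" using e0 r x_in by (simp add: d_def)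
    have dr: "d * norm e < r" "d * norm e \<le> \<epsilon> / 2"
    proof -
      have "d * norm e \<le> r / (2 * norm e) * norm e"
        by (rule mult_right_mono) (auto simp: d_def)
      then show "d * norm e < r" using e0 r by simp
      have "d * norm e \<le> \<epsilon> / (2 * norm e) * norm e"
        by (rule mult_right_mono) (auto simp: d_def)
      then show "d * norm e \<le> \<epsilon> / 2" using e0 by simp
    qed
    have end_in: "G x + (- k + s) *\<^sub>R e \<in> N" if "\<bar>s\<bar> \<le> d" for s
    proof -
      have "G x + (- k + s) *\<^sub>R e = x + s *\<^sub>R e"
        by (simp add: G_def k_def algebra_simps)
      then have "dist x (G x + (- k + s) *\<^sub>R e) = \<bar>s\<bar> * norm e"
        by (simp add: dist_norm)
      also have "\<dots> \<le> d * norm e" by (rule mult_right_mono[OF that]) simp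
      finally show ?thesis using r dr by auto
    qed
    have near: "\<forall>\<^sub>F u in nhds (G x). u + (- k + s) *\<^sub>R e \<in> N" if "\<bar>s\<bar> \<le> d" for s
    proof -
      have "open ((\<lambda>u. u + (- k + s) *\<^sub>R e) -` N)"
        by (intro continuous_open_vimage N continuous_intros)
      then show ?thesis
        using end_in[OF that] by (auto simp: eventually_nhds)
    qed
    have lim: "((\<lambda>u. c * (\<phi> (u + (- k + s) *\<^sub>R e) - \<pi> u)) \<longlongrightarrow>
        c * (\<phi> (G x + (- k + s) *\<^sub>R e) - \<pi> (G x))) (nhds (G x))" if "\<bar>s\<bar> \<le> d" for s
    proof (intro tendsto_intros bounded_linear.tendsto[OF \<pi>(1)] filterlim_ident)
      have "isCont \<phi> (G x + (- k + s) *\<^sub>R e)"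
        using end_in[OF that] N by (intro has_derivative_continuous[OF der]) auto
      moreover have "((\<lambda>u. u + (- k + s) *\<^sub>R e) \<longlongrightarrow> G x + (- k + s) *\<^sub>R e) (nhds (G x))"
        by (intro tendsto_intros filterlim_ident)
      ultimately show "((\<lambda>u. \<phi> (u + (- k + s) *\<^sub>R e)) \<longlongrightarrow> \<phi> (G x + (- k + s) *\<^sub>R e)) (nhds (G x))"
        by (rule isCont_tendsto_compose)
    qed
    have \<pi>G: "\<pi> (G x) = \<phi> (G x + (- k) *\<^sub>R e)"
    proof -
      have "G x + (- k) *\<^sub>R e = x" by (simp add: G_def k_def algebra_simps)
      then show ?thesis by (simp add: \<pi>_G)
    qed
    have "0 < c * (\<phi> (G x + (- k + d) *\<^sub>R e) - \<pi> (G x))"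
      using mono[of "G x" "- k" "- k + d"] end_in[of 0] end_in[of d] d0
      by (simp add: \<pi>G right_diff_distrib)
    with lim[of d] d0 have up: "\<forall>\<^sub>F u in nhds (G x). 0 < c * (\<phi> (u + (- k + d) *\<^sub>R e) - \<pi> u)"
      by (auto dest: order_tendstoD)
    have "c * (\<phi> (G x + (- k - d) *\<^sub>R e) - \<pi> (G x)) < 0"
      using mono[of "G x" "- k - d" "- k"] end_in[of 0] end_in[of "- d"] d0
      by (simp add: \<pi>G right_diff_distrib)
    with lim[of "- d"] d0 have lo: "\<forall>\<^sub>F u in nhds (G x). c * (\<phi> (u + (- k - d) *\<^sub>R e) - \<pi> u) < 0"
      by (auto dest: order_tendstoD)
    have close: "\<forall>\<^sub>F u in nhds (G x). dist u (G x) < \<epsilon> / 2"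
      unfolding eventually_nhds_metric using x_in by (intro exI[of _ "\<epsilon> / 2"]) simp
    have near1: "\<forall>\<^sub>F u in nhds (G x). u + (- k + d) *\<^sub>R e \<in> N"
      using near[of d] d0 by simp
    have near2: "\<forall>\<^sub>F u in nhds (G x). u + (- k - d) *\<^sub>R e \<in> N"
      using near[of "- d"] d0 by simp
    show ?thesis
      using up lo near1 near2 close
    proof eventually_elim
      case (elim u)
      then have in_a: "u + (- k - d) *\<^sub>R e \<in> N" and in_b: "u + (- k + d) *\<^sub>R e \<in> N"
        by simp_all
      have "continuous_on {- k - d..- k + d} (\<lambda>t. c * (\<phi> (u + t *\<^sub>R e) - \<pi> u))"
      proof (intro continuous_intros continuous_on_compose2[OF \<phi>_cont])
        show "(\<lambda>t. u + t *\<^sub>R e) ` {- k - d..- k + d} \<subseteq> N"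
          using line[OF in_a in_b] by auto
      qed
      then have "\<exists>t\<ge>- k - d. t \<le> - k + d \<and> c * (\<phi> (u + t *\<^sub>R e) - \<pi> u) = 0"
        using elim d0 by (intro IVT') auto
      then obtain t where t: "- k - d \<le> t" "t \<le> - k + d" "c * (\<phi> (u + t *\<^sub>R e) - \<pi> u) = 0"
        by blast
      let ?y = "u + t *\<^sub>R e"
      have yN: "?y \<in> N" using line[OF in_a in_b] t by auto
      have "\<phi> ?y = \<pi> u" using t nz by (simp add: c_def)
      moreover have "\<pi> ?y = \<pi> u + t" by (rule \<pi>_line)
      ultimately have "G ?y = u" by (simp add: G_def algebra_simps)
      moreover have "dist ?y x < \<epsilon>"
      proof -
        have "?y - x = (u - G x) + (t + k) *\<^sub>R e"
          by (simp add: G_def k_def algebra_simps)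
        then have "dist ?y x = norm ((u - G x) + (t + k) *\<^sub>R e)"
          by (simp only: dist_norm)
        also have "\<dots> \<le> norm (u - G x) + \<bar>t + k\<bar> * norm e"
          by (rule norm_triangle_le) simp
        also have "\<bar>t + k\<bar> * norm e \<le> d * norm e"
          using t by (intro mult_right_mono) auto
        finally show ?thesis using elim dr by (simp add: dist_norm)
      qed
      ultimately show ?case using yN by blast
    qed
  qed
  have open_G: "open (G ` N)"
  proof (subst open_subopen, intro ballI)
    fix u assume "u \<in> G ` N"
    then obtain x where x: "x \<in> N" "u = G x" by auto
    then have "\<forall>\<^sub>F v in nhds u. v \<in> G ` N"
      using loc[of x 1] by (auto elim!: eventually_mono)
    then show "\<exists>T. open T \<and> u \<in> T \<and> T \<subseteq> G ` N"
      by (auto simp: eventually_nhds)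
  qed
  have K_cont: "isCont K u" if "u \<in> G ` N" for u
  proof -
    from that obtain x where x: "x \<in> N" "u = G x" by auto
    have "(K \<longlongrightarrow> K u) (nhds u)"
    proof (rule tendstoI)
      fix \<epsilon> :: real assume "0 < \<epsilon>"
      from loc[OF x(1) this] show "\<forall>\<^sub>F v in nhds u. dist (K v) (K u) < \<epsilon>"
        unfolding x(2) by eventually_elim (auto simp: KG x)
    qed
    then show ?thesis
      unfolding isCont_def by (rule tendsto_mono[rotated]) (simp add: at_within_def)
  qed
  \<comment> \<open>The inverse of the derivative of \<open>G\<close> at \<open>K u\<close>.\<close>
  define L where "L u = (id_blinfun :: 'a \<Rightarrow>\<^sub>L 'a) +
    (Blinfun (\<lambda>t :: real. t *\<^sub>R e) o\<^sub>L (inverse (\<phi>' (K u) e) *\<^sub>R (Blinfun \<pi> - \<phi>' (K u))))" for u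
  have L: "L u v = v + ((\<pi> v - \<phi>' (K u) v) / \<phi>' (K u) e) *\<^sub>R e" for u v
    by (simp add: L_def blinfun.bilinear_simps bounded_linear_Blinfun_apply
        bounded_linear_scaleR_left \<pi> divide_inverse mult.commute)
  show ?thesis
  proof (rule that[of N K L])
    show "continuous_on (G ` N) L"
    proof -
      have KN: "K ` G ` N \<subseteq> D" using KG N by auto
      have cK: "continuous_on (G ` N) K"
        using K_cont by (simp add: continuous_at_imp_continuous_on)
      have c': "continuous_on (G ` N) (\<lambda>u. \<phi>' (K u))"
        by (rule continuous_on_compose2[OF cont cK KN])
      have "\<phi>' (K u) e \<noteq> 0" if "u \<in> G ` N" for u
        using that pos by (force simp: KG)
      then show ?thesis unfolding L_def by (intro continuous_intros c') auto
    qed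
    fix u assume u: "u \<in> G ` N"
    then obtain x where x: "x \<in> N" "u = G x" "K u = x" by (auto simp: KG)
    have p0: "\<phi>' x e \<noteq> 0" using pos[OF x(1)] by auto
    have \<phi>'lin: "linear (\<phi>' x)" by (simp add: blinfun.bounded_linear_right bounded_linear.linear)
    show "(K has_derivative blinfun_apply (L u)) (at u)"
    proof (rule has_derivative_inverse_basic)
      show "(G has_derivative (\<lambda>v. v + (\<phi>' x v - \<pi> v) *\<^sub>R e)) (at (K u))"
        unfolding G_def x(3)
        using der[of x] x(1) N
        by (auto intro!: derivative_eq_intros bounded_linear_imp_has_derivative \<pi>)
      show "blinfun_apply (L u) \<circ> (\<lambda>v. v + (\<phi>' x v - \<pi> v) *\<^sub>R e) = id"
      proof
        fix v
        have "\<pi> (v + (\<phi>' x v - \<pi> v) *\<^sub>R e) = \<phi>' x v"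
          by (simp add: \<pi>_line)
        moreover have "\<phi>' x (v + (\<phi>' x v - \<pi> v) *\<^sub>R e) = \<phi>' x v + (\<phi>' x v - \<pi> v) * \<phi>' x e"
          by (simp add: blinfun.bilinear_simps)
        ultimately show "(blinfun_apply (L u) \<circ> (\<lambda>v. v + (\<phi>' x v - \<pi> v) *\<^sub>R e)) v = id v"
          using p0 by (simp add: L x(3) scaleR_left_distrib[symmetric])
      qed
      show "isCont K u" by (rule K_cont[OF u])
    qed (use open_G u KG in \<open>auto simp: blinfun.bounded_linear_right\<close>)
  qed (use N open_G KG in auto)
qed

section \<open>Minors under the exchange of one index\<close>

text \<open>
  Rows and columns are given by lists in any order. The order affects only the sign, and working with
  lists makes it possible to put the pivot row or column first.
\<close>

definition list_minor :: "('a \<Rightarrow> 'b \<Rightarrow> real) \<Rightarrow> 'a list \<Rightarrow> 'b list \<Rightarrow> real"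
  where "list_minor R xs ys = det (mat (length xs) (length xs) (\<lambda>(r, s). R (xs ! r) (ys ! s)))"

lemma abs_list_minor_permute_rows:
  assumes "mset xs = mset xs'" "length ys = length xs"
  shows "\<bar>list_minor R xs' ys\<bar> = \<bar>list_minor R xs ys\<bar>"
proof -
  obtain p where p: "p permutes {..<length xs}" "permute_list p xs = xs'"
    using mset_eq_permutation[OF assms(1)[symmetric]] by metis
  let ?n = "length xs"
  let ?A = "mat ?n ?n (\<lambda>(r, s). R (xs ! r) (ys ! s))"
  have p': "p permutes {0..<?n}" using p by (simp add: atLeast0LessThan)
  have "mat ?n ?n (\<lambda>(r, s). R (xs' ! r) (ys ! s)) = mat ?n ?n (\<lambda>(i, j). ?A $$ (p i, j))"
  proof (rule eq_matI)
    fix i j assume "i < dim_row (mat ?n ?n (\<lambda>(i, j). ?A $$ (p i, j)))"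
      and "j < dim_col (mat ?n ?n (\<lambda>(i, j). ?A $$ (p i, j)))"
    moreover from this have "p i < ?n" using permutes_in_image[OF p'] by auto
    moreover have "xs' ! i = xs ! p i" if "i < ?n"
      using that p permute_list_nth by metis
    ultimately show "mat ?n ?n (\<lambda>(r, s). R (xs' ! r) (ys ! s)) $$ (i, j) =
        mat ?n ?n (\<lambda>(i, j). ?A $$ (p i, j)) $$ (i, j)"
      by simp
  qed auto
  also have "det \<dots> = signof p * det ?A"
    by (rule det_permute_rows[OF _ p']) simp
  moreover have "length xs' = length xs" using assms(1) by (metis size_mset)
  ultimately show ?thesis
    by (simp add: list_minor_def abs_mult sign_def)
qed

lemma list_minor_transpose:
  assumes "length ys = length xs"
  shows "list_minor R xs ys = list_minor (\<lambda>y x. R x y) ys xs"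
proof -
  have "mat (length ys) (length ys) (\<lambda>(r, s). R (xs ! s) (ys ! r)) =
      transpose_mat (mat (length xs) (length xs) (\<lambda>(r, s). R (xs ! r) (ys ! s)))"
    using assms by (intro eq_matI) auto
  moreover have "det (transpose_mat (mat (length xs) (length xs) (\<lambda>(r, s). R (xs ! r) (ys ! s)))) =
      det (mat (length xs) (length xs) (\<lambda>(r, s). R (xs ! r) (ys ! s)))"
    by (rule det_transpose[of _ "length xs"]) simp
  ultimately show ?thesis by (simp add: list_minor_def)
qed

lemma abs_list_minor_permute:
  assumes "mset xs = mset xs'" "mset ys = mset ys'" "length ys = length xs"
  shows "\<bar>list_minor R xs' ys'\<bar> = \<bar>list_minor R xs ys\<bar>"
proof -
  have len: "length xs' = length xs" "length ys' = length ys"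
    using assms by (metis size_mset)+
  have "\<bar>list_minor R xs' ys'\<bar> = \<bar>list_minor (\<lambda>y x. R x y) ys' xs'\<bar>"
    using list_minor_transpose[of ys' xs' R] assms len by simp
  also have "\<dots> = \<bar>list_minor (\<lambda>y x. R x y) ys xs'\<bar>"
    by (rule abs_list_minor_permute_rows) (use assms len in auto)
  also have "\<dots> = \<bar>list_minor R xs' ys\<bar>"
    using list_minor_transpose[of ys xs' R] assms len by simp
  also have "\<dots> = \<bar>list_minor R xs ys\<bar>"
    by (rule abs_list_minor_permute_rows) (use assms len in auto)
  finally show ?thesis .
qed

text \<open>
  Laplace expansion along the first column, which has one nonzero entry.
\<close>

lemma list_minor_Cons:
  assumes "length ys = length xs" and zero: "\<And>z. z \<in> set xs \<Longrightarrow> R z y = 0"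
  shows "list_minor R (x # xs) (y # ys) = R x y * list_minor R xs ys"
proof -
  let ?n = "length xs"
  let ?A = "mat (Suc ?n) (Suc ?n) (\<lambda>(r, s). R ((x # xs) ! r) ((y # ys) ! s))"
  have "det ?A = (\<Sum>i<Suc ?n. ?A $$ (i, 0) * cofactor ?A i 0)"
    by (rule laplace_expansion_column) auto
  also have "\<dots> = (\<Sum>i\<in>{0}. ?A $$ (i, 0) * cofactor ?A i 0)"
  proof (rule sum.mono_neutral_right)
    show "\<forall>i\<in>{..<Suc ?n} - {0}. ?A $$ (i, 0) * cofactor ?A i 0 = 0"
      using zero by (auto simp: nth_Cons split: nat.splits)
  qed auto
  also have "\<dots> = R x y * det (mat_delete ?A 0 0)"
    by (simp add: cofactor_def)
  also have "mat_delete ?A 0 0 = mat ?n ?n (\<lambda>(r, s). R (xs ! r) (ys ! s))"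
    by (rule eq_matI) (auto simp: mat_delete_def)
  finally show ?thesis by (simp add: list_minor_def)
qed

text \<open>The two matrices differ by a triangular factor with diagonal \<open>c, 1, \<dots>, 1\<close>.\<close>

lemma list_minor_row_operation:
  assumes "length ys = Suc (length xs)"
    and p: "\<And>k. R p k = c * R' q k"
    and xs: "\<And>x k. x \<in> set xs \<Longrightarrow> R x k = R' x k + b x * R' q k"
  shows "list_minor R (p # xs) ys = c * list_minor R' (q # xs) ys"
proof -
  let ?n = "length xs"
  let ?A = "mat (Suc ?n) (Suc ?n) (\<lambda>(r, s). R ((p # xs) ! r) (ys ! s))"
  let ?B = "mat (Suc ?n) (Suc ?n) (\<lambda>(r, s). R' ((q # xs) ! r) (ys ! s))"
  define T where "T = mat (Suc ?n) (Suc ?n) (\<lambda>(i, j). case i of 0 \<Rightarrow> if j = 0 then c else 0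
    | Suc i' \<Rightarrow> if j = 0 then b (xs ! i') else if i = j then 1 else 0)"
  have "?A = T * ?B"
  proof (rule eq_matI)
    fix i j assume "i < dim_row (T * ?B)" "j < dim_col (T * ?B)"
    then have i: "i < Suc ?n" and j: "j < Suc ?n" by (auto simp: T_def)
    have "(T * ?B) $$ (i, j) = (\<Sum>k<Suc ?n. T $$ (i, k) * ?B $$ (k, j))"
      using i j by (simp add: T_def scalar_prod_def atLeast0LessThan)
    also have "\<dots> = T $$ (i, 0) * ?B $$ (0, j) + (\<Sum>k<?n. T $$ (i, Suc k) * ?B $$ (Suc k, j))"
      by (rule sum.lessThan_Suc_shift)
    also have "\<dots> = ?A $$ (i, j)"
    proof (cases i)
      case 0
      then have "(\<Sum>k<?n. T $$ (i, Suc k) * ?B $$ (Suc k, j)) = 0"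
        by (intro sum.neutral) (auto simp: T_def)
      then show ?thesis using 0 i j by (simp add: T_def p)
    next
      case (Suc i')
      then have "(\<Sum>k<?n. T $$ (i, Suc k) * ?B $$ (Suc k, j)) =
          (\<Sum>k<?n. if k = i' then R' (xs ! k) (ys ! j) else 0)"
        using i j by (intro sum.cong) (auto simp: T_def)
      also have "\<dots> = R' (xs ! i') (ys ! j)"
        using Suc i by simp
      finally show ?thesis using Suc i j xs[of "xs ! i'"] by (simp add: T_def)
    qed
    finally show "?A $$ (i, j) = (T * ?B) $$ (i, j)" ..
  qed (auto simp: T_def)
  moreover have "det (T * ?B) = det T * det ?B"
    by (rule det_mult[of _ "Suc ?n"]) (auto simp: T_def)
  moreover have "det T = prod_list (diag_mat T)"
    by (rule det_lower_triangular[of "Suc ?n"]) (auto simp: T_def split: nat.splits)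
  moreover have "diag_mat T = c # replicate ?n 1"
  proof (rule nth_equalityI)
    show "length (diag_mat T) = length (c # replicate ?n 1)"
      by (simp add: diag_mat_def T_def)
    fix i assume "i < length (diag_mat T)"
    then show "diag_mat T ! i = (c # replicate ?n 1) ! i"
      by (cases i) (auto simp: diag_mat_def T_def simp del: upt_Suc)
  qed
  ultimately show ?thesis by (simp add: list_minor_def)
qed

definition abs_minor :: "(nat \<Rightarrow> nat \<Rightarrow> real) \<Rightarrow> nat set \<Rightarrow> nat set \<Rightarrow> real"
  where "abs_minor R K\<^sub>1 K\<^sub>2 = \<bar>list_minor R (sorted_list_of_set K\<^sub>1) (sorted_list_of_set K\<^sub>2)\<bar>"

lemma abs_minor_eq:
  assumes "distinct xs" "distinct ys" "length ys = length xs"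
  shows "abs_minor R (set xs) (set ys) = \<bar>list_minor R xs ys\<bar>"
  unfolding abs_minor_def
proof (rule abs_list_minor_permute)
  show "mset xs = mset (sorted_list_of_set (set xs))"
    by (subst set_eq_iff_mset_eq_distinct[symmetric]) (use assms in simp_all)
  show "mset ys = mset (sorted_list_of_set (set ys))"
    by (subst set_eq_iff_mset_eq_distinct[symmetric]) (use assms in simp_all)
qed fact

lemma abs_minor_insert:
  assumes "finite K\<^sub>1" "finite K\<^sub>2" "card K\<^sub>1 = card K\<^sub>2" "p \<notin> K\<^sub>1" "p \<notin> K\<^sub>2"
    and "R p p = 1" "\<And>z. z \<in> K\<^sub>1 \<Longrightarrow> R z p = 0"
  shows "abs_minor R (insert p K\<^sub>1) (insert p K\<^sub>2) = abs_minor R K\<^sub>1 K\<^sub>2"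
proof -
  obtain xs ys where xs: "set xs = K\<^sub>1" "distinct xs" and ys: "set ys = K\<^sub>2" "distinct ys"
    using finite_distinct_list[OF assms(1)] finite_distinct_list[OF assms(2)] by blast
  have len: "length ys = length xs" using distinct_card[OF xs(2)] distinct_card[OF ys(2)] assms(3) xs ys by simp
  have "abs_minor R (set (p # xs)) (set (p # ys)) = \<bar>list_minor R (p # xs) (p # ys)\<bar>"
    by (rule abs_minor_eq) (use xs ys len assms in auto)
  also have "\<dots> = \<bar>list_minor R xs ys\<bar>"
    by (subst list_minor_Cons) (use xs ys len assms in auto)
  also have "\<dots> = abs_minor R (set xs) (set ys)"
    by (rule abs_minor_eq[symmetric]) (use xs ys len in auto)
  finally show ?thesis using xs ys by simp
qed

definition minor_pairs :: "nat set \<Rightarrow> (nat set \<times> nat set) set"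
  where "minor_pairs I = {(K\<^sub>1, K\<^sub>2). K\<^sub>1 \<subseteq> I \<and> K\<^sub>2 \<subseteq> - I \<and> finite K\<^sub>1 \<and> finite K\<^sub>2 \<and> card K\<^sub>1 = card K\<^sub>2}"

text \<open>
  A pair \<open>(K\<^sub>1, K\<^sub>2)\<close> describes the index set \<open>Q = (I - K\<^sub>1) \<union> K\<^sub>2\<close>. Passing from \<open>I = J \<union> {p}\<close> to
  \<open>L = J \<union> {q}\<close>, the pair that describes the same \<open>Q\<close> is \<open>(L - Q, Q - L)\<close>, and this is its
  expression in terms of \<open>K\<^sub>1\<close> and \<open>K\<^sub>2\<close>.
\<close>

definition exchange :: "nat \<Rightarrow> nat \<Rightarrow> nat set \<times> nat set \<Rightarrow> nat set \<times> nat set"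
  where "exchange p q = (\<lambda>(K\<^sub>1, K\<^sub>2).
    (K\<^sub>1 - {p} \<union> (if q \<in> K\<^sub>2 then {} else {q}), K\<^sub>2 - {q} \<union> (if p \<in> K\<^sub>1 then {} else {p})))"

lemma exchange_in_minor_pairs:
  assumes "p \<notin> J" "q \<notin> J" "p \<noteq> q" "K \<in> minor_pairs (insert p J)"
  shows "exchange p q K \<in> minor_pairs (insert q J)"
proof -
  obtain K\<^sub>1 K\<^sub>2 where K: "K = (K\<^sub>1, K\<^sub>2)" by (cases K)
  have fin: "finite K\<^sub>1" "finite K\<^sub>2" "card K\<^sub>1 = card K\<^sub>2" "K\<^sub>1 \<subseteq> insert p J" "K\<^sub>2 \<subseteq> - insert p J"
    using assms K by (auto simp: minor_pairs_def)
  have q: "q \<notin> K\<^sub>1" and p: "p \<notin> K\<^sub>2" using fin assms by auto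
  have c1: "card (K\<^sub>1 - {p}) = (if p \<in> K\<^sub>1 then card K\<^sub>1 - 1 else card K\<^sub>1)"
    and c2: "card (K\<^sub>2 - {q}) = (if q \<in> K\<^sub>2 then card K\<^sub>2 - 1 else card K\<^sub>2)"
    using fin by (auto simp: card_Diff_singleton)
  have p1: "p \<in> K\<^sub>1 \<Longrightarrow> 0 < card K\<^sub>1" and p2: "q \<in> K\<^sub>2 \<Longrightarrow> 0 < card K\<^sub>2"
    using fin by (auto simp: card_gt_0_iff)
  have "card (K\<^sub>1 - {p} \<union> (if q \<in> K\<^sub>2 then {} else {q})) =
      card (K\<^sub>2 - {q} \<union> (if p \<in> K\<^sub>1 then {} else {p}))"
    using fin q p p1 p2 c1 c2 by (auto simp: card_insert_if)
  then show ?thesis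
    using fin assms by (auto simp: minor_pairs_def exchange_def K)
qed

lemma exchange_exchange:
  assumes "p \<notin> J" "q \<notin> J" "p \<noteq> q" "K \<in> minor_pairs (insert p J)"
  shows "exchange q p (exchange p q K) = K"
proof -
  obtain K\<^sub>1 K\<^sub>2 where K: "K = (K\<^sub>1, K\<^sub>2)" by (cases K)
  then have "q \<notin> K\<^sub>1" "p \<notin> K\<^sub>2" using assms by (auto simp: minor_pairs_def)
  then show ?thesis
    unfolding K exchange_def prod.case prod.inject
    by (cases "p \<in> K\<^sub>1"; cases "q \<in> K\<^sub>2") (use assms(3) in auto)
qed

lemma bij_betw_exchange:
  assumes "p \<notin> J" "q \<notin> J" "p \<noteq> q"
  shows "bij_betw (exchange p q) (minor_pairs (insert p J)) (minor_pairs (insert q J))"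
proof (rule bij_betwI[where g = "exchange q p"])
  show "exchange p q \<in> minor_pairs (insert p J) \<rightarrow> minor_pairs (insert q J)"
    by (rule funcsetI) (rule exchange_in_minor_pairs[OF assms])
  show "exchange q p \<in> minor_pairs (insert q J) \<rightarrow> minor_pairs (insert p J)"
    by (rule funcsetI) (rule exchange_in_minor_pairs[OF assms(2,1) assms(3)[symmetric]])
qed (rule exchange_exchange exchange_exchange[OF assms(2,1) assms(3)[symmetric]] assms | assumption)+

text \<open>
  Whether \<open>p \<in> K\<^sub>1\<close> and whether \<open>q \<in> K\<^sub>2\<close> are independent alternatives, and the two minors have
  different sizes in general. To treat all cases at once, both minors are enlarged by unit columns
  to minors with the same columns \<open>Y\<close> and with the rows \<open>p, H\<close> and \<open>q, H\<close> respectively, where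
  \<open>H = K\<^sub>1 - {p}\<close>. These differ by one elimination step.
\<close>

lemma abs_minor_exchange:
  assumes pq: "p \<notin> J" "q \<notin> J" "p \<noteq> q"
    and R: "\<And>i k. i \<in> insert p J \<Longrightarrow> k \<in> insert p J \<Longrightarrow> R i k = (if i = k then 1 else 0)"
    and R': "\<And>i k. i \<in> insert q J \<Longrightarrow> k \<in> insert q J \<Longrightarrow> R' i k = (if i = k then 1 else 0)"
    and Rp: "\<And>k. R p k = c * R' q k"
    and RJ: "\<And>i k. i \<in> J \<Longrightarrow> R i k = R' i k + R i q * R' q k"
    and K: "(K\<^sub>1, K\<^sub>2) \<in> minor_pairs (insert p J)" "exchange p q (K\<^sub>1, K\<^sub>2) = (M\<^sub>1, M\<^sub>2)"
  shows "abs_minor R K\<^sub>1 K\<^sub>2 = \<bar>c\<bar> * abs_minor R' M\<^sub>1 M\<^sub>2"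
proof -
  \<comment> \<open>The columns that go with the rows \<open>insert p K\<^sub>1\<close>: a row \<open>p\<close> that was added, rather than
    taken from \<open>K\<^sub>1\<close>, needs its unit column.\<close>
  define Y where "Y = K\<^sub>2 \<union> (if p \<in> K\<^sub>1 then {} else {p})"
  define H where "H = K\<^sub>1 - {p}"
  have fin: "finite K\<^sub>1" "finite K\<^sub>2" "card K\<^sub>1 = card K\<^sub>2" "K\<^sub>1 \<subseteq> insert p J" "K\<^sub>2 \<subseteq> - insert p J"
    using K by (auto simp: minor_pairs_def)
  have "(M\<^sub>1, M\<^sub>2) \<in> minor_pairs (insert q J)"
    using exchange_in_minor_pairs[OF pq K(1)] K(2) by simp
  then have fin': "finite M\<^sub>1" "finite M\<^sub>2" "card M\<^sub>1 = card M\<^sub>2" "M\<^sub>1 \<subseteq> insert q J" "M\<^sub>2 \<subseteq> - insert q J"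
    by (auto simp: minor_pairs_def)
  have M: "M\<^sub>1 = H \<union> (if q \<in> K\<^sub>2 then {} else {q})" "M\<^sub>2 = K\<^sub>2 - {q} \<union> (if p \<in> K\<^sub>1 then {} else {p})"
    using K(2) by (auto simp: exchange_def H_def)
  have 1: "abs_minor R K\<^sub>1 K\<^sub>2 = abs_minor R (insert p H) Y"
  proof (cases "p \<in> K\<^sub>1")
    case True
    then show ?thesis by (simp add: Y_def H_def insert_absorb)
  next
    case False
    have "abs_minor R (insert p K\<^sub>1) (insert p K\<^sub>2) = abs_minor R K\<^sub>1 K\<^sub>2"
      by (rule abs_minor_insert) (use False fin R in auto)
    then show ?thesis using False by (simp add: Y_def H_def)
  qed
  have 2: "abs_minor R' M\<^sub>1 M\<^sub>2 = abs_minor R' (insert q H) Y"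
  proof (cases "q \<in> K\<^sub>2")
    case False
    then show ?thesis by (simp add: Y_def M)
  next
    case True
    have "abs_minor R' (insert q M\<^sub>1) (insert q M\<^sub>2) = abs_minor R' M\<^sub>1 M\<^sub>2"
    proof (rule abs_minor_insert)
      show "q \<notin> M\<^sub>1" "q \<notin> M\<^sub>2" using True fin pq by (auto simp: M H_def)
      show "R' z q = 0" if "z \<in> M\<^sub>1" for z
        using that True fin' \<open>q \<notin> M\<^sub>1\<close> R'[of z q] by auto
    qed (use fin' R' in auto)
    moreover have "insert q M\<^sub>2 = Y" using True by (auto simp: M Y_def)
    ultimately show ?thesis using True by (simp add: M)
  qed
  have finH: "finite H" "p \<notin> H" "q \<notin> H" "H \<subseteq> J" and finY: "finite Y"
    using fin pq by (auto simp: H_def Y_def)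
  have cardY: "card Y = Suc (card H)"
  proof (cases "p \<in> K\<^sub>1")
    case True
    then have "card K\<^sub>1 = Suc (card H)"
      unfolding H_def using fin by (metis card.remove)
    then show ?thesis using fin True by (simp add: Y_def)
  next
    case False
    moreover have "p \<notin> K\<^sub>2" using fin by auto
    ultimately show ?thesis using fin by (simp add: Y_def H_def)
  qed
  obtain xs ys where xs: "set xs = H" "distinct xs" and ys: "set ys = Y" "distinct ys"
    using finite_distinct_list[OF finH(1)] finite_distinct_list[OF finY] by blast
  have len: "length ys = Suc (length xs)"
    using distinct_card[OF xs(2)] distinct_card[OF ys(2)] cardY xs ys by simp
  have "abs_minor R (set (p # xs)) (set ys) = \<bar>list_minor R (p # xs) ys\<bar>"
    by (rule abs_minor_eq) (use xs ys len finH in auto)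
  also have "list_minor R (p # xs) ys = c * list_minor R' (q # xs) ys"
    by (rule list_minor_row_operation[where b = "\<lambda>i. R i q"]) (use len Rp RJ xs finH in auto)
  also have "\<bar>c * list_minor R' (q # xs) ys\<bar> = \<bar>c\<bar> * abs_minor R' (set (q # xs)) (set ys)"
    unfolding abs_mult by (subst abs_minor_eq) (use xs ys len finH in auto)
  finally show ?thesis using 1 2 xs ys by simp
qed

text \<open>
  The square of the normal factor. The summand 1 is the square of the empty minor.
\<close>

definition minor_sum :: "nat set \<Rightarrow> (nat \<Rightarrow> nat \<Rightarrow> real) \<Rightarrow> ennreal"
  where "minor_sum I R = (\<Sum>\<^sub>\<infinity>(K\<^sub>1, K\<^sub>2)\<in>minor_pairs I. ennreal ((abs_minor R K\<^sub>1 K\<^sub>2)\<^sup>2))"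

lemma infsum_cmult_ennreal:
  fixes f :: "'a \<Rightarrow> ennreal"
  shows "(\<Sum>\<^sub>\<infinity>x\<in>A. c * f x) = c * (\<Sum>\<^sub>\<infinity>x\<in>A. f x)"
proof -
  have "(\<Sum>\<^sub>\<infinity>x\<in>A. c * f x) = (SUP F\<in>{F. finite F \<and> F \<subseteq> A}. \<Sum>x\<in>F. c * f x)"
    by (rule nonneg_infsum_complete) simp
  also have "\<dots> = (SUP F\<in>{F. finite F \<and> F \<subseteq> A}. c * sum f F)"
    by (simp only: sum_distrib_left)
  also have "\<dots> = c * (SUP F\<in>{F. finite F \<and> F \<subseteq> A}. sum f F)"
    by (rule SUP_mult_left_ennreal[symmetric])
  also have "(SUP F\<in>{F. finite F \<and> F \<subseteq> A}. sum f F) = (\<Sum>\<^sub>\<infinity>x\<in>A. f x)"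
    by (rule nonneg_infsum_complete[symmetric]) simp
  finally show ?thesis .
qed

lemma minor_sum_exchange:
  assumes pq: "p \<notin> J" "q \<notin> J" "p \<noteq> q"
    and "\<And>i k. i \<in> insert p J \<Longrightarrow> k \<in> insert p J \<Longrightarrow> R i k = (if i = k then 1 else 0)"
    and "\<And>i k. i \<in> insert q J \<Longrightarrow> k \<in> insert q J \<Longrightarrow> R' i k = (if i = k then 1 else 0)"
    and "\<And>k. R p k = c * R' q k"
    and "\<And>i k. i \<in> J \<Longrightarrow> R i k = R' i k + R i q * R' q k"
  shows "minor_sum (insert p J) R = ennreal (c\<^sup>2) * minor_sum (insert q J) R'"
proof -
  let ?f = "\<lambda>(K\<^sub>1, K\<^sub>2). ennreal (c\<^sup>2) * ennreal ((abs_minor R' K\<^sub>1 K\<^sub>2)\<^sup>2)"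
  have "minor_sum (insert p J) R = (\<Sum>\<^sub>\<infinity>K\<in>minor_pairs (insert p J). ?f (exchange p q K))"
    unfolding minor_sum_def
  proof (rule infsum_cong)
    fix K assume K: "K \<in> minor_pairs (insert p J)"
    obtain K\<^sub>1 K\<^sub>2 M\<^sub>1 M\<^sub>2 where *: "K = (K\<^sub>1, K\<^sub>2)" "exchange p q (K\<^sub>1, K\<^sub>2) = (M\<^sub>1, M\<^sub>2)"
      by (cases K; cases "exchange p q K") auto
    have "abs_minor R K\<^sub>1 K\<^sub>2 = \<bar>c\<bar> * abs_minor R' M\<^sub>1 M\<^sub>2"
      by (rule abs_minor_exchange[OF assms]) (use K * in auto)
    then show "(case K of (K\<^sub>1, K\<^sub>2) \<Rightarrow> ennreal ((abs_minor R K\<^sub>1 K\<^sub>2)\<^sup>2)) = ?f (exchange p q K)"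
      by (simp add: * power_mult_distrib ennreal_mult)
  qed
  also have "\<dots> = (\<Sum>\<^sub>\<infinity>K\<in>minor_pairs (insert q J). ?f K)"
    by (rule infsum_reindex_bij_betw[OF bij_betw_exchange[OF pq]])
  also have "\<dots> = ennreal (c\<^sup>2) * minor_sum (insert q J) R'"
    unfolding minor_sum_def infsum_cmult_ennreal[symmetric] by (simp add: case_prod_unfold)
  finally show ?thesis .
qed

lemma sqrt_ennreal_mult_square:
  assumes "c \<noteq> 0"
  shows "sqrt_ennreal (ennreal (c\<^sup>2) * s) = ennreal \<bar>c\<bar> * sqrt_ennreal s"
proof (cases s rule: ennreal_cases)
  case (real r)
  then show ?thesis
    by (simp add: sqrt_ennreal_def ennreal_mult[symmetric] real_sqrt_mult)
next
  case top
  then show ?thesis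
    using assms by (simp add: sqrt_ennreal_def ennreal_mult_top)
qed

lemma minor_sum_split:
  "minor_sum I R = 1 + (\<Sum>\<^sub>\<infinity>(K\<^sub>1, K\<^sub>2)\<in>{(K\<^sub>1, K\<^sub>2). K\<^sub>1 \<subseteq> I \<and> K\<^sub>2 \<subseteq> - I \<and> finite K\<^sub>1 \<and> finite K\<^sub>2 \<and>
        card K\<^sub>1 = card K\<^sub>2 \<and> 1 \<le> card K\<^sub>1}. ennreal ((abs_minor R K\<^sub>1 K\<^sub>2)\<^sup>2))"
proof -
  let ?P = "{(K\<^sub>1, K\<^sub>2). K\<^sub>1 \<subseteq> I \<and> K\<^sub>2 \<subseteq> - I \<and> finite K\<^sub>1 \<and> finite K\<^sub>2 \<and>
        card K\<^sub>1 = card K\<^sub>2 \<and> 1 \<le> card K\<^sub>1}"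
  have "minor_pairs I = {({}, {})} \<union> ?P"
    by (auto simp: minor_pairs_def Suc_le_eq card_gt_0_iff)
  moreover have "abs_minor R {} {} = 1"
    by (simp add: abs_minor_def list_minor_def det_dim_zero)
  moreover have "infsum f ({z} \<union> ?P) = f z + infsum f ?P"
    if "z \<notin> ?P" for f :: "nat set \<times> nat set \<Rightarrow> ennreal" and z
    using that by (subst infsum_Un_disjoint) (auto intro: nonneg_summable_on_complete)
  ultimately show ?thesis
    unfolding minor_sum_def by simp
qed

section \<open>Graphs over coordinate subspaces\<close>

text \<open>
  All points of the ambient space above the base of the chart. Derivatives are taken on this set,
  which is open in \<open>ell2\<close>, rather than on the base, which is open only relative to a subspace.
\<close>

definition cylinder :: "nat set \<Rightarrow> ell2 set \<Rightarrow> ell2 set"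
  where "cylinder I V = {x. coord_proj I x \<in> coord_proj I ` V}"

text \<open>
  The set \<open>V\<close> is the graph of \<open>f\<close> over an open subset of \<open>coord_space I\<close>, and \<open>f'\<close> is the continuous
  derivative of \<open>f \<circ> coord_proj I\<close>. Everything is expressed through \<open>V\<close>: the notion is stable under
  intersecting \<open>V\<close> with open sets, and two charts can be compared on one common \<open>V\<close>.
\<close>

definition C1_graph :: "nat set \<Rightarrow> ell2 set \<Rightarrow> (ell2 \<Rightarrow> ell2) \<Rightarrow> (ell2 \<Rightarrow> ell2 \<Rightarrow>\<^sub>L ell2) \<Rightarrow> bool"
  where "C1_graph I V f f' \<longleftrightarrow> open (cylinder I V) \<and>
    (\<forall>x\<in>V. f (coord_proj I x) = coord_proj (- I) x) \<and>
    (\<forall>x\<in>cylinder I V. ((\<lambda>x. f (coord_proj I x)) has_derivative f' x) (at x)) \<and>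
    continuous_on (cylinder I V) f'"

definition graph_point :: "nat set \<Rightarrow> (ell2 \<Rightarrow> ell2) \<Rightarrow> ell2 \<Rightarrow> ell2"
  where "graph_point I f x = coord_proj I x + f (coord_proj I x)"

lemma subset_cylinder: "V \<subseteq> cylinder I V"
  by (auto simp: cylinder_def)

lemma coord_proj_in_cylinder: "coord_proj I x \<in> cylinder I V \<longleftrightarrow> x \<in> cylinder I V"
  by (simp add: cylinder_def)

context
  fixes I V f f'
  assumes graph: "C1_graph I V f f'"
begin

lemma C1_graphD:
  shows open_cylinder: "open (cylinder I V)"
    and C1_graph_value: "x \<in> V \<Longrightarrow> f (coord_proj I x) = coord_proj (- I) x"
    and C1_graph_derivative: "x \<in> cylinder I V \<Longrightarrow> ((\<lambda>x. f (coord_proj I x)) has_derivative f' x) (at x)"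
    and C1_graph_continuous: "continuous_on (cylinder I V) f'"
  using graph by (auto simp: C1_graph_def)

lemma graph_point_of_mem: "x \<in> V \<Longrightarrow> graph_point I f x = x"
  by (simp add: graph_point_def C1_graph_value coord_proj_compl)

lemma graph_point_in:
  assumes "x \<in> cylinder I V"
  shows "graph_point I f x \<in> V" "coord_proj I (graph_point I f x) = coord_proj I x"
    "coord_proj (- I) (graph_point I f x) = f (coord_proj I x)"
proof -
  obtain y where y: "y \<in> V" "coord_proj I x = coord_proj I y"
    using assms by (auto simp: cylinder_def)
  then have "graph_point I f x = y"
    using graph_point_of_mem[OF y(1)] by (simp add: graph_point_def)
  then show "graph_point I f x \<in> V" "coord_proj I (graph_point I f x) = coord_proj I x"
    "coord_proj (- I) (graph_point I f x) = f (coord_proj I x)"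
    using y C1_graph_value by auto
qed

lemma continuous_on_graph_point: "continuous_on (cylinder I V) (graph_point I f)"
  unfolding graph_point_def
  by (intro continuous_intros continuous_at_imp_continuous_on ballI
      has_derivative_continuous[OF C1_graph_derivative])

lemma C1_graph_restrict:
  assumes "open W"
  shows "C1_graph I (V \<inter> W) f f'"
proof -
  have "cylinder I (V \<inter> W) = graph_point I f -` W \<inter> cylinder I V"
  proof (intro equalityI subsetI)
    fix x assume "x \<in> cylinder I (V \<inter> W)"
    then obtain y where y: "y \<in> V" "y \<in> W" "coord_proj I x = coord_proj I y"
      by (auto simp: cylinder_def)
    then have "graph_point I f x = y"
      using graph_point_of_mem[OF y(1)] by (simp add: graph_point_def)
    then show "x \<in> graph_point I f -` W \<inter> cylinder I V"
      using y by (auto simp: cylinder_def)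
  next
    fix x assume "x \<in> graph_point I f -` W \<inter> cylinder I V"
    then show "x \<in> cylinder I (V \<inter> W)"
      using graph_point_in[of x] by (auto simp: cylinder_def intro!: image_eqI[of _ _ "graph_point I f x"])
  qed
  moreover have "open (graph_point I f -` W \<inter> cylinder I V)"
    using continuous_open_preimage[OF continuous_on_graph_point open_cylinder assms]
    by (simp add: Int_commute)
  moreover have "cylinder I (V \<inter> W) \<subseteq> cylinder I V"
    by (auto simp: cylinder_def)
  ultimately show ?thesis
    using C1_graphD by (auto simp: C1_graph_def intro: continuous_on_subset)
qed

lemma C1_graph_derivative_proj:
  assumes "x \<in> cylinder I V"
  shows "f' x (coord_proj I v) = f' x v" "f' (coord_proj I x) = f' x"
proof -
  let ?F = "\<lambda>x. f (coord_proj I x)"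
  \<comment> \<open>\<open>?F\<close> does not change under the affine maps \<open>y \<mapsto> x + coord_proj I (y - x)\<close> and
    \<open>y \<mapsto> y + (coord_proj I x - x)\<close>.\<close>
  have "((\<lambda>y. x + coord_proj I (y - x)) has_derivative coord_proj I) (at x)"
    by (auto intro!: derivative_eq_intros has_derivative_coord_proj)
  then have "((\<lambda>y. ?F (x + coord_proj I (y - x))) has_derivative (\<lambda>v. f' x (coord_proj I v))) (at x)"
    by (rule has_derivative_compose)
       (use C1_graph_derivative[OF assms] in \<open>simp add: coord_proj_linear_simps\<close>)
  moreover have "(\<lambda>y. ?F (x + coord_proj I (y - x))) = ?F"
    by (simp add: coord_proj_linear_simps)
  ultimately have "(?F has_derivative (\<lambda>v. f' x (coord_proj I v))) (at x)" by simp
  from has_derivative_unique[OF this C1_graph_derivative[OF assms]]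
  show "f' x (coord_proj I v) = f' x v" by metis
  have "((\<lambda>y. y + (coord_proj I x - x)) has_derivative (\<lambda>v. v)) (at x)"
    by (auto intro!: derivative_eq_intros)
  then have "((\<lambda>y. ?F (y + (coord_proj I x - x))) has_derivative f' (coord_proj I x)) (at x)"
    by (rule has_derivative_compose)
       (use C1_graph_derivative[of "coord_proj I x"] assms in \<open>simp add: coord_proj_in_cylinder\<close>)
  moreover have "(\<lambda>y. ?F (y + (coord_proj I x - x))) = ?F"
    by (simp add: coord_proj_linear_simps)
  ultimately have "(?F has_derivative f' (coord_proj I x)) (at x)" by simp
  from has_derivative_unique[OF this C1_graph_derivative[OF assms]]
  show "f' (coord_proj I x) = f' x" by (intro blinfun_eqI) metis
qed

lemma C1_graph_derivative_range:
  assumes x: "x \<in> cylinder I V"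
  shows "coord_proj I (f' x v) = 0"
proof -
  let ?F = "\<lambda>x. f (coord_proj I x)"
  have "((\<lambda>x. coord_proj I (?F x)) has_derivative (\<lambda>v. coord_proj I (f' x v))) (at x)"
    by (rule has_derivative_coord_proj[OF C1_graph_derivative[OF x]])
  moreover have "((\<lambda>x. coord_proj I (?F x)) has_derivative (\<lambda>v. 0)) (at x)"
  proof (rule has_derivative_transform_within_open[OF has_derivative_const open_cylinder x])
    fix y assume "y \<in> cylinder I V"
    then show "0 = coord_proj I (?F y)"
      using graph_point_in(3)[of y] by (metis coord_proj_compl_zero)
  qed
  ultimately have "(\<lambda>v. coord_proj I (f' x v)) = (\<lambda>v. 0)"
    by (rule has_derivative_unique)
  then show ?thesis by metis
qed

lemma coord_graph_derivative:
  assumes "x \<in> cylinder I V" "i \<in> I"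
  shows "coord (f' x v) i = 0"
  using C1_graph_derivative_range[OF assms(1), of v] assms(2)
  by (metis coord_coord_proj coord_zero)

end

text \<open>
  The second chart reproduces every point of \<open>V\<close>, in particular the points given by the first chart.
  Differentiating this identity shows that a tangent vector is determined by its projection to the
  base of the second chart.
\<close>

lemma C1_graph_tangent:
  assumes F: "C1_graph I V f f'" and H: "C1_graph L V h h'" and x: "x \<in> V"
  defines "\<tau> \<equiv> \<lambda>v. coord_proj I v + f' x v"
  shows "\<tau> v = coord_proj L (\<tau> v) + h' x (coord_proj L (\<tau> v))"
proof -
  have xI: "x \<in> cylinder I V" and xL: "x \<in> cylinder L V"
    using x subset_cylinder by auto
  have 1: "(graph_point I f has_derivative \<tau>) (at x)"
    unfolding graph_point_def \<tau>_def
    by (intro has_derivative_add C1_graph_derivative[OF F xI] has_derivative_coord_proj has_derivative_ident)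
  have gx: "graph_point I f x = x" by (rule graph_point_of_mem[OF F x])
  have 2: "(graph_point L h has_derivative (\<lambda>v. coord_proj L v + h' x v)) (at x)"
    unfolding graph_point_def
    by (intro has_derivative_add C1_graph_derivative[OF H xL] has_derivative_coord_proj has_derivative_ident)
  have "((\<lambda>y. graph_point L h (graph_point I f y)) has_derivative
      (\<lambda>v. coord_proj L (\<tau> v) + h' x (\<tau> v))) (at x)"
    using has_derivative_compose[OF 1, of "graph_point L h" "\<lambda>v. coord_proj L v + h' x v"] 2 gx by simp
  then have "(graph_point I f has_derivative (\<lambda>v. coord_proj L (\<tau> v) + h' x (\<tau> v))) (at x)"
    by (rule has_derivative_transform_within_open[OF _ open_cylinder[OF F] xI])
       (rule graph_point_of_mem[OF H graph_point_in(1)[OF F]])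
  from has_derivative_unique[OF 1 this]
  have "\<tau> v = coord_proj L (\<tau> v) + h' x (\<tau> v)" by metis
  then show ?thesis
    unfolding C1_graph_derivative_proj(1)[OF H xL] .
qed

text \<open>
  For \<open>i \<in> I\<close> these are the coordinates of the tangent vector whose projection to the base is the
  \<open>i\<close>-th basis vector. In the columns outside \<open>I\<close> they are the partial derivatives of \<open>f\<close>.
\<close>

definition graph_row :: "(ell2 \<Rightarrow> ell2 \<Rightarrow>\<^sub>L ell2) \<Rightarrow> ell2 \<Rightarrow> nat \<Rightarrow> nat \<Rightarrow> real"
  where "graph_row f' x i k = coord (basis_vec i + f' x (basis_vec i)) k"

lemma graph_row_unit:
  assumes "C1_graph I V f f'" "x \<in> V" "i \<in> I" "k \<in> I"
  shows "graph_row f' x i k = (if i = k then 1 else 0)"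
proof -
  have "x \<in> cylinder I V" using assms(2) subset_cylinder by auto
  then show ?thesis
    using coord_graph_derivative[OF assms(1) _ \<open>k \<in> I\<close>]
    by (simp add: graph_row_def coord_simps coord_basis_vec)
qed

text \<open>
  The second chart recovers a tangent vector from its coordinates in \<open>insert q J\<close>. For the row \<open>p\<close> of
  the first chart only the coordinate \<open>q\<close> survives, and for a row \<open>i \<in> J\<close> only \<open>i\<close> and \<open>q\<close>.
  The pivot is nonzero because the \<open>p\<close>-th coordinate of the row \<open>p\<close> is 1.
\<close>

lemma graph_rows_exchange:
  assumes F: "C1_graph (insert p J) V f f'" and H: "C1_graph (insert q J) V h h'" and x: "x \<in> V"
    and pq: "p \<notin> J" "q \<notin> J" "p \<noteq> q"
  shows "graph_row f' x p k = graph_row f' x p q * graph_row h' x q k"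
    and "i \<in> J \<Longrightarrow> graph_row f' x i k = graph_row h' x i k + graph_row f' x i q * graph_row h' x q k"
    and "graph_row f' x p q \<noteq> 0"
proof -
  define \<tau> where "\<tau> i = basis_vec i + f' x (basis_vec i)" for i
  have row: "graph_row f' x i k = coord (\<tau> i) k" for i k
    by (simp add: graph_row_def \<tau>_def)
  have unit: "coord (\<tau> i) k = (if i = k then 1 else 0)" if "i \<in> insert p J" "k \<in> insert p J" for i k
    using graph_row_unit[OF F x that] by (simp add: row)
  have tangent: "\<tau> i = coord_proj (insert q J) (\<tau> i) + h' x (coord_proj (insert q J) (\<tau> i))"
    if "i \<in> insert p J" for i
    using C1_graph_tangent[OF F H x, of "basis_vec i"] that
    by (simp add: \<tau>_def coord_proj_basis_vec)
  have "coord_proj (insert q J) (\<tau> p) = coord (\<tau> p) q *\<^sub>R basis_vec q"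
    using unit[of p] pq
    by (intro ell2_eqI) (auto simp: coord_coord_proj coord_simps coord_basis_vec)
  with tangent[of p] have p: "\<tau> p = coord (\<tau> p) q *\<^sub>R (basis_vec q + h' x (basis_vec q))"
    by (simp add: blinfun.scaleR_right scaleR_add_right)
  then have "coord (\<tau> p) k = coord (\<tau> p) q * graph_row h' x q k" for k
    by (metis coord_scaleR graph_row_def)
  then have 1: "graph_row f' x p k = graph_row f' x p q * graph_row h' x q k" for k
    unfolding row .
  show "graph_row f' x p k = graph_row f' x p q * graph_row h' x q k" by (rule 1)
  show "graph_row f' x p q \<noteq> 0"
    using 1[of p] unit[of p p] by (auto simp: row)
  assume i: "i \<in> J"
  have proj: "coord_proj (insert q J) (\<tau> i) = basis_vec i + coord (\<tau> i) q *\<^sub>R basis_vec q"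
    using unit[of i] i pq
    by (intro ell2_eqI) (auto simp: coord_coord_proj coord_simps coord_basis_vec)
  have "\<tau> i = coord_proj (insert q J) (\<tau> i) + h' x (coord_proj (insert q J) (\<tau> i))"
    using tangent i by blast
  also have "\<dots> = (basis_vec i + h' x (basis_vec i)) +
      coord (\<tau> i) q *\<^sub>R (basis_vec q + h' x (basis_vec q))"
    unfolding proj by (simp add: blinfun.add_right blinfun.scaleR_right scaleR_add_right)
  finally have "\<tau> i = (basis_vec i + h' x (basis_vec i)) +
      coord (\<tau> i) q *\<^sub>R (basis_vec q + h' x (basis_vec q))" .
  then have "coord (\<tau> i) k = graph_row h' x i k + coord (\<tau> i) q * graph_row h' x q k"
    unfolding graph_row_def by (metis coord_scaleR coord_add)
  then show "graph_row f' x i k = graph_row h' x i k + graph_row f' x i q * graph_row h' x q k"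
    unfolding row .
qed

text \<open>
  Otherwise the tangent vector above the \<open>p\<close>-th basis vector has only zero coordinates in \<open>L\<close>. The
  second chart then forces it to vanish, but its \<open>p\<close>-th coordinate is 1.
\<close>

lemma graph_row_nonzero:
  assumes F: "C1_graph I V f f'" and H: "C1_graph L V h h'" and x: "x \<in> V"
    and p: "p \<in> I" "p \<notin> L"
  obtains q where "q \<in> L" "q \<notin> I" "graph_row f' x p q \<noteq> 0"
proof -
  define \<tau> where "\<tau> = basis_vec p + f' x (basis_vec p)"
  have row: "graph_row f' x p k = coord \<tau> k" for k
    by (simp add: graph_row_def \<tau>_def)
  have "\<exists>q. q \<in> L \<and> q \<notin> I \<and> graph_row f' x p q \<noteq> 0"
  proof (rule ccontr)
    assume none: "\<nexists>q. q \<in> L \<and> q \<notin> I \<and> graph_row f' x p q \<noteq> 0"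
    have "coord \<tau> k = 0" if "k \<in> L" for k
      using none graph_row_unit[OF F x p(1), of k] that p by (cases "k \<in> I") (auto simp: row)
    then have "coord_proj L \<tau> = 0"
      by (intro ell2_eqI) (auto simp: coord_coord_proj coord_simps)
    moreover have "\<tau> = coord_proj L \<tau> + h' x (coord_proj L \<tau>)"
      using C1_graph_tangent[OF F H x, of "basis_vec p"] p
      by (simp add: \<tau>_def coord_proj_basis_vec)
    ultimately have "\<tau> = 0" by (simp add: blinfun.zero_right)
    then show False
      using graph_row_unit[OF F x p(1) p(1)] by (simp add: row coord_zero)
  qed
  then show ?thesis using that by blast
qed

text \<open>
  The equation \<open>x\<^sub>q = \<phi> (x)\<close> of the surface, where \<open>\<phi>\<close> is the \<open>q\<close>-th component of \<open>f\<close>, has to be solved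
  for \<open>x\<^sub>p\<close>. The shear \<open>G\<close> replaces the coordinate \<open>p\<close> of a base point by \<open>\<phi>\<close>, that is by the
  coordinate \<open>q\<close> of the surface point above it. Hence the inverse of \<open>G\<close>, applied to the new base
  point with its coordinate \<open>q\<close> written in place \<open>p\<close> (the map \<open>\<sigma>\<close>), is the old base point.
\<close>

lemma C1_graph_exchange:
  assumes F: "C1_graph (insert p J) V f f'" and x\<^sub>0: "x\<^sub>0 \<in> V"
    and pq: "p \<notin> J" "q \<notin> J" "p \<noteq> q" and nz: "graph_row f' x\<^sub>0 p q \<noteq> 0"
  obtains W h h' where "open W" "x\<^sub>0 \<in> W" "C1_graph (insert q J) (V \<inter> W) h h'"
proof -
  let ?I = "insert p J" and ?L = "insert q J"
  define D where "D = cylinder ?I V"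
  define \<phi> where "\<phi> x = coord (f (coord_proj ?I x)) q" for x
  define \<phi>' where "\<phi>' x = Blinfun (\<lambda>x. coord x q) o\<^sub>L f' x" for x
  have \<phi>'_apply: "\<phi>' x v = coord (f' x v) q" for x v
    by (simp add: \<phi>'_def bounded_linear_Blinfun_apply bounded_linear_coord)
  have x0D: "x\<^sub>0 \<in> D" using x\<^sub>0 subset_cylinder by (auto simp: D_def)
  define y\<^sub>0 where "y\<^sub>0 = coord_proj ?I x\<^sub>0"
  have y0D: "y\<^sub>0 \<in> D" using x0D by (simp add: D_def y\<^sub>0_def coord_proj_in_cylinder)
  have D: "open D" using open_cylinder[OF F] by (simp add: D_def)
  have F_der: "((\<lambda>x. f (coord_proj ?I x)) has_derivative f' x) (at x)" if "x \<in> D" for x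
    using C1_graph_derivative[OF F] that by (simp add: D_def)
  have f'_cont: "continuous_on D f'" using C1_graph_continuous[OF F] by (simp add: D_def)
  have nz': "\<phi>' y\<^sub>0 (basis_vec p) \<noteq> 0"
    using nz C1_graph_derivative_proj(2)[OF F x0D[unfolded D_def]] pq
    by (simp add: \<phi>'_apply y\<^sub>0_def graph_row_def coord_simps coord_basis_vec)
  have \<phi>_der: "(\<phi> has_derivative \<phi>' x) (at x)" if "x \<in> D" for x
    unfolding \<phi>_def[abs_def] using has_derivative_coord[OF F_der[OF that], of q] by (simp add: \<phi>'_apply[abs_def])
  have \<phi>_cont: "continuous_on D \<phi>'"
    unfolding \<phi>'_def[abs_def] by (intro continuous_intros f'_cont)
  define G where "G x = x + (\<phi> x - coord x p) *\<^sub>R basis_vec p" for x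
  obtain N K K' where N: "open N" "y\<^sub>0 \<in> N" "N \<subseteq> D" "open (G ` N)"
    "\<And>x. x \<in> N \<Longrightarrow> K (G x) = x"
    "\<And>u. u \<in> G ` N \<Longrightarrow> (K has_derivative blinfun_apply (K' u)) (at u)"
    "continuous_on (G ` N) K'"
    unfolding G_def[abs_def]
    by (rule shear_inverse_function[where \<phi> = \<phi> and \<phi>' = \<phi>' and e = "basis_vec p" and D = D,
          OF D y0D \<phi>_der \<phi>_cont bounded_linear_coord[of p] _ nz'])
       (auto simp: coord_basis_vec)
  define W where "W = coord_proj ?I -` N"
  define \<sigma> where "\<sigma> u = coord_proj J u + coord u q *\<^sub>R basis_vec p" for u
  have \<sigma>_lin: "bounded_linear \<sigma>"
    unfolding \<sigma>_def[abs_def]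
    by (intro bounded_linear_add bounded_linear_coord_proj
        bounded_linear_compose[OF bounded_linear_scaleR_left bounded_linear_coord])
  \<comment> \<open>The point of the surface above the new base point \<open>coord_proj ?L u\<close>.\<close>
  define g where "g u = graph_point ?I f (K (\<sigma> u))" for u
  define h where "h u = coord_proj (- ?L) (g u)" for u
  have \<sigma>_proj: "\<sigma> (coord_proj ?L u) = \<sigma> u" for u
    by (rule ell2_eqI) (auto simp: \<sigma>_def coord_simps coord_coord_proj)
  have W: "open W"
    unfolding W_def by (intro continuous_open_vimage N continuous_on_coord_proj continuous_intros)
  have G_graph: "G (coord_proj ?I x) = \<sigma> x" if "x \<in> V" for x
  proof -
    have "\<phi> (coord_proj ?I x) = coord x q"
      using C1_graph_value[OF F that] pq by (simp add: \<phi>_def coord_coord_proj)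
    then show ?thesis
      using pq by (intro ell2_eqI) (auto simp: G_def \<sigma>_def coord_simps coord_coord_proj coord_basis_vec)
  qed
  have g: "g x = x" if "x \<in> V \<inter> W" for x
  proof -
    have "K (\<sigma> x) = coord_proj ?I x"
      using that N(5)[of "coord_proj ?I x"] G_graph[of x] by (simp add: W_def)
    then show ?thesis
      using that graph_point_of_mem[OF F, of x] by (simp add: g_def graph_point_def)
  qed
  \<comment> \<open>Openness of the new base is openness of the shear.\<close>
  have cyl: "cylinder ?L (V \<inter> W) = \<sigma> -` (G ` N)"
  proof (intro equalityI subsetI)
    fix u assume "u \<in> cylinder ?L (V \<inter> W)"
    then obtain x where x: "x \<in> V \<inter> W" "coord_proj ?L u = coord_proj ?L x"
      by (auto simp: cylinder_def)
    have "\<sigma> u = G (coord_proj ?I x)"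
      using x G_graph[of x] \<sigma>_proj by (metis IntE)
    then show "u \<in> \<sigma> -` (G ` N)" using x by (simp add: W_def)
  next
    fix u assume "u \<in> \<sigma> -` (G ` N)"
    then obtain y where y: "y \<in> N" "\<sigma> u = G y" by auto
    have Gy: "coord (G y) i = (if i = p then \<phi> y else coord y i)" for i
      by (simp add: G_def coord_simps coord_basis_vec)
    have \<sigma>u: "coord (\<sigma> u) i = (if i = p then coord u q else if i \<in> J then coord u i else 0)" for i
      using pq by (simp add: \<sigma>_def coord_simps coord_basis_vec coord_coord_proj)
    have y_i: "coord y i = (if i \<in> J then coord u i else 0)" if "i \<noteq> p" for i
      using Gy[of i] \<sigma>u[of i] y(2) that by simp
    have y_p: "\<phi> y = coord u q" using Gy[of p] \<sigma>u[of p] y(2) by simp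
    have yI: "coord_proj ?I y = y"
      using y_i by (intro ell2_eqI) (auto simp: coord_coord_proj)
    define x where "x = graph_point ?I f y"
    have yD: "y \<in> cylinder ?I V" using y N by (auto simp: D_def)
    have x: "x \<in> V" "coord_proj ?I x = y" "coord_proj (- ?I) x = f y"
      using graph_point_in[OF F yD] by (simp_all add: x_def yI)
    have "coord x q = \<phi> y"
      using x(3) pq yI by (metis \<phi>_def coord_coord_proj Compl_iff insert_iff)
    moreover have "coord x i = coord u i" if "i \<in> J" for i
      using arg_cong[OF x(2), of "\<lambda>z. coord z i"] y_i[of i] that pq by (auto simp: coord_coord_proj)
    ultimately have "coord_proj ?L u = coord_proj ?L x"
      using y_p by (intro ell2_eqI) (auto simp: coord_coord_proj)
    moreover have "x \<in> W" using x y by (simp add: W_def)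
    ultimately show "u \<in> cylinder ?L (V \<inter> W)"
      using x by (auto simp: cylinder_def)
  qed
  define g' where "g' u = (Blinfun (coord_proj ?I) + f' (K (\<sigma> u))) o\<^sub>L K' (\<sigma> u) o\<^sub>L Blinfun \<sigma>" for u
  define h' where "h' u = Blinfun (coord_proj (- ?L)) o\<^sub>L g' u" for u
  have KN: "K u \<in> N" if "u \<in> G ` N" for u
    using that N(5) by auto
  have g'_apply: "g' u v = coord_proj ?I (K' (\<sigma> u) (\<sigma> v)) + f' (K (\<sigma> u)) (K' (\<sigma> u) (\<sigma> v))" for u v
    by (simp add: g'_def blinfun.add_left bounded_linear_Blinfun_apply bounded_linear_coord_proj \<sigma>_lin)
  have h'_apply: "h' u v = coord_proj (- ?L) (g' u v)" for u v
    by (simp add: h'_def bounded_linear_Blinfun_apply bounded_linear_coord_proj)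
  have g_der: "(g has_derivative g' u) (at u)" if "\<sigma> u \<in> G ` N" for u
  proof -
    have "(\<sigma> has_derivative \<sigma>) (at u)"
      using \<sigma>_lin by (rule bounded_linear_imp_has_derivative)
    then have 1: "((\<lambda>u. K (\<sigma> u)) has_derivative (\<lambda>v. K' (\<sigma> u) (\<sigma> v))) (at u)"
      by (rule has_derivative_compose) (rule N(6)[OF that])
    have 2: "(graph_point ?I f has_derivative (\<lambda>v. coord_proj ?I v + f' (K (\<sigma> u)) v)) (at (K (\<sigma> u)))"
      unfolding graph_point_def[abs_def]
      using KN[OF that] N(3)
      by (intro has_derivative_add F_der has_derivative_coord_proj has_derivative_ident) auto
    show ?thesis
      using has_derivative_compose[OF 1 2] unfolding g_def[abs_def] g'_apply[abs_def] .
  qed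
  have "C1_graph ?L (V \<inter> W) h h'"
    unfolding C1_graph_def cyl
  proof (intro conjI ballI)
    show "open (\<sigma> -` (G ` N))"
      by (rule continuous_open_vimage[OF N(4)]) (rule linear_continuous_at[OF \<sigma>_lin])
    have h_proj: "h (coord_proj ?L u) = coord_proj (- ?L) (g u)" for u
      by (simp add: h_def g_def \<sigma>_proj)
    show "h (coord_proj ?L x) = coord_proj (- ?L) x" if "x \<in> V \<inter> W" for x
      using g[OF that] by (simp add: h_proj)
    show "((\<lambda>u. h (coord_proj ?L u)) has_derivative h' u) (at u)" if "u \<in> \<sigma> -` (G ` N)" for u
      unfolding h_proj
      using has_derivative_coord_proj[OF g_der, of u "- ?L"] that by (simp add: h'_apply[abs_def])
    have \<sigma>_cont: "continuous_on (\<sigma> -` (G ` N)) \<sigma>"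
      by (intro linear_continuous_on \<sigma>_lin)
    have K_cont: "continuous_on (G ` N) K"
      by (intro continuous_at_imp_continuous_on ballI has_derivative_continuous[OF N(6)])
    have c1: "continuous_on (\<sigma> -` (G ` N)) (\<lambda>u. K' (\<sigma> u))"
      by (rule continuous_on_compose2[OF N(7) \<sigma>_cont]) auto
    have c2: "continuous_on (\<sigma> -` (G ` N)) (\<lambda>u. K (\<sigma> u))"
      by (rule continuous_on_compose2[OF K_cont \<sigma>_cont]) auto
    have c3: "continuous_on (\<sigma> -` (G ` N)) (\<lambda>u. f' (K (\<sigma> u)))"
      by (rule continuous_on_compose2[OF f'_cont c2]) (use KN N(3) in auto)
    show "continuous_on (\<sigma> -` (G ` N)) h'"
      unfolding h'_def[abs_def] g'_def[abs_def] by (intro continuous_intros c1 c3)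
  qed
  moreover have "x\<^sub>0 \<in> W" using N(2) by (simp add: W_def y\<^sub>0_def)
  ultimately show ?thesis using W that by blast
qed

section \<open>One-dimensional substitution on Borel sets\<close>

text \<open>
  The substitution rule for absolutely integrable functions is applied to indicators of sets of finite
  measure. This identifies the measure \<open>\<bar>\<psi>'\<bar> ds\<close>, transported by \<open>\<psi>\<close>, with Lebesgue measure on the
  image.
\<close>

lemma nn_integral_substitution_inj:
  fixes \<psi> \<psi>' :: "real \<Rightarrow> real" and G :: "real \<Rightarrow> ennreal"
  assumes A [measurable]: "A \<in> sets borel" and B [measurable]: "\<psi> ` A \<in> sets borel"
    and der: "\<And>s. s \<in> A \<Longrightarrow> (\<psi> has_real_derivative \<psi>' s) (at s within A)"
    and inj: "inj_on \<psi> A"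
    and \<psi>' [measurable]: "\<psi>' \<in> borel_measurable (restrict_space borel A)"
    and G [measurable]: "G \<in> borel_measurable borel"
  shows "(\<integral>\<^sup>+t. G t * indicator (\<psi> ` A) t \<partial>lborel) =
    (\<integral>\<^sup>+s. ennreal \<bar>\<psi>' s\<bar> * G (\<psi> s) * indicator A s \<partial>lborel)"
proof -
  \<comment> \<open>Total functions, so that the transported measure can be formed on the whole line. The value of
    \<open>\<psi>\<^sub>0\<close> outside \<open>A\<close> carries no mass, because the density \<open>J\<close> vanishes there.\<close>
  define \<psi>\<^sub>0 where "\<psi>\<^sub>0 s = (if s \<in> A then \<psi> s else 0)" for s
  define J where "J s = (if s \<in> A then \<bar>\<psi>' s\<bar> else 0)" for s
  have "continuous_on A \<psi>"
    using der by (auto simp: continuous_on_eq_continuous_within intro: DERIV_continuous)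
  then have "\<psi> \<in> borel_measurable (restrict_space borel A)"
    by (rule borel_measurable_continuous_on_restrict)
  then have [measurable]: "\<psi>\<^sub>0 \<in> borel_measurable borel"
    unfolding \<psi>\<^sub>0_def[abs_def] by (intro measurable_If_restrict_space_iff[THEN iffD2] conjI) auto
  have "(\<lambda>s. \<bar>\<psi>' s\<bar>) \<in> borel_measurable (restrict_space borel A)" by measurable
  then have [measurable]: "J \<in> borel_measurable borel"
    unfolding J_def[abs_def] by (intro measurable_If_restrict_space_iff[THEN iffD2] conjI) auto
  have bounded: "emeasure lborel (X \<inter> \<psi> ` A) = (\<integral>\<^sup>+s. ennreal (J s) * indicator X (\<psi>\<^sub>0 s) \<partial>lborel)"
    if X [measurable]: "X \<in> sets borel" and fin: "emeasure lborel X < \<infinity>" for X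
  proof -
    define b where "b = measure lebesgue (X \<inter> \<psi> ` A)"
    have fin': "emeasure lborel (X \<inter> \<psi> ` A) < \<infinity>"
      by (rule le_less_trans[OF emeasure_mono fin]) auto
    then have lm: "X \<inter> \<psi> ` A \<in> lmeasurable"
      by (intro fmeasurableI) auto
    have "(indicat_real X) absolutely_integrable_on (\<psi> ` A) \<and> integral (\<psi> ` A) (indicat_real X) = b"
    proof
      have eq: "(\<lambda>x. if x \<in> \<psi> ` A then indicat_real X x else 0) = indicat_real (X \<inter> \<psi> ` A)"
        by (auto simp: indicator_def)
      have *: "indicat_real (X \<inter> \<psi> ` A) absolutely_integrable_on UNIV"
        using lm by (simp add: set_integrable_def lmeasurable_iff_integrable)
      then show "indicat_real X absolutely_integrable_on \<psi> ` A"
        by (subst absolutely_integrable_restrict_UNIV[symmetric]) (simp only: eq)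
      have "integral (\<psi> ` A) (indicat_real X) = integral UNIV (indicat_real (X \<inter> \<psi> ` A))"
        by (subst integral_restrict_UNIV[symmetric]) (simp only: eq)
      also have "\<dots> = b"
        using lmeasure_integral_UNIV[OF lm] by (simp add: b_def)
      finally show "integral (\<psi> ` A) (indicat_real X) = b" .
    qed
    then have int: "(\<lambda>s. \<bar>\<psi>' s\<bar> * indicat_real X (\<psi> s)) absolutely_integrable_on A"
      "integral A (\<lambda>s. \<bar>\<psi>' s\<bar> * indicat_real X (\<psi> s)) = b"
      using has_absolute_integral_change_of_variables_1'[OF _ der inj, of "indicat_real X" b] by auto
    define F where "F s = J s * indicat_real X (\<psi>\<^sub>0 s)" for s
    have F: "F = (\<lambda>s. indicat_real A s *\<^sub>R (\<bar>\<psi>' s\<bar> * indicat_real X (\<psi> s)))"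
      by (auto simp: F_def J_def \<psi>\<^sub>0_def)
    have F_int: "integrable lebesgue F"
      using int(1) by (simp add: set_integrable_def F)
    have F_b: "integral\<^sup>L lebesgue F = b"
      using set_lebesgue_integral_eq_integral(2)[OF int(1)] int(2)
      by (simp add: set_lebesgue_integral_def F)
    have "(\<integral>\<^sup>+s. ennreal (J s) * indicator X (\<psi>\<^sub>0 s) \<partial>lborel) = (\<integral>\<^sup>+s. ennreal (F s) \<partial>lborel)"
      by (intro nn_integral_cong) (auto simp: F_def indicator_def)
    also have "\<dots> = (\<integral>\<^sup>+s. ennreal (F s) \<partial>lebesgue)"
      unfolding F_def[abs_def] by (rule nn_integral_completion[symmetric])
    also have "\<dots> = ennreal b"
      using nn_integral_eq_integral[OF F_int] F_b by (auto simp: F_def J_def)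
    also have "\<dots> = emeasure lborel (X \<inter> \<psi> ` A)"
      using lm fin' by (simp add: b_def measure_completion emeasure_eq_ennreal_measure)
    finally show ?thesis ..
  qed
  have all: "emeasure lborel (X \<inter> \<psi> ` A) = (\<integral>\<^sup>+s. ennreal (J s) * indicator X (\<psi>\<^sub>0 s) \<partial>lborel)"
    if X [measurable]: "X \<in> sets borel" for X
  proof -
    \<comment> \<open>Exhaustion by sets of finite measure.\<close>
    define Y where "Y n = X \<inter> {- real n..real n}" for n
    have inc: "incseq Y" by (auto simp: incseq_def Y_def)
    have UnY: "(\<Union>n. Y n) = X"
    proof -
      have "\<exists>n. x \<in> {- real n..real n}" for x
      proof -
        obtain n where "\<bar>x\<bar> \<le> real n" using real_arch_simple by blast
        then show ?thesis by (intro exI[of _ n]) auto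
      qed
      then show ?thesis by (auto simp: Y_def)
    qed
    have [measurable]: "Y n \<in> sets borel" for n by (simp add: Y_def)
    have "emeasure lborel (Y n) < \<infinity>" for n
      by (rule le_less_trans[OF emeasure_mono[of _ "{- real n..real n}"]]) (auto simp: Y_def)
    then have Yn: "emeasure lborel (Y n \<inter> \<psi> ` A) = (\<integral>\<^sup>+s. ennreal (J s) * indicator (Y n) (\<psi>\<^sub>0 s) \<partial>lborel)" for n
      by (intro bounded) auto
    have "emeasure lborel (X \<inter> \<psi> ` A) = (SUP n. emeasure lborel (Y n \<inter> \<psi> ` A))"
    proof (subst SUP_emeasure_incseq)
      show "range (\<lambda>n. Y n \<inter> \<psi> ` A) \<subseteq> sets lborel" by auto
      show "incseq (\<lambda>n. Y n \<inter> \<psi> ` A)" using inc by (auto simp: incseq_def)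
      show "emeasure lborel (X \<inter> \<psi> ` A) = emeasure lborel (\<Union>n. Y n \<inter> \<psi> ` A)"
        using UnY by (intro arg_cong2[where f = emeasure]) auto
    qed
    also have "\<dots> = (SUP n. \<integral>\<^sup>+s. ennreal (J s) * indicator (Y n) (\<psi>\<^sub>0 s) \<partial>lborel)"
      by (simp only: Yn)
    also have "\<dots> = (\<integral>\<^sup>+s. (SUP n. ennreal (J s) * indicator (Y n) (\<psi>\<^sub>0 s)) \<partial>lborel)"
    proof (rule nn_integral_monotone_convergence_SUP[symmetric])
      show "incseq (\<lambda>n s. ennreal (J s) * indicator (Y n) (\<psi>\<^sub>0 s))"
        using inc by (auto simp: incseq_def le_fun_def indicator_def intro!: mult_left_mono)
    qed measurable
    also have "(\<lambda>s. SUP n. ennreal (J s) * indicator (Y n) (\<psi>\<^sub>0 s)) =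
        (\<lambda>s. ennreal (J s) * indicator X (\<psi>\<^sub>0 s))"
    proof
      fix s
      show "(SUP n. ennreal (J s) * indicator (Y n) (\<psi>\<^sub>0 s)) = ennreal (J s) * indicator X (\<psi>\<^sub>0 s)"
      proof (cases "\<psi>\<^sub>0 s \<in> X")
        case True
        then obtain n where "\<psi>\<^sub>0 s \<in> Y n" using UnY by auto
        then show ?thesis
          using True by (intro antisym SUP_least SUP_upper2[of n]) (auto simp: indicator_def)
      next
        case False
        then have "\<psi>\<^sub>0 s \<notin> Y n" for n using UnY by auto
        then show ?thesis using False by simp
      qed
    qed
    finally show ?thesis .
  qed
  have "density lborel (indicator (\<psi> ` A)) = distr (density lborel (\<lambda>s. ennreal (J s))) borel \<psi>\<^sub>0"
  proof (rule measure_eqI)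
    fix X assume "X \<in> sets (density lborel (indicator (\<psi> ` A)))"
    then have X [measurable]: "X \<in> sets borel" by simp
    have "emeasure (density lborel (indicator (\<psi> ` A))) X =
        (\<integral>\<^sup>+t. indicator (\<psi> ` A) t * indicator X t \<partial>lborel)"
      by (rule emeasure_density) auto
    also have "\<dots> = (\<integral>\<^sup>+t. indicator (X \<inter> \<psi> ` A) t \<partial>lborel)"
      by (intro nn_integral_cong) (auto simp: indicator_def)
    also have "\<dots> = emeasure lborel (X \<inter> \<psi> ` A)"
      by (rule nn_integral_indicator) auto
    also have "\<dots> = (\<integral>\<^sup>+s. ennreal (J s) * indicator (\<psi>\<^sub>0 -` X) s \<partial>lborel)"
      unfolding all[OF X] by (intro nn_integral_cong) (auto simp: indicator_def)
    also have "\<dots> = emeasure (density lborel (\<lambda>s. ennreal (J s))) (\<psi>\<^sub>0 -` X)"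
      by (rule emeasure_density[symmetric]) (auto simp: measurable_sets_borel[OF _ X])
    also have "\<dots> = emeasure (distr (density lborel (\<lambda>s. ennreal (J s))) borel \<psi>\<^sub>0) X"
      by (subst emeasure_distr) auto
    finally show "emeasure (density lborel (indicator (\<psi> ` A))) X =
        emeasure (distr (density lborel (\<lambda>s. ennreal (J s))) borel \<psi>\<^sub>0) X" .
  qed simp
  from arg_cong[OF this, of "\<lambda>M. nn_integral M G"]
  have "(\<integral>\<^sup>+t. indicator (\<psi> ` A) t * G t \<partial>lborel) = (\<integral>\<^sup>+s. ennreal (J s) * G (\<psi>\<^sub>0 s) \<partial>lborel)"
    by (simp add: nn_integral_density nn_integral_distr)
  also have "\<dots> = (\<integral>\<^sup>+s. ennreal \<bar>\<psi>' s\<bar> * G (\<psi> s) * indicator A s \<partial>lborel)"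
    by (intro nn_integral_cong) (auto simp: J_def \<psi>\<^sub>0_def indicator_def)
  finally show ?thesis by (simp only: mult.commute)
qed

section \<open>Gaussian weights and disintegration\<close>

definition log_density :: "(nat \<Rightarrow> real) \<Rightarrow> nat \<Rightarrow> real \<Rightarrow> real"
  where "log_density a i t = ln (1 / sqrt (2 * pi * (a i)\<^sup>2)) - t\<^sup>2 / (2 * (a i)\<^sup>2)"

lemma exp_log_density: "0 < a i \<Longrightarrow> exp (log_density a i t) = normal_density 0 (a i) t"
proof -
  assume "0 < a i"
  then have "0 < 1 / sqrt (2 * pi * (a i)\<^sup>2)" by simp
  then have "exp (ln (1 / sqrt (2 * pi * (a i)\<^sup>2))) = 1 / sqrt (2 * pi * (a i)\<^sup>2)"
    by (rule exp_ln)
  then show ?thesis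
    unfolding log_density_def normal_density_def diff_conv_add_uminus exp_add by simp
qed

text \<open>
  The density on the coordinates in \<open>I\<close>, as a function of the whole vector and written as an
  exponential of a sum: finite changes of \<open>I\<close> and measurability are then statements about series.
\<close>

definition gauss_weight :: "(nat \<Rightarrow> real) \<Rightarrow> nat set \<Rightarrow> ell2 \<Rightarrow> ennreal"
  where "gauss_weight a I x =
    (if summable (\<lambda>i. if i \<in> I then \<bar>log_density a i (coord x i)\<bar> else 0)
     then ennreal (exp (\<Sum>i. if i \<in> I then log_density a i (coord x i) else 0)) else \<infinity>)"

lemma summable_iff_suminf_ennreal:
  fixes f :: "nat \<Rightarrow> real"
  assumes "\<And>i. 0 \<le> f i"
  shows "summable f \<longleftrightarrow> (\<Sum>i. ennreal (f i)) \<noteq> \<infinity>"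
proof
  assume "summable f"
  then show "(\<Sum>i. ennreal (f i)) \<noteq> \<infinity>"
    unfolding infinity_ennreal_def by (rule ennreal_suminf_neq_top) (rule assms)
next
  assume "(\<Sum>i. ennreal (f i)) \<noteq> \<infinity>"
  then show "summable f"
    unfolding infinity_ennreal_def by (intro summable_suminf_not_top assms)
qed

lemma summable_on_nat_iff:
  fixes f :: "nat \<Rightarrow> real"
  assumes "\<And>i. 0 \<le> f i"
  shows "f summable_on I \<longleftrightarrow> summable (\<lambda>i. if i \<in> I then f i else 0)"
proof -
  have "f summable_on I \<longleftrightarrow> (\<lambda>i. if i \<in> I then f i else 0) summable_on UNIV"
    by (rule summable_on_cong_neutral) auto
  also have "\<dots> \<longleftrightarrow> summable (\<lambda>i. if i \<in> I then f i else 0)"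
    by (rule summable_on_UNIV_nonneg_real_iff) (use assms in auto)
  finally show ?thesis .
qed

lemma density_prod_eq_gauss_weight:
  assumes a: "\<And>i. 0 < a i"
  shows "density_prod a I (coord_proj I x) = gauss_weight a I x"
proof (cases "I = {}")
  case True
  then show ?thesis by (simp add: density_prod_def gauss_weight_def)
next
  case False
  let ?l = "\<lambda>i. if i \<in> I then log_density a i (coord x i) else 0"
  have abs: "(\<lambda>i. \<bar>?l i\<bar>) = (\<lambda>i. if i \<in> I then \<bar>log_density a i (coord x i)\<bar> else 0)" by auto
  have "coord_proj I x \<in> density_domain a I \<longleftrightarrow>
      (\<lambda>i. \<bar>log_density a i (coord (coord_proj I x) i)\<bar>) summable_on I"
    by (simp add: density_domain_def log_density_def)
  also have "\<dots> \<longleftrightarrow> summable (\<lambda>i. \<bar>?l i\<bar>)"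
    unfolding abs by (subst summable_on_nat_iff) (auto simp: coord_coord_proj intro!: arg_cong[where f = summable])
  finally have dom: "coord_proj I x \<in> density_domain a I \<longleftrightarrow> summable (\<lambda>i. \<bar>?l i\<bar>)" .
  have "(\<lambda>i. if i \<in> I then normal_density 0 (a i) (coord (coord_proj I x) i) else 1) = (\<lambda>i. exp (?l i))"
    by (auto simp: coord_coord_proj exp_log_density a)
  moreover have "prodinf (\<lambda>i. exp (?l i)) = exp (suminf ?l)" if "summable (\<lambda>i. \<bar>?l i\<bar>)"
    by (rule prodinf_exp) (use that in \<open>rule summable_rabs_cancel\<close>)
  ultimately show ?thesis
    using False dom by (simp add: density_prod_def gauss_weight_def abs)
qed

text \<open>
  One more index contributes one finite term to the series and a positive finite factor to the
  density, so that the value \<open>\<infinity>\<close> is taken at the same points.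
\<close>

lemma gauss_weight_insert:
  assumes a: "\<And>i. 0 < a i" and q: "q \<notin> I"
  shows "gauss_weight a (insert q I) x = ennreal (normal_density 0 (a q) (coord x q)) * gauss_weight a I x"
proof -
  let ?l = "\<lambda>I i. if i \<in> I then log_density a i (coord x i) else 0"
  let ?d = "\<lambda>i. if i = q then log_density a i (coord x i) else 0"
  have l: "?l (insert q I) = (\<lambda>i. ?l I i + ?d i)" using q by auto
  have abs_l: "(\<lambda>i. if i \<in> insert q I then \<bar>log_density a i (coord x i)\<bar> else 0) =
      (\<lambda>i. (if i \<in> I then \<bar>log_density a i (coord x i)\<bar> else 0) + \<bar>?d i\<bar>)"
    using q by auto
  have d: "summable ?d" "suminf ?d = log_density a q (coord x q)"
    using sums_single[of q "\<lambda>i. log_density a i (coord x i)"] by (simp_all add: sums_iff)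
  have "(\<lambda>i. \<bar>?d i\<bar>) = (\<lambda>i. if i = q then \<bar>log_density a i (coord x i)\<bar> else 0)" by auto
  then have abs_d: "summable (\<lambda>i. \<bar>?d i\<bar>)"
    using sums_single[of q "\<lambda>i. \<bar>log_density a i (coord x i)\<bar>"] by (simp add: sums_iff)
  have iff: "summable (\<lambda>i. if i \<in> insert q I then \<bar>log_density a i (coord x i)\<bar> else 0) \<longleftrightarrow>
      summable (\<lambda>i. if i \<in> I then \<bar>log_density a i (coord x i)\<bar> else 0)"
    unfolding abs_l
  proof
    assume "summable (\<lambda>i. (if i \<in> I then \<bar>log_density a i (coord x i)\<bar> else 0) + \<bar>?d i\<bar>)"
    from summable_diff[OF this abs_d] show "summable (\<lambda>i. if i \<in> I then \<bar>log_density a i (coord x i)\<bar> else 0)"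
      by simp
  qed (rule summable_add[OF _ abs_d])
  show ?thesis
  proof (cases "summable (\<lambda>i. if i \<in> I then \<bar>log_density a i (coord x i)\<bar> else 0)")
    case True
    have "(\<lambda>i. if i \<in> I then \<bar>log_density a i (coord x i)\<bar> else 0) = (\<lambda>i. \<bar>?l I i\<bar>)" by auto
    with True have "summable (\<lambda>i. \<bar>?l I i\<bar>)" by (simp only:)
    then have "summable (?l I)" by (rule summable_rabs_cancel)
    then have "suminf (?l (insert q I)) = suminf (?l I) + log_density a q (coord x q)"
      unfolding l by (subst suminf_add[symmetric]) (simp_all add: d)
    then show ?thesis
      using True iff by (simp add: gauss_weight_def exp_add exp_log_density a mult.commute ennreal_mult)
  next
    case False
    have "0 < normal_density 0 (a q) (coord x q)" by (rule normal_density_pos[OF a])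
    with False iff show ?thesis by (simp add: gauss_weight_def ennreal_mult_top)
  qed
qed

lemma gauss_weight_measurable [measurable]: "gauss_weight a I \<in> borel_measurable borel"
proof -
  have [measurable]: "(\<lambda>x. if i \<in> I then log_density a i (coord x i) else 0) \<in> borel_measurable borel" for i
    unfolding log_density_def by measurable
  have iff: "summable (\<lambda>i. if i \<in> I then \<bar>log_density a i (coord x i)\<bar> else 0) \<longleftrightarrow>
      (\<Sum>i. ennreal \<bar>if i \<in> I then log_density a i (coord x i) else 0\<bar>) \<noteq> \<infinity>" for x
  proof -
    have "(\<lambda>i. if i \<in> I then \<bar>log_density a i (coord x i)\<bar> else 0) =
        (\<lambda>i. \<bar>if i \<in> I then log_density a i (coord x i) else 0\<bar>)" by auto
    moreover have "summable (\<lambda>i. \<bar>if i \<in> I then log_density a i (coord x i) else 0\<bar>) \<longleftrightarrow>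
        (\<Sum>i. ennreal \<bar>if i \<in> I then log_density a i (coord x i) else 0\<bar>) \<noteq> \<infinity>"
      by (rule summable_iff_suminf_ennreal) simp
    ultimately show ?thesis by (simp only:)
  qed
  show ?thesis
    unfolding gauss_weight_def[abs_def] iff by measurable
qed

abbreviation coord_gauss :: "(nat \<Rightarrow> real) \<Rightarrow> nat \<Rightarrow> real measure"
  where "coord_gauss a i \<equiv> density lborel (\<lambda>x. ennreal (normal_density 0 (a i) x))"

lemma component_borel_measurable:
  "(\<lambda>x. if i \<in> I then x i else 0) \<in> borel_measurable (Pi\<^sub>M I (coord_gauss a))"
proof (cases "i \<in> I")
  case True
  have "measurable (Pi\<^sub>M I (coord_gauss a)) (coord_gauss a i) = borel_measurable (Pi\<^sub>M I (coord_gauss a))"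
    by (rule measurable_cong_sets) simp_all
  with measurable_component_singleton[OF True, of "coord_gauss a"] True show ?thesis by simp
qed simp

definition square_summable :: "nat set \<Rightarrow> (nat \<Rightarrow> real) set"
  where "square_summable I = {x. (\<lambda>i. (x i)\<^sup>2) summable_on I}"

definition embed_seq :: "nat set \<Rightarrow> (nat \<Rightarrow> real) \<Rightarrow> ell2"
  where "embed_seq I x = Abs_ell2 (\<lambda>i. if i \<in> I then x i else 0)"

lemma coord_embed:
  assumes "x \<in> square_summable I"
  shows "coord (embed_seq I x) i = (if i \<in> I then x i else 0)"
proof -
  have "summable (\<lambda>i. if i \<in> I then (x i)\<^sup>2 else 0)"
    using assms by (simp add: square_summable_def summable_on_nat_iff)
  also have "(\<lambda>i. if i \<in> I then (x i)\<^sup>2 else 0) = (\<lambda>i. (if i \<in> I then x i else 0)\<^sup>2)" by auto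
  finally show ?thesis unfolding embed_seq_def by (rule coord_Abs)
qed

lemma square_summable_measurable:
  "square_summable I \<inter> space (Pi\<^sub>M I (coord_gauss a)) \<in> sets (Pi\<^sub>M I (coord_gauss a))"
proof -
  let ?P = "Pi\<^sub>M I (coord_gauss a)"
  have [measurable]: "(\<lambda>x. if i \<in> I then (x i)\<^sup>2 else 0) \<in> borel_measurable ?P" for i
  proof -
    have "(\<lambda>x. (if i \<in> I then x i else 0)\<^sup>2) \<in> borel_measurable ?P"
      by (intro borel_measurable_power component_borel_measurable)
    also have "(\<lambda>x :: nat \<Rightarrow> real. (if i \<in> I then x i else 0)\<^sup>2) =
        (\<lambda>x. if i \<in> I then (x i)\<^sup>2 else 0)"
      by auto
    finally show ?thesis .
  qed
  have "x \<in> square_summable I \<longleftrightarrow> (\<Sum>i. ennreal (if i \<in> I then (x i)\<^sup>2 else 0)) \<noteq> \<infinity>" for x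
    unfolding square_summable_def mem_Collect_eq
    by (subst summable_on_nat_iff, simp, rule summable_iff_suminf_ennreal) simp
  then have "square_summable I \<inter> space ?P =
      {x \<in> space ?P. (\<Sum>i. ennreal (if i \<in> I then (x i)\<^sup>2 else 0)) \<noteq> \<infinity>}"
    by auto
  also have "\<dots> \<in> sets ?P" by measurable
  finally show ?thesis .
qed

lemma embed_measurable:
  "embed_seq I \<in> measurable (restrict_space (Pi\<^sub>M I (coord_gauss a)) (square_summable I))
     (restrict_space borel (coord_space I))"
proof (rule measurable_restrict_space2)
  let ?R = "restrict_space (Pi\<^sub>M I (coord_gauss a)) (square_summable I)"
  have sp: "x \<in> square_summable I" if "x \<in> space ?R" for x
    using that by (simp add: space_restrict_space)
  show "embed_seq I \<in> space ?R \<rightarrow> coord_space I"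
    by (rule funcsetI) (simp add: coord_space_eq coord_embed[OF sp])
  show "embed_seq I \<in> borel_measurable ?R"
  proof (rule ell2_measurableI)
    fix i
    have "(\<lambda>x. if i \<in> I then x i else 0) \<in> borel_measurable ?R"
      by (rule measurable_restrict_space1[OF component_borel_measurable])
    also have "(\<lambda>x. if i \<in> I then x i else 0) \<in> borel_measurable ?R \<longleftrightarrow>
        (\<lambda>x. coord (embed_seq I x) i) \<in> borel_measurable ?R"
      by (rule measurable_cong) (simp only: coord_embed[OF sp])
    finally show "(\<lambda>x. coord (embed_seq I x) i) \<in> borel_measurable ?R" .
  qed
qed

lemma nn_integral_gauss_measure:
  assumes H: "H \<in> borel_measurable borel"
  shows "(\<integral>\<^sup>+x. H x \<partial>gauss_measure a I) =
    (\<integral>\<^sup>+x. H (embed_seq I x) * indicator (square_summable I) x \<partial>Pi\<^sub>M I (coord_gauss a))"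
proof -
  have "gauss_measure a I = distr (restrict_space (Pi\<^sub>M I (coord_gauss a)) (square_summable I))
      (restrict_space borel (coord_space I)) (embed_seq I)"
    by (simp add: gauss_measure_def square_summable_def embed_seq_def[abs_def])
  then have "(\<integral>\<^sup>+x. H x \<partial>gauss_measure a I) =
      (\<integral>\<^sup>+x. H x \<partial>distr (restrict_space (Pi\<^sub>M I (coord_gauss a)) (square_summable I))
        (restrict_space borel (coord_space I)) (embed_seq I))"
    by (simp only:)
  also have "\<dots> =
      (\<integral>\<^sup>+x. H (embed_seq I x) \<partial>restrict_space (Pi\<^sub>M I (coord_gauss a)) (square_summable I))"
    by (rule nn_integral_distr[OF embed_measurable[of I a]])
       (simp only: measurable_distr_eq1 measurable_restrict_space1[OF H])
  also have "\<dots> = (\<integral>\<^sup>+x. H (embed_seq I x) * indicator (square_summable I) x \<partial>Pi\<^sub>M I (coord_gauss a))"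
    by (rule nn_integral_restrict_space) (rule square_summable_measurable)
  finally show ?thesis .
qed

text \<open>
  Square summability depends only on the coordinates in \<open>J\<close>, so that Fubini for the product of one
  normal distribution with the others is compatible with the restriction to square-summable
  families.
\<close>

lemma nn_integral_gauss_measure_insert:
  assumes a: "\<And>i. 0 < a i" and p: "p \<notin> J" and H [measurable]: "H \<in> borel_measurable borel"
  shows "(\<integral>\<^sup>+x. H x \<partial>gauss_measure a (insert p J)) =
    (\<integral>\<^sup>+w. (\<integral>\<^sup>+s. ennreal (normal_density 0 (a p) s) * H (w + s *\<^sub>R basis_vec p) \<partial>lborel) \<partial>gauss_measure a J)"
proof -
  let ?I = "insert p J" and ?N = "coord_gauss a"
  let ?P = "Pi\<^sub>M J ?N"
  have prob: "prob_space (?N i)" for i by (rule prob_space_normal_density[OF a])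
  interpret P: prob_space ?P by (rule prob_space_PiM) (rule prob)
  interpret Np: prob_space "?N p" by (rule prob)
  interpret pair_sigma_finite "?N p" ?P ..
  have sq: "w(p := s) \<in> square_summable ?I \<longleftrightarrow> w \<in> square_summable J" for w s
  proof -
    have "(\<lambda>i. ((w(p := s)) i)\<^sup>2) summable_on ?I \<longleftrightarrow> (\<lambda>i. ((w(p := s)) i)\<^sup>2) summable_on J"
      by (rule summable_on_insert_iff)
    also have "\<dots> \<longleftrightarrow> (\<lambda>i. (w i)\<^sup>2) summable_on J"
      using p by (intro summable_on_cong) auto
    finally show ?thesis by (simp add: square_summable_def)
  qed
  have emb: "embed_seq ?I (w(p := s)) = embed_seq J w + s *\<^sub>R basis_vec p" if "w \<in> square_summable J" for w s
    by (rule ell2_eqI)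
       (use that sq[of w s] p in \<open>auto simp: coord_embed coord_simps coord_basis_vec\<close>)
  define \<Phi> where "\<Phi> w = (\<integral>\<^sup>+s. ennreal (normal_density 0 (a p) s) * H (w + s *\<^sub>R basis_vec p) \<partial>lborel)" for w
  have \<Phi> [measurable]: "\<Phi> \<in> borel_measurable borel"
    unfolding \<Phi>_def[abs_def] by measurable
  let ?h = "\<lambda>x. H (embed_seq ?I x) * indicator (square_summable ?I) x"
  have h [measurable]: "?h \<in> borel_measurable (Pi\<^sub>M ?I ?N)"
  proof -
    have "(\<lambda>x. H (embed_seq ?I x)) \<in> borel_measurable (restrict_space (Pi\<^sub>M ?I ?N) (square_summable ?I))"
      by (rule measurable_compose[OF embed_measurable measurable_restrict_space1[OF H]])
    then show ?thesis
      by (subst (asm) borel_measurable_restrict_space_iff_ennreal) (rule square_summable_measurable)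
  qed
  have upd: "(\<lambda>(x, X). X(p := x)) \<in> measurable (?N p \<Otimes>\<^sub>M ?P) (Pi\<^sub>M ?I ?N)"
    unfolding case_prod_unfold by (rule measurable_fun_upd[where J = J]) auto
  have "(\<integral>\<^sup>+x. H x \<partial>gauss_measure a ?I) = (\<integral>\<^sup>+x. ?h x \<partial>Pi\<^sub>M ?I ?N)"
    by (rule nn_integral_gauss_measure[OF H])
  also have "Pi\<^sub>M ?I ?N = distr (?N p \<Otimes>\<^sub>M ?P) (Pi\<^sub>M ?I ?N) (\<lambda>(x, X). X(p := x))"
    by (rule distr_pair_PiM_eq_PiM[symmetric]) (rule prob)+
  also have "(\<integral>\<^sup>+x. ?h x \<partial>distr (?N p \<Otimes>\<^sub>M ?P) (Pi\<^sub>M ?I ?N) (\<lambda>(x, X). X(p := x))) =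
      (\<integral>\<^sup>+z. ?h (case z of (x, X) \<Rightarrow> X(p := x)) \<partial>(?N p \<Otimes>\<^sub>M ?P))"
    by (rule nn_integral_distr[OF upd]) (simp only: measurable_distr_eq1 h)
  also have "\<dots> = (\<integral>\<^sup>+w. (\<integral>\<^sup>+s. ?h (w(p := s)) \<partial>?N p) \<partial>?P)"
    using nn_integral_snd[OF measurable_compose[OF upd h]] by (simp add: case_prod_unfold)
  also have "\<dots> = (\<integral>\<^sup>+w. \<Phi> (embed_seq J w) * indicator (square_summable J) w \<partial>?P)"
  proof (rule nn_integral_cong)
    fix w
    show "(\<integral>\<^sup>+s. ?h (w(p := s)) \<partial>?N p) = \<Phi> (embed_seq J w) * indicator (square_summable J) w"
    proof (cases "w \<in> square_summable J")
      case True
      then have "?h (w(p := s)) = H (embed_seq J w + s *\<^sub>R basis_vec p)" for s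
        by (simp add: emb sq)
      then show ?thesis
        using True by (simp add: \<Phi>_def nn_integral_density)
    next
      case False
      then show ?thesis by (simp add: sq)
    qed
  qed
  also have "\<dots> = (\<integral>\<^sup>+w. \<Phi> w \<partial>gauss_measure a J)"
    by (rule nn_integral_gauss_measure[OF \<Phi>, symmetric])
  finally show ?thesis by (simp add: \<Phi>_def)
qed

section \<open>The integrand of the surface measure\<close>

lemma partial_deriv_eq:
  assumes F: "C1_graph I V f f'" and x: "x \<in> cylinder I V" and i: "i \<in> I"
  shows "partial_deriv i j f (coord_proj I x) = coord (f' x (basis_vec i)) j"
proof -
  let ?\<phi> = "\<lambda>x. coord (f (coord_proj I x)) j"
  have "(?\<phi> has_derivative (\<lambda>v. coord (f' x v) j)) (at (x + 0 *\<^sub>R basis_vec i))"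
    using has_derivative_coord[OF C1_graph_derivative[OF F x]] by simp
  from has_real_derivative_along_line[OF this]
  have "((\<lambda>t. ?\<phi> (x + t *\<^sub>R basis_vec i)) has_real_derivative coord (f' x (basis_vec i)) j) (at 0)" .
  moreover have "(\<lambda>t. ?\<phi> (x + t *\<^sub>R basis_vec i)) =
      (\<lambda>t. inner (f (coord_proj I x + t *\<^sub>R basis_vec i)) (basis_vec j))"
    using i by (simp add: coord_proj_linear_simps coord_proj_basis_vec inner_basis_vec)
  ultimately show ?thesis
    unfolding partial_deriv_def by (simp add: DERIV_imp_deriv)
qed

lemma abs_minor_graph_row:
  assumes F: "C1_graph I V f f'" and x: "x \<in> cylinder I V"
    and K: "K\<^sub>1 \<subseteq> I" "K\<^sub>2 \<subseteq> - I" "finite K\<^sub>1" "finite K\<^sub>2" "card K\<^sub>1 = card K\<^sub>2"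
  shows "\<bar>minor f (coord_proj I x) K\<^sub>1 K\<^sub>2\<bar> = abs_minor (graph_row f' x) K\<^sub>1 K\<^sub>2"
proof -
  have len: "length (sorted_list_of_set K\<^sub>1) = card K\<^sub>1" "length (sorted_list_of_set K\<^sub>2) = card K\<^sub>2"
    using K by simp_all
  have "mat (card K\<^sub>1) (card K\<^sub>2)
      (\<lambda>(r, s). partial_deriv (sorted_list_of_set K\<^sub>1 ! r) (sorted_list_of_set K\<^sub>2 ! s) f (coord_proj I x)) =
    mat (card K\<^sub>1) (card K\<^sub>1)
      (\<lambda>(r, s). graph_row f' x (sorted_list_of_set K\<^sub>1 ! r) (sorted_list_of_set K\<^sub>2 ! s))"
    (is "?A = ?B")
  proof (rule eq_matI)
    fix r s assume "r < dim_row ?B" "s < dim_col ?B"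
    then have r: "r < card K\<^sub>1" and s: "s < card K\<^sub>1" by simp_all
    define i where "i = sorted_list_of_set K\<^sub>1 ! r"
    define j where "j = sorted_list_of_set K\<^sub>2 ! s"
    have "i \<in> K\<^sub>1"
      using nth_mem[of r "sorted_list_of_set K\<^sub>1"] r K len by (simp add: i_def)
    moreover have "j \<in> K\<^sub>2"
      using nth_mem[of s "sorted_list_of_set K\<^sub>2"] s K len by (simp add: j_def)
    ultimately have "i \<in> I" "j \<noteq> i" using K by auto
    then have "partial_deriv i j f (coord_proj I x) = graph_row f' x i j"
      by (simp add: partial_deriv_eq[OF F x] graph_row_def coord_simps coord_basis_vec)
    then show "?A $$ (r, s) = ?B $$ (r, s)"
      using r s K by (simp add: i_def j_def)
  qed (use K in simp_all)
  then show ?thesis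
    by (simp add: minor_def abs_minor_def list_minor_def len)
qed

lemma normal_factor_eq:
  assumes F: "C1_graph I V f f'" and x: "x \<in> cylinder I V"
  shows "normal_factor I f x = sqrt_ennreal (minor_sum I (graph_row f' x))"
proof -
  let ?P = "{(K\<^sub>1, K\<^sub>2). K\<^sub>1 \<subseteq> I \<and> K\<^sub>2 \<subseteq> - I \<and> finite K\<^sub>1 \<and> finite K\<^sub>2 \<and>
        card K\<^sub>1 = card K\<^sub>2 \<and> 1 \<le> card K\<^sub>1}"
  have "(\<Sum>\<^sub>\<infinity>(K\<^sub>1, K\<^sub>2)\<in>?P. ennreal (\<bar>minor f (coord_proj I x) K\<^sub>1 K\<^sub>2\<bar>\<^sup>2)) =
      (\<Sum>\<^sub>\<infinity>(K\<^sub>1, K\<^sub>2)\<in>?P. ennreal ((abs_minor (graph_row f' x) K\<^sub>1 K\<^sub>2)\<^sup>2))"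
  proof (rule infsum_cong)
    fix K assume "K \<in> ?P"
    then obtain K\<^sub>1 K\<^sub>2 where K: "K = (K\<^sub>1, K\<^sub>2)" "K\<^sub>1 \<subseteq> I" "K\<^sub>2 \<subseteq> - I" "finite K\<^sub>1" "finite K\<^sub>2"
      "card K\<^sub>1 = card K\<^sub>2" by blast
    show "(case K of (K\<^sub>1, K\<^sub>2) \<Rightarrow> ennreal (\<bar>minor f (coord_proj I x) K\<^sub>1 K\<^sub>2\<bar>\<^sup>2)) =
        (case K of (K\<^sub>1, K\<^sub>2) \<Rightarrow> ennreal ((abs_minor (graph_row f' x) K\<^sub>1 K\<^sub>2)\<^sup>2))"
      unfolding K(1) prod.case abs_minor_graph_row[OF F x K(2-6)] ..
  qed
  then show ?thesis
    unfolding normal_factor_def minor_sum_split by (simp only:)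
qed

text \<open>
  A determinant is a polynomial in its entries.
\<close>

lemma continuous_on_list_minor:
  assumes "\<And>i k. continuous_on S (\<lambda>x. R x i k)" "length ys = length xs"
  shows "continuous_on S (\<lambda>x. list_minor (R x) xs ys)"
proof -
  let ?n = "length xs"
  have "list_minor (R x) xs ys = (\<Sum>p\<in>{p. p permutes {0..<?n}}.
      signof p * (\<Prod>i = 0..<?n. R x (xs ! i) (ys ! p i)))" for x
  proof -
    have "mat ?n ?n (\<lambda>(r, s). R x (xs ! r) (ys ! s)) \<in> carrier_mat ?n ?n" by simp
    from det_def'[OF this] have "list_minor (R x) xs ys = (\<Sum>p\<in>{p. p permutes {0..<?n}}.
        signof p * (\<Prod>i = 0..<?n. mat ?n ?n (\<lambda>(r, s). R x (xs ! r) (ys ! s)) $$ (i, p i)))"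
      by (simp only: list_minor_def)
    also have "\<dots> = (\<Sum>p\<in>{p. p permutes {0..<?n}}.
        signof p * (\<Prod>i = 0..<?n. R x (xs ! i) (ys ! p i)))"
    proof (intro sum.cong prod.cong arg_cong2[where f = "(*)"] refl)
      fix p i assume "p \<in> {p. p permutes {0..<?n}}" "i \<in> {0..<?n}"
      then have "p i < ?n" "i < ?n" using permutes_in_image[of p "{0..<?n}" i] by auto
      then show "mat ?n ?n (\<lambda>(r, s). R x (xs ! r) (ys ! s)) $$ (i, p i) = R x (xs ! i) (ys ! p i)"
        by simp
    qed
    finally show ?thesis .
  qed
  then show ?thesis
    by (simp only:) (intro continuous_on_sum continuous_on_mult continuous_on_const continuous_on_prod assms)
qed

text \<open>
  The sum is a supremum of finite partial sums, and there are only countably many finite sets of pairs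
  of finite index sets.
\<close>

lemma borel_measurable_minor_sum:
  assumes R: "\<And>i k. continuous_on S (\<lambda>x. R x i k)"
  shows "(\<lambda>x. minor_sum I (R x)) \<in> borel_measurable (restrict_space borel S)"
proof -
  let ?\<F> = "{F. finite F \<and> F \<subseteq> minor_pairs I}"
  have "countable (Collect finite \<times> Collect finite :: (nat set \<times> nat set) set)"
    by (intro countable_SIGMA countable_Collect_finite)
  then have "countable (minor_pairs I)"
    by (rule countable_subset[rotated]) (auto simp: minor_pairs_def)
  then have "countable ?\<F>"
    by (rule countable_Collect_finite_subset)
  moreover have "(\<lambda>x. \<Sum>K\<in>F. case K of (K\<^sub>1, K\<^sub>2) \<Rightarrow> ennreal ((abs_minor (R x) K\<^sub>1 K\<^sub>2)\<^sup>2))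
      \<in> borel_measurable (restrict_space borel S)" if F: "F \<in> ?\<F>" for F
  proof (rule borel_measurable_sum)
    fix K assume "K \<in> F"
    then obtain K\<^sub>1 K\<^sub>2 where K: "K = (K\<^sub>1, K\<^sub>2)" "card K\<^sub>1 = card K\<^sub>2"
      using F by (cases K) (auto simp: minor_pairs_def)
    have "continuous_on S (\<lambda>x. (abs_minor (R x) K\<^sub>1 K\<^sub>2)\<^sup>2)"
      unfolding abs_minor_def
      by (intro continuous_on_power continuous_on_rabs continuous_on_list_minor R) (simp add: K)
    then have "(\<lambda>x. (abs_minor (R x) K\<^sub>1 K\<^sub>2)\<^sup>2) \<in> borel_measurable (restrict_space borel S)"
      by (rule borel_measurable_continuous_on_restrict)
    then show "(\<lambda>x. case K of (K\<^sub>1, K\<^sub>2) \<Rightarrow> ennreal ((abs_minor (R x) K\<^sub>1 K\<^sub>2)\<^sup>2))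
        \<in> borel_measurable (restrict_space borel S)"
      by (simp add: K)
  qed
  ultimately have "(\<lambda>x. SUP F\<in>?\<F>. \<Sum>K\<in>F. case K of (K\<^sub>1, K\<^sub>2) \<Rightarrow> ennreal ((abs_minor (R x) K\<^sub>1 K\<^sub>2)\<^sup>2))
      \<in> borel_measurable (restrict_space borel S)"
    by (rule borel_measurable_SUP)
  then show ?thesis
    unfolding minor_sum_def by (subst nonneg_infsum_complete) auto
qed

lemma sqrt_ennreal_measurable [measurable]: "sqrt_ennreal \<in> borel_measurable borel"
  unfolding sqrt_ennreal_def[abs_def] by measurable

text \<open>
  The integrand of the surface measure as a function of the point of the surface instead of its
  projection, so that the integrands of two charts can be compared at the same point.
\<close>

definition surface_density :: "(nat \<Rightarrow> real) \<Rightarrow> nat set \<Rightarrow> (ell2 \<Rightarrow> ell2 \<Rightarrow>\<^sub>L ell2) \<Rightarrow> ell2 \<Rightarrow> ennreal"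
  where "surface_density a I f' x = sqrt_ennreal (minor_sum I (graph_row f' x)) * gauss_weight a (- I) x"

text \<open>
  For \<open>E \<subseteq> V\<close> this set has the same trace on \<open>coord_space I\<close> as the projection of \<open>E\<close>. It is a
  preimage under a continuous map, and hence Borel for Borel \<open>E\<close>.
\<close>

definition base_set :: "nat set \<Rightarrow> ell2 set \<Rightarrow> (ell2 \<Rightarrow> ell2) \<Rightarrow> ell2 set \<Rightarrow> ell2 set"
  where "base_set I V f E = {x \<in> cylinder I V. graph_point I f x \<in> E}"

lemma base_set_borel:
  assumes F: "C1_graph I V f f'" and E: "E \<in> sets borel"
  shows "base_set I V f E \<in> sets borel"
proof -
  have D: "cylinder I V \<in> sets borel" using open_cylinder[OF F] by simp
  have "graph_point I f \<in> borel_measurable (restrict_space borel (cylinder I V))"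
    by (rule borel_measurable_continuous_on_restrict[OF continuous_on_graph_point[OF F]])
  from measurable_sets[OF this E]
  have "graph_point I f -` E \<inter> cylinder I V \<in> sets (restrict_space borel (cylinder I V))"
    by (simp add: space_restrict_space)
  then have "graph_point I f -` E \<inter> cylinder I V \<in> sets borel"
    using D by (simp add: sets_restrict_space_iff)
  moreover have "base_set I V f E = graph_point I f -` E \<inter> cylinder I V"
    by (auto simp: base_set_def)
  ultimately show ?thesis by simp
qed

text \<open>
  Inside the open cylinder, the graph is the relatively closed set of fixed points of \<open>graph_point\<close>.
\<close>

lemma C1_graph_borel:
  assumes F: "C1_graph I V f f'"
  shows "V \<in> sets borel"
proof -
  let ?D = "cylinder I V"
  have "continuous_on ?D (\<lambda>x. graph_point I f x - x)"
    by (intro continuous_on_diff continuous_on_graph_point[OF F] continuous_on_id)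
  then have "open (?D \<inter> (\<lambda>x. graph_point I f x - x) -` (- {0}))"
    by (rule continuous_open_preimage) (use open_cylinder[OF F] in auto)
  then have "?D - (?D \<inter> (\<lambda>x. graph_point I f x - x) -` (- {0})) \<in> sets borel"
    by (intro sets.Diff borel_open open_cylinder[OF F])
  moreover have "V = ?D - (?D \<inter> (\<lambda>x. graph_point I f x - x) -` (- {0}))"
  proof (intro equalityI subsetI)
    fix x assume x: "x \<in> V"
    then have "x \<in> ?D" using subset_cylinder by blast
    then show "x \<in> ?D - (?D \<inter> (\<lambda>x. graph_point I f x - x) -` (- {0}))"
      using graph_point_of_mem[OF F x] by simp
  next
    fix x assume "x \<in> ?D - (?D \<inter> (\<lambda>x. graph_point I f x - x) -` (- {0}))"
    then have "x \<in> ?D" "graph_point I f x = x" by auto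
    then show "x \<in> V" using graph_point_in(1)[OF F, of x] by simp
  qed
  ultimately show ?thesis by (simp only:)
qed

lemma surface_integrand_measurable:
  assumes F: "C1_graph I V f f'" and E: "E \<in> sets borel"
  shows "(\<lambda>x. surface_density a I f' (graph_point I f x) * indicator (base_set I V f E) x)
    \<in> borel_measurable borel"
proof -
  let ?D = "cylinder I V" and ?B = "base_set I V f E"
  have B [measurable]: "?B \<in> sets borel" by (rule base_set_borel[OF F E])
  have BD: "?B \<subseteq> ?D" by (auto simp: base_set_def)
  have g: "continuous_on ?B (graph_point I f)"
    by (rule continuous_on_subset[OF continuous_on_graph_point[OF F] BD])
  have "graph_point I f ` ?B \<subseteq> ?D"
    using graph_point_in(1)[OF F] BD subset_cylinder by blast
  then have f': "continuous_on ?B (\<lambda>x. f' (graph_point I f x))"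
    by (rule continuous_on_compose2[OF C1_graph_continuous[OF F] g])
  have "continuous_on ?B (\<lambda>x. graph_row f' (graph_point I f x) i k)" for i k
    unfolding graph_row_def by (intro continuous_intros f')
  then have 1: "(\<lambda>x. minor_sum I (graph_row f' (graph_point I f x))) \<in> borel_measurable (restrict_space borel ?B)"
    by (rule borel_measurable_minor_sum)
  have 2: "(\<lambda>x. gauss_weight a (- I) (graph_point I f x)) \<in> borel_measurable (restrict_space borel ?B)"
    by (rule measurable_compose[OF borel_measurable_continuous_on_restrict[OF g] gauss_weight_measurable])
  have "(\<lambda>x. surface_density a I f' (graph_point I f x)) \<in> borel_measurable (restrict_space borel ?B)"
    unfolding surface_density_def
    by (intro borel_measurable_times_ennreal measurable_compose[OF 1 sqrt_ennreal_measurable] 2)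
  then show ?thesis
    by (subst (asm) borel_measurable_restrict_space_iff_ennreal) auto
qed

lemma space_gauss_measure: "space (gauss_measure a I) = coord_space I"
  by (simp add: gauss_measure_def space_restrict_space)

lemma local_measure_eq:
  assumes a: "\<And>i. 0 < a i" and F: "C1_graph I V f f'" and E: "E \<subseteq> V"
  shows "local_measure a I f E =
    (\<integral>\<^sup>+x. surface_density a I f' (graph_point I f x) * indicator (base_set I V f E) x \<partial>gauss_measure a I)"
  unfolding local_measure_def
proof (rule nn_integral_cong)
  fix y assume "y \<in> space (gauss_measure a I)"
  then have y: "coord_proj I y = y"
    by (auto simp: space_gauss_measure)
  have mem: "y \<in> coord_proj I ` E \<longleftrightarrow> y \<in> base_set I V f E"
  proof
    assume "y \<in> coord_proj I ` E"
    then obtain x where x: "x \<in> E" "y = coord_proj I x" by auto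
    then have "x \<in> V" using E by auto
    then have "graph_point I f y = x" "y \<in> cylinder I V"
      using graph_point_of_mem[OF F, of x] x(2) by (auto simp: graph_point_def cylinder_def)
    then show "y \<in> base_set I V f E" using x(1) by (simp add: base_set_def)
  next
    assume "y \<in> base_set I V f E"
    then show "y \<in> coord_proj I ` E"
      using graph_point_in(2)[OF F, of y] y by (auto simp: base_set_def image_iff intro!: bexI[of _ "graph_point I f y"])
  qed
  show "normal_factor I f (y + f y) * density_prod a (- I) (f y) * indicator (coord_proj I ` E) y =
      surface_density a I f' (graph_point I f y) * indicator (base_set I V f E) y"
  proof (cases "y \<in> base_set I V f E")
    case True
    then have D: "y \<in> cylinder I V" by (simp add: base_set_def)
    define z where "z = graph_point I f y"
    have z: "z \<in> V" "y + f y = z" "coord_proj (- I) z = f y"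
      using graph_point_in[OF F D] y by (simp_all add: z_def graph_point_def)
    have "z \<in> cylinder I V" using z subset_cylinder by auto
    then have "normal_factor I f z = sqrt_ennreal (minor_sum I (graph_row f' z))"
      by (rule normal_factor_eq[OF F])
    moreover have "density_prod a (- I) (f y) = gauss_weight a (- I) z"
      unfolding z(3)[symmetric] by (rule density_prod_eq_gauss_weight[OF a])
    ultimately show ?thesis
      using mem True by (simp add: z surface_density_def flip: z_def)
  qed (use mem in simp)
qed

text \<open>
  With \<open>M\<close> the set of indices that are normal for both charts, the normal indices are \<open>M \<union> {q}\<close> for the
  first and \<open>M \<union> {p}\<close> for the second chart. Together with the density of the exchanged base coordinate,
  both sides therefore carry the Gaussian weight of \<open>M \<union> {p, q}\<close>.
\<close>

lemma surface_density_exchange: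
  assumes a: "\<And>i. 0 < a i" and F: "C1_graph (insert p J) V f f'" and H: "C1_graph (insert q J) V h h'"
    and x: "x \<in> V" and pq: "p \<notin> J" "q \<notin> J" "p \<noteq> q"
  shows "ennreal (normal_density 0 (a p) (coord x p)) * surface_density a (insert p J) f' x =
    ennreal \<bar>graph_row f' x p q\<bar> *
      (ennreal (normal_density 0 (a q) (coord x q)) * surface_density a (insert q J) h' x)"
proof -
  define c where "c = graph_row f' x p q"
  define M where "M = - insert p (insert q J)"
  have compl: "- insert p J = insert q M" "- insert q J = insert p M" "p \<notin> M" "q \<notin> M"
    using pq by (auto simp: M_def)
  have "minor_sum (insert p J) (graph_row f' x) = ennreal (c\<^sup>2) * minor_sum (insert q J) (graph_row h' x)"
    by (rule minor_sum_exchange[OF pq graph_row_unit[OF F x] graph_row_unit[OF H x]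
          graph_rows_exchange(1)[OF F H x pq, folded c_def] graph_rows_exchange(2)[OF F H x pq]])
  then have "sqrt_ennreal (minor_sum (insert p J) (graph_row f' x)) =
      ennreal \<bar>c\<bar> * sqrt_ennreal (minor_sum (insert q J) (graph_row h' x))"
    using sqrt_ennreal_mult_square[of c] graph_rows_exchange(3)[OF F H x pq] by (simp add: c_def)
  then show ?thesis
    by (simp add: surface_density_def compl gauss_weight_insert[OF a] c_def mult_ac)
qed

text \<open>
  The right-hand side treats the exchanged coordinate like any other coordinate of a point of the
  surface. Used for \<open>p\<close> and for \<open>q\<close>, it identifies the fibres of both charts over the same \<open>w\<close>.
\<close>

lemma base_set_fiber:
  assumes F: "C1_graph (insert p J) V f f'" and E: "E \<subseteq> V" and p: "p \<notin> J" and w: "w \<in> coord_space J"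
  shows "w + s *\<^sub>R basis_vec p \<in> base_set (insert p J) V f E \<and>
      x = graph_point (insert p J) f (w + s *\<^sub>R basis_vec p) \<longleftrightarrow>
    x \<in> E \<and> coord_proj J x = w \<and> coord x p = s" (is "?u \<in> ?B \<and> _ \<longleftrightarrow> _")
proof -
  let ?I = "insert p J"
  have w': "coord w i = 0" if "i \<notin> J" for i using w that by (auto simp: coord_space_eq)
  have u: "coord_proj ?I ?u = ?u"
    using w' by (intro ell2_eqI) (auto simp: coord_coord_proj coord_simps coord_basis_vec)
  show ?thesis
  proof
    assume x: "?u \<in> ?B \<and> x = graph_point ?I f ?u"
    then have "coord_proj ?I x = ?u"
      using graph_point_in(2)[OF F, of ?u] by (simp add: base_set_def u)
    then have *: "coord (coord_proj ?I x) i = coord ?u i" for i by simp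
    have "coord_proj J x = w"
    proof (rule ell2_eqI)
      fix i show "coord (coord_proj J x) i = coord w i"
        using *[of i] w'[of i] p by (auto simp: coord_coord_proj coord_simps coord_basis_vec split: if_splits)
    qed
    moreover have "coord x p = s"
      using *[of p] w'[OF p] by (simp add: coord_coord_proj coord_simps coord_basis_vec)
    ultimately show "x \<in> E \<and> coord_proj J x = w \<and> coord x p = s"
      using x by (simp add: base_set_def)
  next
    assume x: "x \<in> E \<and> coord_proj J x = w \<and> coord x p = s"
    then have xV: "x \<in> V" using E by auto
    have "coord_proj ?I x = ?u"
    proof (rule ell2_eqI)
      fix i show "coord (coord_proj ?I x) i = coord ?u i"
        using x p by (auto simp: coord_coord_proj coord_simps coord_basis_vec)
    qed
    with u have pu: "coord_proj ?I ?u = coord_proj ?I x" by (simp only:)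
    have "graph_point ?I f ?u = graph_point ?I f x"
      by (simp only: graph_point_def pu)
    also have "\<dots> = x" by (rule graph_point_of_mem[OF F xV])
    finally have "graph_point ?I f ?u = x" .
    moreover have "?u \<in> cylinder ?I V"
      unfolding cylinder_def mem_Collect_eq pu using xV by (rule imageI)
    ultimately show "?u \<in> ?B \<and> x = graph_point ?I f ?u"
      unfolding base_set_def using x by blast
  qed
qed

section \<open>Exchange of one index\<close>

text \<open>
  Over a fixed \<open>w\<close>, the curve \<open>X\<close> runs through the points of the surface with \<open>J\<close>-coordinates \<open>w\<close>,
  parametrized by the coordinate \<open>p\<close>, and \<open>\<psi>\<close> expresses the coordinate \<open>q\<close> in terms of \<open>p\<close>.
\<close>

lemma local_measure_exchange:
  assumes a: "\<And>i. 0 < a i" and F: "C1_graph (insert p J) V f f'" and H: "C1_graph (insert q J) V h h'"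
    and pq: "p \<notin> J" "q \<notin> J" "p \<noteq> q" and E: "E \<in> sets borel" "E \<subseteq> V"
  shows "local_measure a (insert q J) h E = local_measure a (insert p J) f E"
proof -
  let ?I = "insert p J" and ?L = "insert q J"
  let ?B = "base_set ?I V f E" and ?C = "base_set ?L V h E"
  define \<Phi> where "\<Phi> x = surface_density a ?I f' (graph_point ?I f x) * indicator ?B x" for x
  define \<Psi> where "\<Psi> x = surface_density a ?L h' (graph_point ?L h x) * indicator ?C x" for x
  have \<Phi>_meas [measurable]: "\<Phi> \<in> borel_measurable borel"
    unfolding \<Phi>_def[abs_def] by (rule surface_integrand_measurable[OF F E(1)])
  have \<Psi>_meas [measurable]: "\<Psi> \<in> borel_measurable borel"
    unfolding \<Psi>_def[abs_def] by (rule surface_integrand_measurable[OF H E(1)])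
  have fiber: "(\<integral>\<^sup>+t. ennreal (normal_density 0 (a q) t) * \<Psi> (w + t *\<^sub>R basis_vec q) \<partial>lborel) =
      (\<integral>\<^sup>+s. ennreal (normal_density 0 (a p) s) * \<Phi> (w + s *\<^sub>R basis_vec p) \<partial>lborel)"
    if w: "w \<in> coord_space J" for w
  proof -
    define u where "u s = w + s *\<^sub>R basis_vec p" for s
    define A where "A = {s. u s \<in> ?B}"
    define X where "X s = graph_point ?I f (u s)" for s
    define \<psi> where "\<psi> s = coord (X s) q" for s
    define \<psi>' where "\<psi>' s = graph_row f' (X s) p q" for s
    define G where "G t = ennreal (normal_density 0 (a q) t) * \<Psi> (w + t *\<^sub>R basis_vec q)" for t
    \<comment> \<open>Both charts parametrize the same points of \<open>E\<close> above \<open>w\<close>; this gives the image and the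
      injectivity of \<open>\<psi>\<close>.\<close>
    note fib_p = base_set_fiber[OF F E(2) pq(1) w, folded u_def X_def]
    note fib_q = base_set_fiber[OF H E(2) pq(2) w]
    have X: "X s \<in> E" "coord_proj J (X s) = w" "coord (X s) p = s" if "s \<in> A" for s
      using fib_p[of s "X s"] that by (auto simp: A_def X_def)
    have XV: "X s \<in> V" if "s \<in> A" for s using X(1)[OF that] E by auto
    have X_q: "w + \<psi> s *\<^sub>R basis_vec q \<in> ?C" "X s = graph_point ?L h (w + \<psi> s *\<^sub>R basis_vec q)"
      if "s \<in> A" for s
      using fib_q[of "\<psi> s" "X s"] X[OF that] by (auto simp: \<psi>_def)
    have img: "\<psi> ` A = {t. w + t *\<^sub>R basis_vec q \<in> ?C}"
    proof (intro equalityI subsetI)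
      fix t assume "t \<in> \<psi> ` A"
      then show "t \<in> {t. w + t *\<^sub>R basis_vec q \<in> ?C}" using X_q(1) by auto
    next
      fix t assume "t \<in> {t. w + t *\<^sub>R basis_vec q \<in> ?C}"
      then obtain x where x: "x \<in> E" "coord_proj J x = w" "coord x q = t"
        using fib_q[of t "graph_point ?L h (w + t *\<^sub>R basis_vec q)"] by auto
      then have "u (coord x p) \<in> ?B" "x = X (coord x p)"
        using fib_p[of "coord x p" x] by (auto simp: X_def)
      then have "coord x p \<in> A" "t = \<psi> (coord x p)"
        using x(3) by (simp_all add: A_def \<psi>_def flip: \<open>x = X (coord x p)\<close>)
      then show "t \<in> \<psi> ` A" by blast
    qed
    have inj: "inj_on \<psi> A"
    proof (rule inj_onI)
      fix s s' assume s: "s \<in> A" "s' \<in> A" "\<psi> s = \<psi> s'"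
      have "X s = X s'"
        unfolding X_q(2)[OF s(1)] X_q(2)[OF s(2)] s(3) ..
      then have "coord (X s) p = coord (X s') p" by (rule arg_cong)
      then show "s = s'" unfolding X(3)[OF s(1)] X(3)[OF s(2)] .
    qed
    have B_borel: "?B \<in> sets borel" and C_borel: "?C \<in> sets borel"
      by (rule base_set_borel[OF F E(1)], rule base_set_borel[OF H E(1)])
    have u_cont: "continuous_on S u" for S
      unfolding u_def[abs_def] by (intro continuous_intros)
    have "u -` ?B \<in> sets borel"
      by (rule measurable_sets_borel[OF borel_measurable_continuous_onI[OF u_cont] B_borel])
    moreover have "u -` ?B = A" by (auto simp: A_def)
    ultimately have A_borel: "A \<in> sets borel" by simp
    have "(\<lambda>t. w + t *\<^sub>R basis_vec q) -` ?C \<in> sets borel"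
      by (intro measurable_sets_borel[OF borel_measurable_continuous_onI C_borel] continuous_intros)
    then have img_borel: "\<psi> ` A \<in> sets borel"
      unfolding img by (simp add: vimage_def)
    have uD: "u s \<in> cylinder ?I V" if "s \<in> A" for s
      using that by (simp add: A_def base_set_def)
    have der: "(\<psi> has_real_derivative \<psi>' s) (at s within A)" if s: "s \<in> A" for s
    proof -
      have "((\<lambda>x. coord (graph_point ?I f x) q) has_derivative
          (\<lambda>v. coord (coord_proj ?I v + f' (u s) v) q)) (at (w + s *\<^sub>R basis_vec p))"
        unfolding graph_point_def u_def[symmetric]
        by (intro has_derivative_coord has_derivative_add has_derivative_coord_proj has_derivative_ident
            C1_graph_derivative[OF F uD[OF s]])
      from has_real_derivative_along_line[OF this]
      have "(\<psi> has_real_derivative coord (coord_proj ?I (basis_vec p) + f' (u s) (basis_vec p)) q) (at s)"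
        by (simp add: \<psi>_def[abs_def] X_def u_def)
      \<comment> \<open>The base point and the point of the surface above it have the same projection.\<close>
      moreover have "f' (u s) = f' (X s)"
      proof -
        have "coord_proj ?I (X s) = coord_proj ?I (u s)"
          unfolding X_def by (rule graph_point_in(2)[OF F uD[OF s]])
        moreover have "X s \<in> cylinder ?I V" using XV[OF s] subset_cylinder by auto
        ultimately show ?thesis
          using C1_graph_derivative_proj(2)[OF F] uD[OF s] by metis
      qed
      ultimately have "(\<psi> has_real_derivative \<psi>' s) (at s)"
        by (simp add: \<psi>'_def graph_row_def coord_proj_basis_vec)
      then show ?thesis by (rule has_field_derivative_at_within)
    qed
    have X_cont: "continuous_on A X"
      unfolding X_def[abs_def]
      by (rule continuous_on_compose2[OF continuous_on_graph_point[OF F] u_cont]) (use uD in auto)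
    have "continuous_on A (\<lambda>s. f' (X s))"
      by (rule continuous_on_compose2[OF C1_graph_continuous[OF F] X_cont]) (use XV subset_cylinder in auto)
    then have "continuous_on A \<psi>'"
      unfolding \<psi>'_def[abs_def] graph_row_def by (intro continuous_intros)
    then have \<psi>'_meas: "\<psi>' \<in> borel_measurable (restrict_space borel A)"
      by (rule borel_measurable_continuous_on_restrict)
    have G_meas: "G \<in> borel_measurable borel"
      unfolding G_def[abs_def] by measurable
    have "(\<integral>\<^sup>+t. G t \<partial>lborel) = (\<integral>\<^sup>+t. G t * indicator (\<psi> ` A) t \<partial>lborel)"
      by (rule nn_integral_cong) (auto simp: G_def \<Psi>_def img indicator_def)
    also have "\<dots> = (\<integral>\<^sup>+s. ennreal \<bar>\<psi>' s\<bar> * G (\<psi> s) * indicator A s \<partial>lborel)"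
      by (rule nn_integral_substitution_inj[OF A_borel img_borel der inj \<psi>'_meas G_meas])
    also have "\<dots> = (\<integral>\<^sup>+s. ennreal (normal_density 0 (a p) s) * \<Phi> (u s) \<partial>lborel)"
    proof (rule nn_integral_cong)
      fix s
      show "ennreal \<bar>\<psi>' s\<bar> * G (\<psi> s) * indicator A s = ennreal (normal_density 0 (a p) s) * \<Phi> (u s)"
      proof (cases "s \<in> A")
        case True
        have "\<Psi> (w + \<psi> s *\<^sub>R basis_vec q) = surface_density a ?L h' (X s)"
          unfolding \<Psi>_def X_q(2)[OF True, symmetric] using X_q(1)[OF True] by simp
        then have 1: "G (\<psi> s) = ennreal (normal_density 0 (a q) (\<psi> s)) * surface_density a ?L h' (X s)"
          by (simp only: G_def)
        have 2: "\<Phi> (u s) = surface_density a ?I f' (X s)"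
          using True by (simp add: \<Phi>_def X_def A_def)
        have "ennreal (normal_density 0 (a p) s) * surface_density a ?I f' (X s) =
            ennreal \<bar>\<psi>' s\<bar> * (ennreal (normal_density 0 (a q) (\<psi> s)) * surface_density a ?L h' (X s))"
          using surface_density_exchange[OF a F H XV[OF True] pq]
          unfolding X(3)[OF True] \<psi>_def \<psi>'_def .
        then show ?thesis
          unfolding 1 2 using True by simp
      qed (simp add: A_def \<Phi>_def)
    qed
    finally show ?thesis by (simp only: G_def u_def)
  qed
  have "local_measure a ?L h E = (\<integral>\<^sup>+x. \<Psi> x \<partial>gauss_measure a ?L)"
    unfolding \<Psi>_def[abs_def] local_measure_eq[OF a H E(2)] ..
  also have "\<dots> = (\<integral>\<^sup>+w. (\<integral>\<^sup>+t. ennreal (normal_density 0 (a q) t) * \<Psi> (w + t *\<^sub>R basis_vec q) \<partial>lborel) \<partial>gauss_measure a J)"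
    by (rule nn_integral_gauss_measure_insert[OF a pq(2) \<Psi>_meas])
  also have "\<dots> = (\<integral>\<^sup>+w. (\<integral>\<^sup>+s. ennreal (normal_density 0 (a p) s) * \<Phi> (w + s *\<^sub>R basis_vec p) \<partial>lborel) \<partial>gauss_measure a J)"
    by (rule nn_integral_cong) (simp add: fiber space_gauss_measure)
  also have "\<dots> = (\<integral>\<^sup>+x. \<Phi> x \<partial>gauss_measure a ?I)"
    by (rule nn_integral_gauss_measure_insert[OF a pq(1) \<Phi>_meas, symmetric])
  also have "\<dots> = local_measure a ?I f E"
    unfolding \<Phi>_def[abs_def] local_measure_eq[OF a F E(2)] ..
  finally show ?thesis .
qed

section \<open>Independence of the chart\<close>

lemma local_measure_UN:
  assumes a: "\<And>i. 0 < a i" and F: "C1_graph I V f f'"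
    and E: "\<And>n :: nat. E n \<in> sets borel" "\<And>n. E n \<subseteq> V" and disj: "disjoint_family E"
  shows "local_measure a I f (\<Union>n. E n) = (\<Sum>n. local_measure a I f (E n))"
proof -
  let ?d = "\<lambda>x. surface_density a I f' (graph_point I f x)"
  let ?B = "\<lambda>n. base_set I V f (E n)"
  have meas: "(\<lambda>x. ?d x * indicator (?B n) x) \<in> borel_measurable (gauss_measure a I)" for n
  proof -
    have "(\<lambda>x. ?d x * indicator (?B n) x) \<in> borel_measurable (restrict_space borel (coord_space I))"
      by (rule measurable_restrict_space1[OF surface_integrand_measurable[OF F E(1)]])
    then show ?thesis by (simp add: gauss_measure_def)
  qed
  have UN: "base_set I V f (\<Union>n. E n) = (\<Union>n. ?B n)" and "disjoint_family ?B"
    using disj by (auto simp: base_set_def disjoint_family_on_def)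
  then have ind: "indicator (base_set I V f (\<Union>n. E n)) x = (\<Sum>n. indicator (?B n) x :: ennreal)" for x
    by (simp only: UN suminf_indicator)
  have "local_measure a I f (\<Union>n. E n) =
      (\<integral>\<^sup>+x. ?d x * indicator (base_set I V f (\<Union>n. E n)) x \<partial>gauss_measure a I)"
    by (rule local_measure_eq[OF a F]) (use E(2) in blast)
  also have "\<dots> = (\<integral>\<^sup>+x. (\<Sum>n. ?d x * indicator (?B n) x) \<partial>gauss_measure a I)"
    by (simp only: ind ennreal_suminf_cmult)
  also have "\<dots> = (\<Sum>n. \<integral>\<^sup>+x. ?d x * indicator (?B n) x \<partial>gauss_measure a I)"
    by (rule nn_integral_suminf[OF meas])
  also have "\<dots> = (\<Sum>n. local_measure a I f (E n))"
    by (simp only: local_measure_eq[OF a F E(2)])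
  finally show ?thesis .
qed

text \<open>
  A countable subcover, made disjoint, cuts \<open>E\<close> into countably many Borel pieces on each of which the
  two measures agree.
\<close>

lemma local_measure_eq_of_locally_eq:
  assumes a: "\<And>i. 0 < a i" and F: "C1_graph I V f f'" and H: "C1_graph L V h h'"
    and loc: "\<And>x. x \<in> V \<Longrightarrow> \<exists>W. open W \<and> x \<in> W \<and>
      (\<forall>E\<in>sets borel. E \<subseteq> V \<inter> W \<longrightarrow> local_measure a L h E = local_measure a I f E)"
    and E: "E \<in> sets borel" "E \<subseteq> V"
  shows "local_measure a L h E = local_measure a I f E"
proof (cases "V = {}")
  case True
  then show ?thesis using E by (simp add: local_measure_def)
next
  case False
  define \<W> where "\<W> = {W. open W \<and>
      (\<forall>E\<in>sets borel. E \<subseteq> V \<inter> W \<longrightarrow> local_measure a L h E = local_measure a I f E)}"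
  have "open W" if "W \<in> \<W>" for W using that by (simp add: \<W>_def)
  then obtain \<W>' where \<W>': "\<W>' \<subseteq> \<W>" "countable \<W>'" "\<Union>\<W>' = \<Union>\<W>"
    by (rule Lindelof)
  have V: "V \<subseteq> \<Union>\<W>'"
    unfolding \<W>'(3)
  proof
    fix x assume "x \<in> V"
    from loc[OF this] obtain W where "W \<in> \<W>" "x \<in> W"
      unfolding \<W>_def by blast
    then show "x \<in> \<Union>\<W>" by blast
  qed
  with False have ne: "\<W>' \<noteq> {}" by auto
  define W where "W n = from_nat_into \<W>' n" for n
  have W_in: "W n \<in> \<W>" for n
    using from_nat_into[OF ne] \<W>'(1) by (auto simp: W_def)
  then have W_open: "open (W n)" for n by (auto simp: \<W>_def)
  have UW: "(\<Union>n. W n) = \<Union>\<W>'"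
    using range_from_nat_into[OF ne \<W>'(2)] by (simp add: W_def[abs_def])
  define D where "D n = E \<inter> disjointed W n" for n
  have D_borel: "D n \<in> sets borel" for n
    unfolding D_def disjointed_def using E(1) W_open by (intro sets.Int sets.Diff sets.finite_UN) auto
  have D_sub: "D n \<subseteq> V" "D n \<subseteq> V \<inter> W n" for n
    using E(2) disjointed_subset[of W n] by (auto simp: D_def)
  have D_disj: "disjoint_family D"
    unfolding D_def
    by (rule disjoint_family_subset[OF disjoint_family_disjointed[of W]]) blast
  have UD: "(\<Union>n. D n) = E"
  proof -
    have "(\<Union>n. D n) = E \<inter> (\<Union>n. disjointed W n)" by (simp add: D_def)
    also have "\<dots> = E \<inter> \<Union>\<W>'" by (simp only: UN_disjointed_eq UW)
    also have "\<dots> = E" using V E(2) by auto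
    finally show ?thesis .
  qed
  have "local_measure a L h (D n) = local_measure a I f (D n)" for n
    using W_in[of n] D_borel[of n] D_sub(2)[of n] by (simp add: \<W>_def)
  then show ?thesis
    using local_measure_UN[OF a F D_borel D_sub(1) D_disj] local_measure_UN[OF a H D_borel D_sub(1) D_disj]
    by (simp add: UD)
qed

text \<open>
  Both functions agree on the common base, but their values elsewhere are arbitrary. The normal
  factor is unaffected because it depends only on the derivative, a local datum.
\<close>

lemma local_measure_same_index:
  assumes a: "\<And>i. 0 < a i" and F: "C1_graph I V f f'" and H: "C1_graph I V h h'" and E: "E \<subseteq> V"
  shows "local_measure a I h E = local_measure a I f E"
proof -
  have gp: "graph_point I h x = graph_point I f x" if x: "x \<in> cylinder I V" for x
  proof -
    have "graph_point I h (graph_point I f x) = graph_point I f x"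
      by (rule graph_point_of_mem[OF H graph_point_in(1)[OF F x]])
    then show ?thesis
      unfolding graph_point_def[of I h] graph_point_in(2)[OF F x] .
  qed
  have der: "h' x = f' x" if x: "x \<in> V" for x
  proof (rule blinfun_eqI)
    fix v
    have xD: "x \<in> cylinder I V" using x subset_cylinder by auto
    have "coord_proj I (coord_proj I v + f' x v) = coord_proj I v"
      by (simp add: coord_proj_linear_simps C1_graph_derivative_range[OF F xD])
    with C1_graph_tangent[OF F H x, of v] show "h' x v = f' x v"
      by (simp add: C1_graph_derivative_proj(1)[OF H xD])
  qed
  have "base_set I V h E = base_set I V f E"
    unfolding base_set_def using gp by auto
  moreover have "surface_density a I h' (graph_point I h x) * indicator (base_set I V f E) x =
      surface_density a I f' (graph_point I f x) * indicator (base_set I V f E) x" for x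
  proof (cases "x \<in> base_set I V f E")
    case True
    then have "graph_point I f x \<in> V" "x \<in> cylinder I V" using E by (auto simp: base_set_def)
    then show ?thesis by (simp add: gp surface_density_def graph_row_def[abs_def] der)
  qed simp
  ultimately show ?thesis
    by (simp only: local_measure_eq[OF a F E] local_measure_eq[OF a H E])
qed

text \<open>
  Each step exchanges one index of \<open>I - L\<close> for one of \<open>L - I\<close>. The intermediate charts exist only
  locally, and the exchanged \<open>q\<close> depends on the point, which is why the induction hypothesis is used on
  small pieces of \<open>V\<close> that are glued together afterwards.
\<close>

theorem local_measure_independent:
  assumes a: "\<And>i. 0 < a i" and "C1_graph I V f f'" and H: "C1_graph L V h h'"
    and "finite (I - L)" "finite (L - I)" "card (I - L) = card (L - I)"
    and "E \<in> sets borel" "E \<subseteq> V"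
  shows "local_measure a L h E = local_measure a I f E"
  using assms(2-)
proof (induction "card (I - L)" arbitrary: I V f f' E)
  case 0
  have "I - L = {}"
    by (rule card_0_eq[OF "0.prems"(3), THEN iffD1]) (rule "0.hyps"[symmetric])
  moreover have "L - I = {}"
    by (rule card_0_eq[OF "0.prems"(4), THEN iffD1]) (rule trans[OF "0.prems"(5)[symmetric] "0.hyps"[symmetric]])
  ultimately have eq: "L = I" by blast
  show ?case
    unfolding eq
    by (rule local_measure_same_index[OF a "0.prems"(1) "0.prems"(2)[unfolded eq] "0.prems"(7)])
next
  case (Suc n)
  note F = Suc.prems(1) and H = Suc.prems(2)
  obtain p where p: "p \<in> I" "p \<notin> L"
  proof -
    have "I - L \<noteq> {}" using Suc.hyps(2) by (intro notI) simp
    then show ?thesis using that by blast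
  qed
  define J where "J = I - {p}"
  have I: "I = insert p J" and pJ: "p \<notin> J" using p by (auto simp: J_def)
  show ?case
  proof (rule local_measure_eq_of_locally_eq[OF a F H _ Suc.prems(6,7)])
    fix x assume x: "x \<in> V"
    obtain q where q: "q \<in> L" "q \<notin> I" "graph_row f' x p q \<noteq> 0"
      by (rule graph_row_nonzero[OF F H x p])
    then have qJ: "q \<notin> J" "p \<noteq> q" using I by auto
    obtain W g g' where W: "open W" "x \<in> W" "C1_graph (insert q J) (V \<inter> W) g g'"
      by (rule C1_graph_exchange[OF F[unfolded I] x pJ qJ q(3)])
    have diff1: "insert q J - L = (I - L) - {p}" and diff2: "L - insert q J = (L - I) - {q}"
      using p q by (auto simp: J_def)
    have "local_measure a L h E' = local_measure a I f E'" if E': "E' \<in> sets borel" "E' \<subseteq> V \<inter> W" for E'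
    proof -
      have "local_measure a L h E' = local_measure a (insert q J) g E'"
      proof (rule Suc.hyps(1)[OF _ W(3) C1_graph_restrict[OF H W(1)] _ _ _ E'])
        show "n = card (insert q J - L)" "card (insert q J - L) = card (L - insert q J)"
          unfolding diff1 diff2 using Suc.hyps(2) Suc.prems(3-5) p q by (simp_all add: card_Diff_singleton)
        show "finite (insert q J - L)" "finite (L - insert q J)"
          unfolding diff1 diff2 using Suc.prems by simp_all
      qed
      also have "\<dots> = local_measure a I f E'"
        unfolding I
        by (rule local_measure_exchange[OF a C1_graph_restrict[OF F[unfolded I] W(1)] W(3) pJ qJ E'])
      finally show ?thesis .
    qed
    then show "\<exists>W. open W \<and> x \<in> W \<and>
        (\<forall>E\<in>sets borel. E \<subseteq> V \<inter> W \<longrightarrow> local_measure a L h E = local_measure a I f E)"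
      using W by blast
  qed
qed

text \<open>
  Composition with the projection turns openness and differentiability relative to the subspace into
  the corresponding properties in \<open>ell2\<close>.
\<close>

lemma coordinate_triple_C1_graph:
  assumes "coordinate_triple I\<^sub>0 S V I f"
  obtains f' where "C1_graph I V f f'"
proof -
  obtain U\<^sub>I g where U: "openin (top_of_set (coord_space I)) U\<^sub>I"
    and C1: "C1_map (coord_space I) U\<^sub>I (coord_space (- I)) f"
    and hom: "homeomorphism V U\<^sub>I (coord_proj I) g"
    and V: "V = {y + f y | y. y \<in> U\<^sub>I}"
    using assms unfolding coordinate_triple_def by blast
  obtain d where d: "\<And>y. y \<in> U\<^sub>I \<Longrightarrow> (f has_derivative blinfun_apply (d y)) (at y within U\<^sub>I)"
    and d_cont: "continuous_on U\<^sub>I d" and f: "f ` U\<^sub>I \<subseteq> coord_space (- I)"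
    using C1 unfolding C1_map_def by blast
  have PV: "coord_proj I ` V = U\<^sub>I" using hom by (simp add: homeomorphism_def)
  obtain T where T: "open T" "U\<^sub>I = coord_space I \<inter> T"
    using U by (auto simp: openin_open)
  have cyl: "cylinder I V = coord_proj I -` T"
    unfolding cylinder_def PV T(2) by auto
  have "isCont (coord_proj I) x" for x
    by (rule linear_continuous_at[OF bounded_linear_coord_proj])
  then have op: "open (cylinder I V)"
    unfolding cyl by (rule continuous_open_vimage[OF T(1)])
  have cylU: "coord_proj I x \<in> U\<^sub>I" if "x \<in> cylinder I V" for x
    using that by (simp add: cylinder_def PV)
  define P where "P = Blinfun (coord_proj I)"
  have P: "blinfun_apply P = coord_proj I"
    unfolding P_def by (rule bounded_linear_Blinfun_apply[OF bounded_linear_coord_proj])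
  have "C1_graph I V f (\<lambda>x. d (coord_proj I x) o\<^sub>L P)"
    unfolding C1_graph_def
  proof (intro conjI ballI op)
    fix x assume "x \<in> V"
    then obtain y where y: "y \<in> U\<^sub>I" "x = y + f y" using V by blast
    have "coord_proj I y = y" using y(1) T(2) by auto
    moreover have "f y \<in> coord_space (- I)" using f y(1) by blast
    then have "coord_proj (- I) (f y) = f y" by auto
    moreover have "coord_proj I (coord_proj (- I) (f y)) = 0" by simp
    moreover have "coord_proj (- I) (coord_proj I y) = 0"
      using coord_proj_compl_zero[of "- I" y] by simp
    ultimately show "f (coord_proj I x) = coord_proj (- I) x"
      unfolding y(2) by (simp add: coord_proj_linear_simps)
  next
    fix x assume x: "x \<in> cylinder I V"
    have "(coord_proj I has_derivative coord_proj I) (at x within cylinder I V)"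
      by (rule bounded_linear_imp_has_derivative[OF bounded_linear_coord_proj])
    moreover have "(f has_derivative d (coord_proj I x)) (at (coord_proj I x) within coord_proj I ` cylinder I V)"
      by (rule has_derivative_subset[OF d[OF cylU[OF x]]]) (use cylU in auto)
    ultimately have "((\<lambda>x. f (coord_proj I x)) has_derivative (\<lambda>v. d (coord_proj I x) (coord_proj I v)))
        (at x within cylinder I V)"
      by (rule has_derivative_in_compose)
    then show "((\<lambda>x. f (coord_proj I x)) has_derivative blinfun_apply (d (coord_proj I x) o\<^sub>L P)) (at x)"
      unfolding at_within_open[OF x op] by (simp add: P blinfun_apply_blinfun_compose[abs_def] comp_def)
  next
    have "continuous_on (cylinder I V) (\<lambda>x. d (coord_proj I x))"
      by (rule continuous_on_compose2[OF d_cont continuous_on_coord_proj[OF continuous_on_id]])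
         (use cylU in auto)
    then show "continuous_on (cylinder I V) (\<lambda>x. d (coord_proj I x) o\<^sub>L P)"
      by (intro continuous_intros)
  qed
  then show ?thesis by (rule that)
qed

text \<open>
  Inside a finite set that contains all differences, \<open>I\<close>, \<open>L\<close> and \<open>I\<^sub>0\<close> have the same number of
  elements.
\<close>

lemma index_class_card_diff:
  assumes "I \<in> index_class I\<^sub>0" "L \<in> index_class I\<^sub>0"
  shows "finite (I - L)" "finite (L - I)" "card (I - L) = card (L - I)"
proof -
  have *: "finite (A - I\<^sub>0) \<and> finite (I\<^sub>0 - A) \<and> card (A - I\<^sub>0) = card (I\<^sub>0 - A)"
    if "A \<in> index_class I\<^sub>0" for A
  proof -
    from that obtain K\<^sub>1 K\<^sub>2 where K: "K\<^sub>1 \<subseteq> A" "K\<^sub>2 \<subseteq> - A" "finite K\<^sub>1" "finite K\<^sub>2" "card K\<^sub>1 = card K\<^sub>2"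
      "I\<^sub>0 = (A - K\<^sub>1) \<union> K\<^sub>2"
      unfolding index_class_def index_equiv_def by blast
    then have "A - I\<^sub>0 = K\<^sub>1" "I\<^sub>0 - A = K\<^sub>2" by blast+
    then show ?thesis using K(3-5) by (simp only:)
  qed
  define F where "F = (I - I\<^sub>0) \<union> (I\<^sub>0 - I) \<union> (L - I\<^sub>0) \<union> (I\<^sub>0 - L)"
  have finF: "finite F" using *[OF assms(1)] *[OF assms(2)] by (simp add: F_def)
  have card_F: "card (A \<inter> F) = card (I\<^sub>0 \<inter> F)"
    if "finite (A - I\<^sub>0)" "finite (I\<^sub>0 - A)" "card (A - I\<^sub>0) = card (I\<^sub>0 - A)"
      "A - I\<^sub>0 \<subseteq> F" "I\<^sub>0 - A \<subseteq> F" for A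
  proof -
    define B where "B = A \<inter> I\<^sub>0 \<inter> F"
    have "A \<inter> F = B \<union> (A - I\<^sub>0)" "I\<^sub>0 \<inter> F = B \<union> (I\<^sub>0 - A)"
      using that(4,5) by (auto simp: B_def)
    moreover have "card (B \<union> (A - I\<^sub>0)) = card B + card (A - I\<^sub>0)"
      using that(1) finF by (intro card_Un_disjoint) (auto simp: B_def)
    moreover have "card (B \<union> (I\<^sub>0 - A)) = card B + card (I\<^sub>0 - A)"
      using that(2) finF by (intro card_Un_disjoint) (auto simp: B_def)
    ultimately show ?thesis using that(3) by (simp only:)
  qed
  have "card (I \<inter> F) = card (I\<^sub>0 \<inter> F)"
    by (rule card_F) (use *[OF assms(1)] in \<open>auto simp: F_def\<close>)
  moreover have "card (L \<inter> F) = card (I\<^sub>0 \<inter> F)"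
    by (rule card_F) (use *[OF assms(2)] in \<open>auto simp: F_def\<close>)
  ultimately have eq: "card (I \<inter> F) = card (L \<inter> F)" by simp
  have sub: "I - L \<subseteq> F" "L - I \<subseteq> F" by (auto simp: F_def)
  then show "finite (I - L)" "finite (L - I)" using finF finite_subset by auto
  have "card (I \<inter> F - L \<inter> F) = card (L \<inter> F - I \<inter> F)"
  proof (rule antisym)
    show "card (I \<inter> F - L \<inter> F) \<le> card (L \<inter> F - I \<inter> F)"
      by (rule card_le_sym_Diff) (use finF eq in simp_all)
    show "card (L \<inter> F - I \<inter> F) \<le> card (I \<inter> F - L \<inter> F)"
      by (rule card_le_sym_Diff) (use finF eq in simp_all)
  qed
  moreover have "I \<inter> F - L \<inter> F = I - L" "L \<inter> F - I \<inter> F = L - I" using sub by auto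
  ultimately show "card (I - L) = card (L - I)" by (simp only:)
qed

theorem lemma4p5:
  fixes a :: "nat \<Rightarrow> real" and I\<^sub>0 I\<^sub>1 I\<^sub>2 :: "nat set" and S U U\<^sub>1 E :: "ell2 set"
    and \<A> :: "(ell2 set \<times> nat set \<times> (ell2 \<Rightarrow> ell2)) set" and f f' :: "ell2 \<Rightarrow> ell2"
  assumes "\<And>i. 0 < a i" and "summable a"
    and "I\<^sub>0 \<noteq> {}"
    and "C1_surface I\<^sub>0 S \<A>"
    and "open U" and "coordinate_triple I\<^sub>0 S (S \<inter> U) I\<^sub>1 f"
    and "open U\<^sub>1" and "coordinate_triple I\<^sub>0 S (S \<inter> U\<^sub>1) I\<^sub>2 f'"
    and "S \<inter> U \<inter> U\<^sub>1 \<noteq> {}"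
    and "E \<in> sets (restrict_space borel (S \<inter> U \<inter> U\<^sub>1))"
  shows "local_measure a I\<^sub>2 f' E = local_measure a I\<^sub>1 f E"
proof -
  obtain d where d: "C1_graph I\<^sub>1 (S \<inter> U) f d"
    by (rule coordinate_triple_C1_graph[OF assms(6)])
  obtain d' where d': "C1_graph I\<^sub>2 (S \<inter> U\<^sub>1) f' d'"
    by (rule coordinate_triple_C1_graph[OF assms(8)])
  let ?V = "S \<inter> U \<inter> U\<^sub>1"
  have F: "C1_graph I\<^sub>1 ?V f d" by (rule C1_graph_restrict[OF d assms(7)])
  have "S \<inter> U\<^sub>1 \<inter> U = ?V" by auto
  with C1_graph_restrict[OF d' assms(5)] have H: "C1_graph I\<^sub>2 ?V f' d'" by simp
  have "?V \<in> sets borel" by (rule C1_graph_borel[OF F])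
  with assms(10) have E: "E \<in> sets borel" "E \<subseteq> ?V"
    by (simp_all add: sets_restrict_space_iff)
  have "I\<^sub>1 \<in> index_class I\<^sub>0" "I\<^sub>2 \<in> index_class I\<^sub>0"
    using assms(6,8) by (simp_all add: coordinate_triple_def)
  from index_class_card_diff[OF this] show ?thesis
    by (intro local_measure_independent[OF assms(1) F H _ _ _ E])
qed

end
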